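(* Let $q=q(n)$ be a sequence of positive integers and, for each $n$, let $\iota=\iota_n$ be any map from $\{1,\dots,q\}$ to itself with $\iota\circ\iota=\mathrm{id}$. Consider the random $n\times n$ jigsaw puzzle with $q$ types of jigs and complementarity map $\iota$ (the random edge-matching puzzle with $q$ colors being the case $\iota=\mathrm{id}$). Then the following holds with high probability, i.e. with probability tending to $1$ as $n\to\infty$. (i) If $2\le q\le \frac{2}{\sqrt{e}}\,n$ for all $n$, then the puzzle has at least two non-similar solutions. (ii) If, for some fixed $\varepsilon>0$, $q\ge(2+\varepsilon)n$ for all $n$, then all solutions of the puzzle are similar. (iii) If $q=\omega(n)$, i.e. $q/n\to\infty$, then the solution of the puzzle is unique up to global rotation.
   Context: Jigs. There are $q$ jig types $1,\dots,q$ and a map $\iota:\{1,\dots,q\}\to\{1,\dots,q\}$ with $\iota\circ\iota=\mathrm{id}$; a jig of type $j$ fits exactly with jigs of type $\iota(j)$ (they are called complementary). A puzzle piece is a unit square each of whose four sides carries a jig type. Pieces may be rotated by multiples of $90^\circ$ but not flipped; apart from their jigs, all pieces are identical. Random model. Start with $n^2$ unit squares arranged in an $n\times n$ grid. A carving is an assignment of a jig type to each of the four sides of each square (including sides on the boundary of the grid) such that whenever two squares share a common side, the two sides meeting there get complementary types. The set $\Omega$ of all carvings has $q^{2n(n+1)}$ elements; the random jigsaw puzzle is obtained by choosing $\omega\in\Omega$ uniformly at random. (An edge-matching puzzle is the case $\iota=\mathrm{id}$, the types being called colors and carvings being called colorings.) Solutions. A solution of the puzzle is a placement of the $n^2$ pieces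 (keeping their jigs) into the positions of a fixed $n\times n$ grid, one piece per position, each piece with one of four orientations, such that any two adjacent pieces have complementary jigs on their common side. The planted assembly is the solution in which all pieces have their original positions and orientations. A solution induces a carving of the $n\times n$ grid. Two solutions are similar if the carvings they induce coincide up to a global rotation of the grid (by a multiple of $90^\circ$); equivalently, if the solutions differ only by a global rotation, permutation of duplicate pieces (pieces with identical jigs up to rotation), and rotation of rotationally symmetric pieces. The solution is unique up to global rotation if the only solutions are the four global rotations of the planted assembly. *)

theory Defs
  imports "HOL-Probability.Probability"
begin

text \<open>
  Positions of the grid are pairs (column, row), counted from the lower left corner.
  The sides of a square are numbered counterclockwise: 0 = right, 1 = top, 2 = left, 3 = bottom.
  A piece is the function giving the jig type of each of its sides.
\<close>

type_synonym pos = "nat \<times> nat"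
type_synonym piece = "nat \<Rightarrow> nat"
type_synonym carving = "pos \<Rightarrow> piece"

definition grid :: "nat \<Rightarrow> pos set" where
  "grid n = {..<n} \<times> {..<n}"

definition fits_together :: "nat \<Rightarrow> (nat \<Rightarrow> nat) \<Rightarrow> carving \<Rightarrow> bool" where
  "fits_together n \<iota> \<omega> \<longleftrightarrow>
     (\<forall>i j. i + 1 < n \<and> j < n \<longrightarrow> \<omega> (i + 1, j) 2 = \<iota> (\<omega> (i, j) 0)) \<and>
     (\<forall>i j. i < n \<and> j + 1 < n \<longrightarrow> \<omega> (i, j + 1) 3 = \<iota> (\<omega> (i, j) 1))"

definition carvings :: "nat \<Rightarrow> nat \<Rightarrow> (nat \<Rightarrow> nat) \<Rightarrow> carving set" where
  "carvings n q \<iota> =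
     {\<omega> \<in> grid n \<rightarrow>\<^sub>E ({..<4} \<rightarrow>\<^sub>E {1..q}). fits_together n \<iota> \<omega>}"

definition random_puzzle :: "nat \<Rightarrow> nat \<Rightarrow> (nat \<Rightarrow> nat) \<Rightarrow> carving pmf" where
  "random_puzzle n q \<iota> = pmf_of_set (carvings n q \<iota>)"

text \<open>
  Counterclockwise rotation by r quarter turns: side d of the rotated piece is side d - r
  modulo 4 of the original one; 3 * r stands for - r to avoid truncated subtraction.
\<close>

definition rotate_piece :: "nat \<Rightarrow> piece \<Rightarrow> piece" where
  "rotate_piece r c = (\<lambda>d\<in>{..<4}. c ((d + 3 * r) mod 4))"

text \<open>
  Pieces are identified by their original position. In a placement (\<pi>, \<rho>), the piece cut from
  position s is put at position \<pi> s after \<rho> s counterclockwise quarter turns.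
\<close>

type_synonym placement = "(pos \<Rightarrow> pos) \<times> (pos \<Rightarrow> nat)"

definition placements :: "nat \<Rightarrow> placement set" where
  "placements n =
     {\<pi> \<in> extensional (grid n). bij_betw \<pi> (grid n) (grid n)} \<times> (grid n \<rightarrow>\<^sub>E {..<4})"

definition induced_carving :: "nat \<Rightarrow> carving \<Rightarrow> placement \<Rightarrow> carving" where
  "induced_carving n \<omega> S =
     (\<lambda>p\<in>grid n. let s = the_inv_into (grid n) (fst S) p in rotate_piece (snd S s) (\<omega> s))"

definition solutions :: "nat \<Rightarrow> (nat \<Rightarrow> nat) \<Rightarrow> carving \<Rightarrow> placement set" where
  "solutions n \<iota> \<omega> = {S \<in> placements n. fits_together n \<iota> (induced_carving n \<omega> S)}"

text \<open>
  The quarter turn of the grid is counterclockwise, consistently with the numbering of the sides.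
\<close>

definition rotate_pos :: "nat \<Rightarrow> pos \<Rightarrow> pos" where
  "rotate_pos n = (\<lambda>(i, j). (n - 1 - j, i))"

definition global_rotation :: "nat \<Rightarrow> nat \<Rightarrow> placement" where
  "global_rotation n k = ((\<lambda>p\<in>grid n. (rotate_pos n ^^ k) p), (\<lambda>p\<in>grid n. k))"

definition planted_assembly :: "nat \<Rightarrow> placement" where
  "planted_assembly n = ((\<lambda>p\<in>grid n. p), (\<lambda>p\<in>grid n. 0))"

definition rotate_carving :: "nat \<Rightarrow> nat \<Rightarrow> carving \<Rightarrow> carving" where
  "rotate_carving n k \<omega> = induced_carving n \<omega> (global_rotation n k)"

definition similar :: "nat \<Rightarrow> carving \<Rightarrow> placement \<Rightarrow> placement \<Rightarrow> bool" where
  "similar n \<omega> S T \<longleftrightarrow>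
     (\<exists>k<4. induced_carving n \<omega> T = rotate_carving n k (induced_carving n \<omega> S))"

definition two_nonsimilar_solutions :: "nat \<Rightarrow> (nat \<Rightarrow> nat) \<Rightarrow> carving \<Rightarrow> bool" where
  "two_nonsimilar_solutions n \<iota> \<omega> \<longleftrightarrow>
     (\<exists>S\<in>solutions n \<iota> \<omega>. \<exists>T\<in>solutions n \<iota> \<omega>. \<not> similar n \<omega> S T)"

definition all_solutions_similar :: "nat \<Rightarrow> (nat \<Rightarrow> nat) \<Rightarrow> carving \<Rightarrow> bool" where
  "all_solutions_similar n \<iota> \<omega> \<longleftrightarrow>
     (\<forall>S\<in>solutions n \<iota> \<omega>. \<forall>T\<in>solutions n \<iota> \<omega>. similar n \<omega> S T)"

definition unique_up_to_rotation :: "nat \<Rightarrow> (nat \<Rightarrow> nat) \<Rightarrow> carving \<Rightarrow> bool" where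
  "unique_up_to_rotation n \<iota> \<omega> \<longleftrightarrow> solutions n \<iota> \<omega> = global_rotation n ` {..<4}"

lemma global_rotation_0: "global_rotation n 0 = planted_assembly n"
  by (simp add: global_rotation_def planted_assembly_def)

lemma finite_carvings: "finite (carvings n q \<iota>)"
proof -
  have "finite (grid n)"
    by (simp add: grid_def)
  moreover have "finite ({..<4::nat} \<rightarrow>\<^sub>E {1..q})"
    by (intro finite_PiE) simp_all
  ultimately have "finite (grid n \<rightarrow>\<^sub>E ({..<4::nat} \<rightarrow>\<^sub>E {1..q}))"
    by (rule finite_PiE)
  then show ?thesis
    unfolding carvings_def by simp
qed

lemma carvings_nonempty:
  assumes "q \<ge> 1" "\<iota> \<in> {1..q} \<rightarrow> {1..q}"
  shows "carvings n q \<iota> \<noteq> {}"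
proof -
  define c where "c = (\<lambda>d\<in>{..<4::nat}. if d < 2 then 1 else \<iota> 1)"
  have "\<iota> 1 \<in> {1..q}"
    using assms by (intro funcset_mem[OF assms(2)]) simp
  then have "c \<in> {..<4} \<rightarrow>\<^sub>E {1..q}"
    using assms(1) unfolding c_def by (intro restrict_PiE_iff[THEN iffD2]) simp
  then have "(\<lambda>p\<in>grid n. c) \<in> carvings n q \<iota>"
    by (simp add: carvings_def fits_together_def grid_def c_def)
  then show ?thesis
    by blast
qed

lemma induced_carving_planted:
  assumes "\<omega> \<in> carvings n q \<iota>"
  shows "induced_carving n \<omega> (planted_assembly n) = \<omega>"
proof
  fix p
  have \<omega>: "\<omega> \<in> grid n \<rightarrow>\<^sub>E ({..<4} \<rightarrow>\<^sub>E {1..q})"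
    using assms by (simp add: carvings_def)
  show "induced_carving n \<omega> (planted_assembly n) p = \<omega> p"
  proof (cases "p \<in> grid n")
    case True
    have inv: "the_inv_into (grid n) (\<lambda>p\<in>grid n. p) p = p"
      using True by (intro the_inv_into_f_eq) (simp_all add: inj_on_def)
    have \<omega>p: "\<omega> p \<in> {..<4} \<rightarrow>\<^sub>E {1..q}"
      using \<omega> True by (rule PiE_mem)
    have "rotate_piece 0 (\<omega> p) d = \<omega> p d" for d
      using PiE_arb[OF \<omega>p, of d] by (cases "d < 4") (simp_all add: rotate_piece_def)
    then have "rotate_piece 0 (\<omega> p) = \<omega> p" ..
    with True inv show ?thesis
      by (simp add: induced_carving_def planted_assembly_def)
  next
    case False
    then show ?thesis
      using PiE_arb[OF \<omega>] by (simp add: induced_carving_def)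
  qed
qed

end

theory Submission
  imports Defs "HOL-Real_Asymp.Real_Asymp"
begin

text \<open>
  Few types: if all solutions are similar, then the carving is determined up to rotation by the
  multiset of its pieces up to rotation. There are at most \<open>q^4 / 4 + q^2\<close> pieces up to rotation, and
  for \<open>q \<le> 2 n / sqrt e\<close> the number of multisets of \<open>n^2\<close> of them is negligible against the number
  \<open>q^(2 n^2 + 2 n)\<close> of carvings.

  Many types: an adjacency of a placement that is not an original one imposes a constraint, and
  independent constraints cost a factor \<open>q\<close> each. In a union bound over placements, one has to pay for
  the positions of the components of pieces that keep their original partners, about \<open>4 n^2\<close> per
  component, and for the pattern of these components. A single piece has four constraints, shared
  with its neighbours, which gives \<open>q^2\<close> against \<open>4 n^2\<close>; this is where \<open>q \<ge> (2 + \<epsilon>) n\<close> enters, and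
  larger components do better by isoperimetry. Hence in each window of side about \<open>2 (ln n)^2\<close> nearly
  all pieces are moved by one rigid motion, which is the same for all windows. After exchanging
  identical pieces, a remaining island of misplaced pieces meets the rim of a suitable box around it
  so rarely that the boundary of the island yields additional constraints, and the union bound rules
  it out. Near the border, where the gain is smaller, the pieces available are only those near the
  border, since all others are in place.
  If moreover \<open>q / n\<close> tends to infinity, then no piece is symmetric and no two pieces agree up to rotation.
\<close>

text \<open>At \<open>q = 2 n / sqrt e\<close> the multisets already number at most a constant times
  \<open>q^(2 n^2)\<close>; the ratio vanishes only because the border sides give carvings the
  surplus exponent \<open>2 n\<close>, worth at least \<open>4^n\<close>. For many types the
  obstacle is that a lone piece gains just the constant factor \<open>4 n^2 / q^2 < 1\<close>, too
  little to pay for recording where lone pieces sit. Hence regions of lone pieces are stored only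
  through boundaries, and \<open>complexity\<close> ignores their number. In a window of side
  \<open>s\<close>, constant factors from order \<open>s^2\<close> lone pieces must outweigh the
  loss of order \<open>q^(2 s)\<close> at the rim of the window, so \<open>s\<close> has to exceed a
  multiple of \<open>ln q\<close>; it must stay polylogarithmic, since each unit of complexity costs
  a power of the window area. A single misplaced piece among correct ones has perimeter 4, and its
  net gain of about \<open>q^2\<close> does not beat the \<open>n^2\<close> places where it can
  occur. This event is not improbable but harmless: four correct neighbours force the correct jigs.
  Probability is needed only for islands of at least two cells, and for the border, where neighbours
  are missing.\<close>

section \<open>Cells, sides and original adjacency\<close>

type_synonym cell = "int \<times> int"
type_synonym side = "cell \<times> nat"

text \<open>
  Cells have integer coordinates, so that the neighbours of border cells exist and pieces can be moved
  by rigid motions without truncation.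
\<close>

definition direction :: "nat \<Rightarrow> cell" where
  "direction d = (if d = 0 then (1, 0) else if d = 1 then (0, 1) else if d = 2 then (-1, 0) else (0, -1))"

definition across :: "side \<Rightarrow> side" where
  "across s = (fst s + direction (snd s), (snd s + 2) mod 4)"

definition sides :: "cell set \<Rightarrow> side set" where
  "sides A = A \<times> {..<4}"

definition cells :: "nat \<Rightarrow> cell set" where
  "cells n = {0..<int n} \<times> {0..<int n}"

definition nat_cell :: "cell \<Rightarrow> pos" where
  "nat_cell c = (nat (fst c), nat (snd c))"

definition jig :: "carving \<Rightarrow> side \<Rightarrow> nat" where
  "jig \<omega> s = \<omega> (nat_cell (fst s)) (snd s)"

lemma less_4_cases:
  assumes "d < (4::nat)" obtains "d = 0" | "d = 1" | "d = 2" | "d = 3"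
  using assms by linarith

lemma snd_across_less [simp]: "snd (across s) < 4"
  by (simp add: across_def)

lemma across_across:
  assumes "snd s < 4" shows "across (across s) = s"
proof -
  obtain a b d where s: "s = ((a, b), d)" by (metis prod.exhaust)
  have "d < 4" using assms s by simp
  then show ?thesis
    by (cases rule: less_4_cases) (simp_all add: s across_def direction_def)
qed

lemma direction_nonzero: "direction d \<noteq> 0"
  by (simp add: direction_def zero_prod_def)

lemma fst_across_neq: "fst (across s) \<noteq> fst s"
  using direction_nonzero[of "snd s"] by (simp add: across_def)

lemma across_neq: "across s \<noteq> s"
  using fst_across_neq by metis

lemma inj_on_across: "inj_on across {s. snd s < 4}"
  by (rule inj_on_inverseI[where g = across]) (simp add: across_across)

lemma sides_iff: "s \<in> sides A \<longleftrightarrow> fst s \<in> A \<and> snd s < 4"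
  by (cases s) (simp add: sides_def)

lemma across_in_sides: "across s \<in> sides A \<longleftrightarrow> fst (across s) \<in> A"
  by (simp add: sides_iff)

lemma finite_sides: "finite A \<Longrightarrow> finite (sides A)"
  by (simp add: sides_def)

lemma card_sides: "card (sides A) = 4 * card A"
  by (simp add: sides_def card_cartesian_product)

lemma sides_mono: "A \<subseteq> B \<Longrightarrow> sides A \<subseteq> sides B"
  by (auto simp: sides_def)

lemma finite_cells: "finite (cells n)"
  by (simp add: cells_def)

lemma card_cells: "card (cells n) = n\<^sup>2"
  by (simp add: cells_def card_cartesian_product power2_eq_square)

lemma nat_cell_in_grid: "c \<in> cells n \<Longrightarrow> nat_cell c \<in> grid n"
  by (auto simp: cells_def nat_cell_def grid_def)

lemma inj_on_nat_cell: "inj_on nat_cell (cells n)"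
  by (auto simp: inj_on_def cells_def nat_cell_def)

lemma nat_cell_image: "nat_cell ` cells n = grid n"
proof
  show "nat_cell ` cells n \<subseteq> grid n" using nat_cell_in_grid by blast
  show "grid n \<subseteq> nat_cell ` cells n"
  proof
    fix p assume "p \<in> grid n"
    then have "(int (fst p), int (snd p)) \<in> cells n" "nat_cell (int (fst p), int (snd p)) = p"
      by (auto simp: cells_def nat_cell_def grid_def)
    then show "p \<in> nat_cell ` cells n" by (metis imageI)
  qed
qed

section \<open>Carvings and the cost of independent constraints\<close>

locale puzzle =
  fixes n q :: nat and \<iota> :: "nat \<Rightarrow> nat"
  assumes q_pos: "q \<ge> 1"
    and \<iota>_closed: "\<iota> \<in> {1..q} \<rightarrow> {1..q}"
    and \<iota>_invol: "t \<in> {1..q} \<Longrightarrow> \<iota> (\<iota> t) = t"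
begin

abbreviation "G \<equiv> cells n"
abbreviation "\<Omega> \<equiv> carvings n q \<iota>"

definition fits :: "carving \<Rightarrow> bool" where
  "fits \<omega> \<longleftrightarrow> (\<forall>s \<in> sides G. across s \<in> sides G \<longrightarrow> jig \<omega> (across s) = \<iota> (jig \<omega> s))"

lemma \<iota>_in: "t \<in> {1..q} \<Longrightarrow> \<iota> t \<in> {1..q}"
  using \<iota>_closed by blast

text \<open>The given rules read each adjacency once, from its left or lower cell, whereas
  \<open>fits\<close> reads it from both cells. The second reading is free because
  \<open>\<iota>\<close> is an involution on the types that occur.\<close>

lemma fits_together_iff:
  assumes \<omega>: "\<And>p. p \<in> grid n \<Longrightarrow> \<omega> p \<in> {..<4} \<rightarrow> {1..q}"
  shows "fits_together n \<iota> \<omega> \<longleftrightarrow> fits \<omega>"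
proof
  assume F: "fits_together n \<iota> \<omega>"
  have inv: "\<iota> (\<iota> (\<omega> (i, j) d)) = \<omega> (i, j) d" if "i < n" "j < n" "d < 4" for i j d
  proof -
    have "(i, j) \<in> grid n" using that by (simp add: grid_def)
    then have "\<omega> (i, j) d \<in> {1..q}" using \<omega> that(3) by blast
    then show ?thesis by (rule \<iota>_invol)
  qed
  have R: "\<omega> (nat (a + 1), nat b) 2 = \<iota> (\<omega> (nat a, nat b) 0)"
    if "0 \<le> a" "a + 1 < int n" "0 \<le> b" "b < int n" for a b
  proof -
    have "nat (a + 1) = nat a + 1" "nat a + 1 < n" "nat b < n" using that by linarith+
    then show ?thesis using F by (simp only: fits_together_def)
  qed
  have U: "\<omega> (nat a, nat (b + 1)) 3 = \<iota> (\<omega> (nat a, nat b) 1)"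
    if "0 \<le> a" "a < int n" "0 \<le> b" "b + 1 < int n" for a b
  proof -
    have "nat (b + 1) = nat b + 1" "nat b + 1 < n" "nat a < n" using that by linarith+
    then show ?thesis using F by (simp only: fits_together_def)
  qed
  show "fits \<omega>"
    unfolding fits_def
  proof safe
    fix a b :: int and d :: nat
    assume 1: "((a, b), d) \<in> sides G" "across ((a, b), d) \<in> sides G"
    then have ab: "0 \<le> a" "a < int n" "0 \<le> b" "b < int n" "d < 4"
      by (auto simp: sides_iff cells_def)
    from \<open>d < 4\<close> show "jig \<omega> (across ((a, b), d)) = \<iota> (jig \<omega> ((a, b), d))"
    proof (cases rule: less_4_cases)
      case 1
      then show ?thesis using R[of a b] ab \<open>across _ \<in> _\<close>
        by (auto simp: jig_def nat_cell_def across_def direction_def sides_iff cells_def numeral_2_eq_2)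
    next
      case 2
      then show ?thesis using U[of a b] ab \<open>across _ \<in> _\<close>
        by (auto simp: jig_def nat_cell_def across_def direction_def sides_iff cells_def)
    next
      case 3
      then have "0 \<le> a - 1" using \<open>across _ \<in> _\<close>
        by (auto simp: across_def direction_def sides_iff cells_def)
      then have "\<omega> (nat a, nat b) 2 = \<iota> (\<omega> (nat (a - 1), nat b) 0)"
        using R[of "a - 1" b] ab by simp
      then show ?thesis using 3 ab inv[of "nat (a - 1)" "nat b" 0] \<open>0 \<le> a - 1\<close>
        by (auto simp: jig_def nat_cell_def across_def direction_def)
    next
      case 4
      then have "0 \<le> b - 1" using \<open>across _ \<in> _\<close>
        by (auto simp: across_def direction_def sides_iff cells_def)
      then have "\<omega> (nat a, nat b) 3 = \<iota> (\<omega> (nat a, nat (b - 1)) 1)"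
        using U[of a "b - 1"] ab by simp
      then show ?thesis using 4 ab inv[of "nat a" "nat (b - 1)" 1] \<open>0 \<le> b - 1\<close>
        by (auto simp: jig_def nat_cell_def across_def direction_def)
    qed
  qed
next
  assume F: "fits \<omega>"
  have *: "jig \<omega> (across s) = \<iota> (jig \<omega> s)" if "fst s \<in> G" "fst (across s) \<in> G" "snd s < 4" for s
    using F that by (auto simp: fits_def sides_iff)
  show "fits_together n \<iota> \<omega>"
    unfolding fits_together_def
  proof (intro conjI allI impI)
    fix i j assume "i + 1 < n \<and> j < n"
    then show "\<omega> (i + 1, j) 2 = \<iota> (\<omega> (i, j) 0)"
      using *[of "((int i, int j), 0)"]
      by (simp add: jig_def nat_cell_def across_def direction_def cells_def nat_add_distrib numeral_2_eq_2)
  next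
    fix i j assume "i < n \<and> j + 1 < n"
    then show "\<omega> (i, j + 1) 3 = \<iota> (\<omega> (i, j) 1)"
      using *[of "((int i, int j), 1)"]
      by (simp add: jig_def nat_cell_def across_def direction_def cells_def nat_add_distrib)
  qed
qed

lemma carvings_iff: "\<omega> \<in> \<Omega> \<longleftrightarrow> \<omega> \<in> grid n \<rightarrow>\<^sub>E ({..<4} \<rightarrow>\<^sub>E {1..q}) \<and> fits \<omega>"
proof -
  have "fits_together n \<iota> \<omega> \<longleftrightarrow> fits \<omega>" if "\<omega> \<in> grid n \<rightarrow>\<^sub>E ({..<4} \<rightarrow>\<^sub>E {1..q})"
    using that by (intro fits_together_iff) (auto simp: PiE_def Pi_def)
  then show ?thesis by (auto simp: carvings_def)
qed

lemma jig_in: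
  assumes a: "\<omega> \<in> \<Omega>" "s \<in> sides G" shows "jig \<omega> s \<in> {1..q}"
proof -
  from a have "nat_cell (fst s) \<in> grid n" "snd s < 4" using nat_cell_in_grid by (auto simp: sides_iff)
  then have "\<omega> (nat_cell (fst s)) \<in> {..<4} \<rightarrow>\<^sub>E {1..q}" using a by (auto simp: carvings_iff)
  from PiE_mem[OF this, of "snd s"] show ?thesis unfolding jig_def using \<open>snd s < 4\<close> by simp
qed

definition jig_update :: "carving \<Rightarrow> side \<Rightarrow> nat \<Rightarrow> carving" where
  "jig_update \<omega> s t = fun_upd \<omega> (nat_cell (fst s)) (fun_upd (\<omega> (nat_cell (fst s))) (snd s) t)"

lemma jig_jig_update:
  assumes "s \<in> sides G" "s' \<in> sides G"
  shows "jig (jig_update \<omega> s t) s' = (if s' = s then t else jig \<omega> s')"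
proof -
  have "nat_cell (fst s') = nat_cell (fst s) \<longleftrightarrow> fst s' = fst s"
    using assms inj_on_nat_cell by (auto simp: sides_iff inj_on_def)
  then show ?thesis by (cases s, cases s') (auto simp: jig_def jig_update_def)
qed

lemma jig_update_in:
  assumes "\<omega> \<in> grid n \<rightarrow>\<^sub>E ({..<4} \<rightarrow>\<^sub>E {1..q})" "s \<in> sides G" "t \<in> {1..q}"
  shows "jig_update \<omega> s t \<in> grid n \<rightarrow>\<^sub>E ({..<4} \<rightarrow>\<^sub>E {1..q})"
proof -
  have "nat_cell (fst s) \<in> grid n" "snd s < 4" using assms nat_cell_in_grid by (auto simp: sides_iff)
  moreover have "\<omega> (nat_cell (fst s)) \<in> {..<4} \<rightarrow>\<^sub>E {1..q}"
    using assms(1) \<open>nat_cell (fst s) \<in> grid n\<close> by (rule PiE_mem)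
  moreover have "insert (snd s) {..<4} = {..<4}" "insert (nat_cell (fst s)) (grid n) = grid n"
    using \<open>nat_cell (fst s) \<in> grid n\<close> \<open>snd s < 4\<close> by auto
  ultimately show ?thesis
    using PiE_fun_upd[of t "\<lambda>_. {1..q}" "snd s" "\<omega> (nat_cell (fst s))" "{..<4}"]
      PiE_fun_upd[of _ "\<lambda>_. {..<4} \<rightarrow>\<^sub>E {1..q}" "nat_cell (fst s)" \<omega> "grid n"] assms(1,3)
    unfolding jig_update_def by simp
qed

text \<open>Resampling of one edge: the opposite side is changed along with \<open>s\<close>, so
  that the result is again a carving. At the border of the grid there is no opposite side.\<close>

definition edge_update :: "carving \<Rightarrow> side \<Rightarrow> nat \<Rightarrow> carving" where
  "edge_update \<omega> s t =
     (let \<omega>' = jig_update \<omega> s t in if across s \<in> sides G then jig_update \<omega>' (across s) (\<iota> t) else \<omega>')"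

lemma jig_edge_update:
  assumes "s \<in> sides G" "s' \<in> sides G"
  shows "jig (edge_update \<omega> s t) s' =
    (if s' = s then t else if s' = across s then \<iota> t else jig \<omega> s')"
  using assms across_neq[of s] by (auto simp: edge_update_def Let_def jig_jig_update)

lemma edge_update_in:
  assumes \<omega>: "\<omega> \<in> \<Omega>" and s: "s \<in> sides G" and t: "t \<in> {1..q}"
  shows "edge_update \<omega> s t \<in> \<Omega>"
proof -
  have "edge_update \<omega> s t \<in> grid n \<rightarrow>\<^sub>E ({..<4} \<rightarrow>\<^sub>E {1..q})"
  proof -
    have 1: "jig_update \<omega> s t \<in> grid n \<rightarrow>\<^sub>E ({..<4} \<rightarrow>\<^sub>E {1..q})"
      using \<omega> s t unfolding carvings_iff by (intro jig_update_in) blast+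
    show ?thesis
      using 1 jig_update_in[OF 1 _ \<iota>_in[OF t]] by (simp add: edge_update_def Let_def)
  qed
  moreover have "fits (edge_update \<omega> s t)"
    unfolding fits_def
  proof (intro ballI impI)
    fix s' assume s': "s' \<in> sides G" "across s' \<in> sides G"
    have aa: "across (across s') = s'" "across (across s) = s"
      using s s' by (auto simp: sides_iff across_across)
    have f: "jig \<omega> (across s') = \<iota> (jig \<omega> s')" using \<omega> s' by (auto simp: carvings_iff fits_def)
    have e: "across s' = s \<longleftrightarrow> s' = across s" "across s' = across s \<longleftrightarrow> s' = s" using aa by metis+
    show "jig (edge_update \<omega> s t) (across s') = \<iota> (jig (edge_update \<omega> s t) s')"
      using f \<iota>_invol[OF t] across_neq[of s] across_neq[of s']
      unfolding jig_edge_update[OF s s'(1)] jig_edge_update[OF s s'(2)] e by presburger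
  qed
  ultimately show ?thesis by (simp add: carvings_iff)
qed

lemma carving_eqI:
  assumes "\<omega> \<in> \<Omega>" "\<omega>' \<in> \<Omega>" "\<And>s. s \<in> sides G \<Longrightarrow> jig \<omega> s = jig \<omega>' s"
  shows "\<omega> = \<omega>'"
proof (rule PiE_ext[of \<omega> "grid n" "\<lambda>_. {..<4} \<rightarrow>\<^sub>E {1..q}" \<omega>'])
  show "\<omega> \<in> grid n \<rightarrow>\<^sub>E ({..<4} \<rightarrow>\<^sub>E {1..q})" "\<omega>' \<in> grid n \<rightarrow>\<^sub>E ({..<4} \<rightarrow>\<^sub>E {1..q})"
    using assms by (auto simp: carvings_iff)
  then have *: "\<omega> p \<in> {..<4} \<rightarrow>\<^sub>E {1..q}" "\<omega>' p \<in> {..<4} \<rightarrow>\<^sub>E {1..q}" if "p \<in> grid n" for p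
    using that by auto
  fix p assume p: "p \<in> grid n"
  then obtain c where c: "c \<in> G" "p = nat_cell c" using nat_cell_image by blast
  show "\<omega> p = \<omega>' p"
    by (rule PiE_ext[OF *[OF p]]) (use assms(3)[of "(c, _)"] c in \<open>auto simp: jig_def sides_iff\<close>)
qed

text \<open>The map \<open>m\<close> pairs the constrained sides. The relation
  \<open>\<sigma>\<close> is left open because fitting of a placement uses \<open>\<iota>\<close>,
  while equality and symmetry of pieces use the identity.\<close>

definition satisfying :: "side set \<Rightarrow> (side \<Rightarrow> side) \<Rightarrow> (nat \<Rightarrow> nat) \<Rightarrow> carving set" where
  "satisfying K m \<sigma> = {\<omega> \<in> \<Omega>. \<forall>x \<in> K. jig \<omega> (m x) = \<sigma> (jig \<omega> x)}"

lemma finite_satisfying: "finite (satisfying K m \<sigma>)"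
  by (simp add: satisfying_def finite_carvings)

text \<open>The old jig of \<open>x\<close> can be recovered from that of \<open>m x\<close>, so
  overwriting the edge of \<open>x\<close> by an arbitrary type is injective. As
  \<open>across x\<close> occurs in no constraint, only the pair of \<open>x\<close> and
  \<open>m x\<close> is destroyed.\<close>

lemma card_satisfying_step:
  assumes K: "K \<subseteq> sides G" "x \<in> K" "m x \<in> K" "m (m x) = x" "m x \<noteq> x" "m x \<noteq> across x"
    and fresh: "across x \<notin> K" and inv: "\<And>y. y \<in> K \<Longrightarrow> y \<noteq> x \<Longrightarrow> y \<noteq> m x \<Longrightarrow> m y \<noteq> x"
    and mK: "\<And>y. y \<in> K \<Longrightarrow> m y \<in> K"
    and \<sigma>: "\<And>t. t \<in> {1..q} \<Longrightarrow> \<sigma> t \<in> {1..q} \<and> \<sigma> (\<sigma> t) = t"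
  shows "card (satisfying K m \<sigma>) * q \<le> card (satisfying (K - {x, m x}) m \<sigma>)"
proof -
  let ?f = "\<lambda>(\<omega>, t). edge_update \<omega> x t"
  have xs: "x \<in> sides G" "m x \<in> sides G" using K by auto
  have "inj_on ?f (satisfying K m \<sigma> \<times> {1..q})"
  proof (rule inj_onI; clarify)
    fix \<omega> t \<omega>' t'
    assume a: "\<omega> \<in> satisfying K m \<sigma>" "\<omega>' \<in> satisfying K m \<sigma>" "t \<in> {1..q}" "t' \<in> {1..q}"
      and eq: "edge_update \<omega> x t = edge_update \<omega>' x t'"
    have e: "jig (edge_update \<omega> x t) s = jig (edge_update \<omega>' x t') s" for s using eq by simp
    have \<omega>s: "\<omega> \<in> \<Omega>" "\<omega>' \<in> \<Omega>" using a by (auto simp: satisfying_def)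
    have t: "t = t'" using e[of x] xs by (simp add: jig_edge_update)
    have mx: "jig \<omega> (m x) = jig \<omega>' (m x)" using e[of "m x"] xs K by (simp add: jig_edge_update)
    have "jig \<omega> (m x) = \<sigma> (jig \<omega> x)" "jig \<omega>' (m x) = \<sigma> (jig \<omega>' x)"
      using a K by (auto simp: satisfying_def)
    then have x: "jig \<omega> x = jig \<omega>' x"
      using mx \<sigma> jig_in[OF \<omega>s(1) xs(1)] jig_in[OF \<omega>s(2) xs(1)] by metis
    have "jig \<omega> s = jig \<omega>' s" if s: "s \<in> sides G" for s
    proof -
      consider "s = x" | "s = across x" | "s \<noteq> x" "s \<noteq> across x" by blast
      then show ?thesis
      proof cases
        case 2
        then have "across x \<in> sides G" using s by simp
        then have "jig \<omega> (across x) = \<iota> (jig \<omega> x)" "jig \<omega>' (across x) = \<iota> (jig \<omega>' x)"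
          using \<omega>s xs by (auto simp: carvings_iff fits_def)
        then show ?thesis using 2 x by simp
      next
        case 3
        then show ?thesis using e[of s] xs s by (simp add: jig_edge_update)
      qed (use x in simp)
    qed
    then have "\<omega> = \<omega>'" by (rule carving_eqI[OF \<omega>s])
    then show "\<omega> = \<omega>' \<and> t = t'" using t by simp
  qed
  moreover have "?f ` (satisfying K m \<sigma> \<times> {1..q}) \<subseteq> satisfying (K - {x, m x}) m \<sigma>"
  proof clarify
    fix \<omega> t assume a: "\<omega> \<in> satisfying K m \<sigma>" "t \<in> {1..q}"
    then have "edge_update \<omega> x t \<in> \<Omega>" using xs by (auto simp: satisfying_def intro: edge_update_in)
    moreover have "jig (edge_update \<omega> x t) (m y) = \<sigma> (jig (edge_update \<omega> x t) y)"
      if y: "y \<in> K - {x, m x}" for y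
    proof -
      have 1: "y \<noteq> x" "y \<noteq> across x" "m y \<noteq> x" using y fresh inv[of y] by blast+
      have 2: "m y \<noteq> across x" using y fresh mK[of y] by auto
      have "y \<in> sides G" "m y \<in> sides G" using y K(1) mK[of y] by blast+
      then have "jig (edge_update \<omega> x t) (m y) = jig \<omega> (m y)" "jig (edge_update \<omega> x t) y = jig \<omega> y"
        using 1 2 xs by (simp_all add: jig_edge_update)
      then show ?thesis using a y by (auto simp: satisfying_def)
    qed
    ultimately show "edge_update \<omega> x t \<in> satisfying (K - {x, m x}) m \<sigma>"
      by (auto simp: satisfying_def)
  qed
  ultimately have "card (satisfying K m \<sigma> \<times> {1..q}) \<le> card (satisfying (K - {x, m x}) m \<sigma>)"
    by (rule card_inj_on_le) (rule finite_satisfying)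
  then show ?thesis by (simp add: card_cartesian_product)
qed

text \<open>
  A constraint with a side whose original partner is unconstrained costs a factor q. When no such
  side is left, one constraint is discarded, which frees two partners: a cycle formed by constraints
  and original adjacencies has at least two constraints.
\<close>

lemma card_satisfying:
  assumes "finite K" "K \<subseteq> sides G"
    and "\<And>x. x \<in> K \<Longrightarrow> m x \<in> K \<and> m (m x) = x \<and> m x \<noteq> x \<and> m x \<noteq> across x"
    and \<sigma>: "\<And>t. t \<in> {1..q} \<Longrightarrow> \<sigma> t \<in> {1..q} \<and> \<sigma> (\<sigma> t) = t"
  shows "real (card (satisfying K m \<sigma>)) \<le>
    real (card \<Omega>) * real q powr (- (2 * real (card K) - real (card {x \<in> K. across x \<in> K})) / 4)"
  using assms(1-3)
proof (induction "card K" arbitrary: K rule: less_induct)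
  case less
  note K = less.prems
  show ?case
  proof (cases "K = {}")
    case True
    then show ?thesis using q_pos by (simp add: satisfying_def)
  next
    case False
    define u where "u = (\<lambda>K. card {x \<in> K. across x \<in> K})"
    have q1: "real q \<ge> 1" using q_pos by simp
    have IH: "real (card (satisfying (K - {x, m x}) m \<sigma>)) \<le>
        real (card \<Omega>) * real q powr (- (2 * (real (card K) - 2) - real (u (K - {x, m x}))) / 4)"
      if "x \<in> K" for x
    proof -
      have mx: "m x \<in> K" "m x \<noteq> x" using K(3) that by auto
      have c: "card (K - {x, m x}) = card K - 2" "card K \<ge> 2"
        using K(1) that mx card_mono[of K "{x, m x}"] by (auto simp: card_Diff_subset)
      have "m y \<in> K - {x, m x}" if "y \<in> K - {x, m x}" for y
        using that K(3) \<open>x \<in> K\<close> by (metis Diff_iff insertCI insertE singletonD)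
      then have "real (card (satisfying (K - {x, m x}) m \<sigma>)) \<le>
        real (card \<Omega>) * real q powr (- (2 * real (card (K - {x, m x})) - real (u (K - {x, m x}))) / 4)"
        unfolding u_def using K c by (intro less.hyps) auto
      then show ?thesis using c by (simp add: of_nat_diff)
    qed
    show ?thesis
    proof (cases "\<exists>x\<in>K. across x \<notin> K")
      case True
      then obtain x where x: "x \<in> K" "across x \<notin> K" by blast
      have u: "u (K - {x, m x}) \<le> u K" unfolding u_def using K(1) by (intro card_mono) auto
      have "real (card (satisfying K m \<sigma>)) * real q \<le> real (card (satisfying (K - {x, m x}) m \<sigma>))"
      proof -
        have "card (satisfying K m \<sigma>) * q \<le> card (satisfying (K - {x, m x}) m \<sigma>)"
        proof (rule card_satisfying_step[OF K(2) x(1) _ _ _ _ x(2)])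
          show "m x \<in> K" "m (m x) = x" "m x \<noteq> x" "m x \<noteq> across x" using K(3)[OF x(1)] by blast+
          show "m y \<noteq> x" if "y \<in> K" "y \<noteq> m x" for y using K(3)[OF that(1)] that(2) by metis
          show "m y \<in> K" if "y \<in> K" for y using K(3)[OF that] by blast
        qed (use \<sigma> in blast)+
        then show ?thesis by (metis of_nat_le_iff of_nat_mult)
      qed
      also note IH[OF x(1)]
      finally have "real (card (satisfying K m \<sigma>)) \<le> real (card \<Omega>) *
          (real q powr (- (2 * (real (card K) - 2) - real (u (K - {x, m x}))) / 4) * real q powr (-1))"
        using q_pos by (simp add: powr_minus field_simps)
      also have "real q powr (- (2 * (real (card K) - 2) - real (u (K - {x, m x}))) / 4) * real q powr (-1)
          \<le> real q powr (- (2 * real (card K) - real (u K)) / 4)"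
        unfolding powr_add[symmetric] using u q1 by (intro powr_mono) (auto simp: field_simps)
      finally show ?thesis unfolding u_def by (simp add: mult_left_mono)
    next
      case no: False
      obtain x where x: "x \<in> K" using False by blast
      have mx: "m x \<in> K" "m x \<noteq> x" "m x \<noteq> across x" using K(3) x by auto
      have s4: "snd y < 4" if "y \<in> K" for y using that K(2) by (auto simp: sides_iff)
      have aa: "across (across y) = y" if "y \<in> K" for y using s4[OF that] by (rule across_across)
      have d: "across x \<noteq> m x" "across (m x) \<noteq> x" "across x \<noteq> across (m x)"
        using mx x aa by metis+
      \<comment> \<open>All partners are constrained here. Removing the pair also strips two further
        sides of their constrained partners, so \<open>u\<close> drops by at least 4, which makes up
        for the drop of \<open>2 * card K\<close> by 4 although no factor was gained.\<close>
      have sub: "{y \<in> K - {x, m x}. across y \<in> K - {x, m x}} \<subseteq> K - {x, m x, across x, across (m x)}"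
        using aa[OF x] aa[OF mx(1)] by auto
      have "u (K - {x, m x}) \<le> card (K - {x, m x, across x, across (m x)})"
        unfolding u_def using K(1) sub by (intro card_mono) auto
      also have "\<dots> = card K - card {x, m x, across x, across (m x)}"
        using no x mx K(1) by (intro card_Diff_subset) auto
      also have "card {x, m x, across x, across (m x)} = 4"
        using d mx across_neq[of x] across_neq[of "m x"] by (auto simp: card_insert_if)
      finally have u: "u (K - {x, m x}) \<le> card K - 4" .
      have "card K \<ge> card {x, m x, across x, across (m x)}"
        using no x mx K(1) by (intro card_mono) auto
      then have "card K \<ge> 4"
        using d mx across_neq[of x] across_neq[of "m x"] by (auto simp: card_insert_if)
      then have u': "real (u (K - {x, m x})) + 4 \<le> real (card K)" using u by linarith
      have uK: "u K = card K" unfolding u_def using no by (intro arg_cong[where f = card]) auto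
      have "card (satisfying K m \<sigma>) \<le> card (satisfying (K - {x, m x}) m \<sigma>)"
        by (intro card_mono finite_satisfying) (auto simp: satisfying_def)
      then have "real (card (satisfying K m \<sigma>)) \<le> real (card (satisfying (K - {x, m x}) m \<sigma>))" by simp
      also note IH[OF x]
      also have "real q powr (- (2 * (real (card K) - 2) - real (u (K - {x, m x}))) / 4)
          \<le> real q powr (- (2 * real (card K) - real (u K)) / 4)"
        using u' q1 uK by (intro powr_mono) auto
      finally show ?thesis unfolding u_def by (simp add: mult_left_mono)
    qed
  qed
qed

end

section \<open>Perimeters\<close>

definition boundary :: "cell set \<Rightarrow> side set" where
  "boundary A = {s \<in> sides A. fst (across s) \<notin> A}"

definition perimeter :: "cell set \<Rightarrow> nat" where
  "perimeter A = card (boundary A)"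

lemma finite_boundary: "finite A \<Longrightarrow> finite (boundary A)"
  by (simp add: boundary_def finite_sides)

lemma boundary_subset: "boundary A \<subseteq> sides A"
  by (auto simp: boundary_def)

lemma column_top:
  assumes "finite (A :: cell set)" "(x, y) \<in> A"
  obtains t b where "(x, t) \<in> A" "(x, t + 1) \<notin> A" "(x, b) \<in> A" "(x, b - 1) \<notin> A"
proof -
  let ?C = "{y. (x, y) \<in> A}"
  have "?C \<subseteq> snd ` A" by force
  then have fin: "finite ?C" using assms(1) by (meson finite_imageI finite_subset)
  have ne: "?C \<noteq> {}" using assms by auto
  have "Max ?C + 1 \<notin> ?C" using Max_ge[OF fin, of "Max ?C + 1"] by auto
  moreover have "Min ?C - 1 \<notin> ?C" using Min_le[OF fin, of "Min ?C - 1"] by auto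
  ultimately show ?thesis using that[of "Max ?C" "Min ?C"] Max_in[OF fin ne] Min_in[OF fin ne] by auto
qed

lemma row_ends:
  assumes "finite (A :: cell set)" "(x, y) \<in> A"
  obtains r l where "(r, y) \<in> A" "(r + 1, y) \<notin> A" "(l, y) \<in> A" "(l - 1, y) \<notin> A"
proof -
  have "finite (prod.swap ` A)" "(y, x) \<in> prod.swap ` A" using assms by auto
  from column_top[OF this] obtain t b where "(y, t) \<in> prod.swap ` A" "(y, t + 1) \<notin> prod.swap ` A"
    "(y, b) \<in> prod.swap ` A" "(y, b - 1) \<notin> prod.swap ` A" .
  then show ?thesis using that[of t b] by (simp add: pair_in_swap_image)
qed

text \<open>Each occupied row has a first and a last cell, and so has each occupied column; these
  contribute a boundary side in the respective direction.\<close>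

lemma boundary_dir:
  assumes A: "finite A"
  shows "card (snd ` A) \<le> card {s \<in> boundary A. snd s = 0}"
    "card (fst ` A) \<le> card {s \<in> boundary A. snd s = 1}"
    "card (snd ` A) \<le> card {s \<in> boundary A. snd s = 2}"
    "card (fst ` A) \<le> card {s \<in> boundary A. snd s = 3}"
proof -
  have fin: "finite {s \<in> boundary A. snd s = d}" for d using finite_boundary[OF A] by simp
  have "snd ` A \<subseteq> (\<lambda>s. snd (fst s)) ` {s \<in> boundary A. snd s = 0}"
  proof clarify
    fix x y assume "(x, y) \<in> A"
    from row_ends[OF A this] obtain r where r: "(r, y) \<in> A" "(r + 1, y) \<notin> A" by metis
    then have "((r, y), 0) \<in> {s \<in> boundary A. snd s = 0}"
      by (simp add: boundary_def sides_iff across_def direction_def)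
    then show "snd (x, y) \<in> (\<lambda>s. snd (fst s)) ` {s \<in> boundary A. snd s = 0}"
      by (rule rev_image_eqI) simp
  qed
  then show "card (snd ` A) \<le> card {s \<in> boundary A. snd s = 0}" by (rule surj_card_le[OF fin])
  have "snd ` A \<subseteq> (\<lambda>s. snd (fst s)) ` {s \<in> boundary A. snd s = 2}"
  proof clarify
    fix x y assume "(x, y) \<in> A"
    from row_ends[OF A this] obtain r where r: "(r, y) \<in> A" "(r - 1, y) \<notin> A" by metis
    then have "((r, y), 2) \<in> {s \<in> boundary A. snd s = 2}"
      by (simp add: boundary_def sides_iff across_def direction_def)
    then show "snd (x, y) \<in> (\<lambda>s. snd (fst s)) ` {s \<in> boundary A. snd s = 2}"
      by (rule rev_image_eqI) simp
  qed
  then show "card (snd ` A) \<le> card {s \<in> boundary A. snd s = 2}" by (rule surj_card_le[OF fin])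
  have "fst ` A \<subseteq> (\<lambda>s. fst (fst s)) ` {s \<in> boundary A. snd s = 1}"
  proof clarify
    fix x y assume "(x, y) \<in> A"
    from column_top[OF A this] obtain r where r: "(x, r) \<in> A" "(x, r + 1) \<notin> A" by metis
    then have "((x, r), 1) \<in> {s \<in> boundary A. snd s = 1}"
      by (simp add: boundary_def sides_iff across_def direction_def)
    then show "fst (x, y) \<in> (\<lambda>s. fst (fst s)) ` {s \<in> boundary A. snd s = 1}"
      by (rule rev_image_eqI) simp
  qed
  then show "card (fst ` A) \<le> card {s \<in> boundary A. snd s = 1}" by (rule surj_card_le[OF fin])
  have "fst ` A \<subseteq> (\<lambda>s. fst (fst s)) ` {s \<in> boundary A. snd s = 3}"
  proof clarify
    fix x y assume "(x, y) \<in> A"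
    from column_top[OF A this] obtain r where r: "(x, r) \<in> A" "(x, r - 1) \<notin> A" by metis
    then have "((x, r), 3) \<in> {s \<in> boundary A. snd s = 3}"
      by (simp add: boundary_def sides_iff across_def direction_def)
    then show "fst (x, y) \<in> (\<lambda>s. fst (fst s)) ` {s \<in> boundary A. snd s = 3}"
      by (rule rev_image_eqI) simp
  qed
  then show "card (fst ` A) \<le> card {s \<in> boundary A. snd s = 3}" by (rule surj_card_le[OF fin])
qed

lemma perimeter_ge_projections:
  assumes A: "finite A"
  shows "2 * (card (fst ` A) + card (snd ` A)) \<le> perimeter A"
proof -
  let ?b = "\<lambda>d. {s \<in> boundary A. snd s = d}"
  have fin: "finite (?b d)" for d using finite_boundary[OF A] by simp
  have "card (?b 0 \<union> ?b 1 \<union> ?b 2 \<union> ?b 3) = card (?b 0) + card (?b 1) + card (?b 2) + card (?b 3)"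
    using fin by (subst card_Un_disjoint, simp, simp, force)+ simp
  moreover have "card (?b 0 \<union> ?b 1 \<union> ?b 2 \<union> ?b 3) \<le> perimeter A"
    unfolding perimeter_def using finite_boundary[OF A] by (intro card_mono) auto
  ultimately show ?thesis using boundary_dir[OF A] by simp
qed

lemma card_le_projections:
  assumes "finite (A :: cell set)" shows "card A \<le> card (fst ` A) * card (snd ` A)"
proof -
  have "A \<subseteq> fst ` A \<times> snd ` A" by force
  then have "card A \<le> card (fst ` A \<times> snd ` A)" using assms by (intro card_mono) auto
  then show ?thesis by (simp add: card_cartesian_product)
qed

text \<open>The set lies in the product of its projections, and the perimeter is at least twice the
  sum of their sizes; the inequality between arithmetic and geometric mean does the rest.\<close>

lemma isoperimetric:
  assumes "finite A" shows "16 * card A \<le> (perimeter A)\<^sup>2"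
proof -
  let ?a = "card (fst ` A)" and ?b = "card (snd ` A)"
  have "16 * card A \<le> 4 * (4 * (?a * ?b))" using card_le_projections[OF assms] by simp
  also have "4 * (?a * ?b) \<le> (?a + ?b)\<^sup>2"
  proof -
    have "0 \<le> (int ?a - int ?b)\<^sup>2" by simp
    then have "4 * (int ?a * int ?b) \<le> (int ?a + int ?b)\<^sup>2" by (simp add: power2_eq_square algebra_simps)
    then show ?thesis by (metis of_nat_add of_nat_le_iff of_nat_mult of_nat_numeral of_nat_power)
  qed
  also have "4 * (?a + ?b)\<^sup>2 = (2 * (?a + ?b))\<^sup>2" by (simp only: power_mult_distrib) simp
  also have "\<dots> \<le> (perimeter A)\<^sup>2" using perimeter_ge_projections[OF assms] by (intro power_mono) auto
  finally show ?thesis by simp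
qed

lemma perimeter_ge_4: "finite A \<Longrightarrow> A \<noteq> {} \<Longrightarrow> 4 \<le> perimeter A"
proof -
  assume A: "finite A" "A \<noteq> {}"
  then have "card (fst ` A) \<ge> 1" "card (snd ` A) \<ge> 1" by (auto simp: Suc_le_eq card_gt_0_iff)
  then show ?thesis using perimeter_ge_projections[OF A(1)] by simp
qed

text \<open>The gap between 4 and 6 is what gives components of two or more pieces, and islands of
  two or more cells, some slack over single ones.\<close>

lemma perimeter_ge_6: "finite A \<Longrightarrow> 2 \<le> card A \<Longrightarrow> 6 \<le> perimeter A"
proof -
  assume A: "finite A" "2 \<le> card A"
  then have "A \<noteq> {}" by auto
  then have "card (fst ` A) \<ge> 1" "card (snd ` A) \<ge> 1" using A by (auto simp: Suc_le_eq card_gt_0_iff)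
  moreover have "\<not> (card (fst ` A) = 1 \<and> card (snd ` A) = 1)"
    using card_le_projections[OF A(1)] A(2) by auto
  ultimately have "card (fst ` A) + card (snd ` A) \<ge> 3" by arith
  then show ?thesis using perimeter_ge_projections[OF A(1)] by simp
qed

text \<open>At the right end of a row of \<open>X - Y\<close> there are two cases. If
  \<open>X\<close> ends there, it has a boundary side on a cell outside \<open>Y\<close>; otherwise
  the next cell lies in both sets and its left side is a boundary side for \<open>Y\<close> only.
  Patterns use this to store a region by its boundary.\<close>

lemma boundary_inject:
  assumes "finite A" "finite B" "boundary A = boundary B"
  shows "A = B"
proof -
  have sub: "X \<subseteq> Y" if X: "finite X" and eq: "boundary X = boundary Y" for X Y
  proof (rule ccontr)
    assume "\<not> X \<subseteq> Y"
    then obtain x y where "(x, y) \<in> X - Y" by auto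
    from row_ends[OF finite_Diff[OF X] this]
    obtain r where r: "(r, y) \<in> X - Y" "(r + 1, y) \<notin> X - Y" by metis
    show False
    proof (cases "(r + 1, y) \<in> X")
      case True
      then have "(r + 1, y) \<in> Y" using r by simp
      then have "((r + 1, y), 2) \<in> boundary Y" using r by (simp add: boundary_def sides_iff across_def direction_def)
      then have "((r + 1, y), 2) \<in> boundary X" using eq by simp
      then show False using r by (simp add: boundary_def sides_iff across_def direction_def)
    next
      case False
      then have "((r, y), 0) \<in> boundary X" using r by (simp add: boundary_def sides_iff across_def direction_def)
      then have "((r, y), 0) \<in> boundary Y" using eq by simp
      then show False using r by (simp add: boundary_def sides_iff)
    qed
  qed
  show ?thesis using sub[of A B] sub[of B A] assms by auto
qed

section \<open>Rigid motions and misplaced pieces\<close>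

definition quarter_turn :: "cell \<Rightarrow> cell" where
  "quarter_turn c = (- snd c, fst c)"

lemma quarter_turn_add: "quarter_turn (c + d) = quarter_turn c + quarter_turn d"
  by (simp add: quarter_turn_def)

lemma funpow_quarter_turn_add: "(quarter_turn ^^ k) (c + d) = (quarter_turn ^^ k) c + (quarter_turn ^^ k) d"
  by (induction k) (simp_all add: quarter_turn_add)

lemma quarter_turn_direction: "quarter_turn (direction (d mod 4)) = direction (Suc d mod 4)"
proof -
  have "d mod 4 = 0 \<or> d mod 4 = 1 \<or> d mod 4 = 2 \<or> d mod 4 = 3" by linarith
  then show ?thesis by (auto simp: quarter_turn_def direction_def mod_Suc)
qed

lemma funpow_quarter_turn_direction: "d < 4 \<Longrightarrow> (quarter_turn ^^ k) (direction d) = direction ((d + k) mod 4)"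
  by (induction k) (simp_all add: quarter_turn_direction)

lemma quarter_turn_4: "(quarter_turn ^^ 4) c = c"
  by (simp add: quarter_turn_def numeral_eq_Suc)

lemma funpow_quarter_turn_4_mult: "(quarter_turn ^^ (4 * k)) c = c"
  by (induction k arbitrary: c) (simp_all add: funpow_add quarter_turn_4)

text \<open>
  A placement sends a position to the original cell of the piece put there, together with the number
  of quarter turns applied to it. In a frame all pieces come from one rigid motion of the original
  picture; \<open>3 * k\<close> stands for \<open>- k\<close>.
\<close>

definition frame :: "nat \<Rightarrow> cell \<Rightarrow> cell \<Rightarrow> cell \<times> nat" where
  "frame k v p = ((quarter_turn ^^ (3 * k)) p + v, k)"

text \<open>The original side of the piece which appears as side \<open>s\<close> of the assembled picture.\<close>

definition orig_side :: "(cell \<Rightarrow> cell \<times> nat) \<Rightarrow> side \<Rightarrow> side" where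
  "orig_side \<phi> s = (fst (\<phi> (fst s)), (snd s + 3 * snd (\<phi> (fst s))) mod 4)"

lemma snd_orig_side_less [simp]: "snd (orig_side \<phi> s) < 4"
  by (simp add: orig_side_def)

lemma fst_orig_side: "fst (orig_side \<phi> s) = fst (\<phi> (fst s))"
  by (simp add: orig_side_def)

text \<open>A rigid motion preserves adjacency: the turn of the piece compensates the turn of the
  direction.\<close>

lemma across_orig_side_frame:
  assumes "snd s < 4" shows "across (orig_side (frame k v) s) = orig_side (frame k v) (across s)"
proof -
  have "((snd s + 3 * k) mod 4 + 2) mod 4 = ((snd s + 2) mod 4 + 3 * k) mod 4"
    by (simp add: mod_simps add_ac)
  then show ?thesis using assms
    by (simp add: across_def orig_side_def frame_def funpow_quarter_turn_add funpow_quarter_turn_direction algebra_simps)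
qed

lemma rotation_cancel:
  assumes "(e + 3 * k) mod 4 = (e + 3 * k') mod (4::nat)" "k < 4" "k' < 4"
  shows "k = k'"
proof -
  have "(e mod 4 + 3 * k) mod 4 = (e mod 4 + 3 * k') mod 4" using assms(1) by (simp add: mod_simps)
  moreover have "e mod 4 < 4" by simp
  ultimately show ?thesis using assms(2,3)
    by (elim less_4_cases) simp_all
qed

lemma direction_cancel:
  assumes "(e + 3 * k) mod 4 = (e' + 3 * k) mod (4::nat)" "e < 4" "e' < 4"
  shows "e = e'"
proof -
  have "(e + 3 * (k mod 4)) mod 4 = (e' + 3 * (k mod 4)) mod 4" using assms(1)
    by (metis mod_add_right_eq mod_mult_right_eq)
  moreover have "k mod 4 < 4" by simp
  ultimately show ?thesis using assms(2,3)
    by (elim less_4_cases) simp_all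
qed

lemma placed_eqI:
  assumes "orig_side \<phi> s = orig_side \<psi> s" "snd (\<phi> (fst s)) < 4" "snd (\<psi> (fst s)) < 4"
  shows "\<phi> (fst s) = \<psi> (fst s)"
  using assms rotation_cancel[of "snd s" "snd (\<phi> (fst s))" "snd (\<psi> (fst s))"]
  by (simp add: orig_side_def prod_eq_iff)

lemma frame_inj: "frame k v p = frame k v p' \<Longrightarrow> p = p'"
proof -
  assume "frame k v p = frame k v p'"
  then have "(quarter_turn ^^ (3 * k)) p = (quarter_turn ^^ (3 * k)) p'" by (simp add: frame_def)
  then have "(quarter_turn ^^ k) ((quarter_turn ^^ (3 * k)) p) = (quarter_turn ^^ k) ((quarter_turn ^^ (3 * k)) p')" by simp
  moreover have "k + 3 * k = 4 * k" by simp
  ultimately show ?thesis by (metis funpow_add comp_apply funpow_quarter_turn_4_mult)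
qed

text \<open>Frames spread along preserved adjacencies: the original side shown by the neighbour is
  known, and a shown side together with its direction determines both the piece and its
  rotation.\<close>

lemma preserved_same_frame:
  assumes pres: "orig_side \<phi> (across s) = across (orig_side \<phi> s)" and "snd s < 4"
    and "\<phi> (fst s) = frame k v (fst s)" "k < 4" "snd (\<phi> (fst (across s))) < 4"
  shows "\<phi> (fst (across s)) = frame k v (fst (across s))"
proof (rule placed_eqI)
  have "orig_side \<phi> s = orig_side (frame k v) s" using assms(3) by (simp add: orig_side_def)
  then show "orig_side \<phi> (across s) = orig_side (frame k v) (across s)"
    using pres across_orig_side_frame[OF assms(2)] by simp
qed (use assms in \<open>simp_all add: frame_def\<close>)

lemma frame_at:
  assumes "snd (\<phi> p) < 4"
  obtains v where "\<phi> p = frame (snd (\<phi> p)) v p"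
  using that[of "fst (\<phi> p) - (quarter_turn ^^ (3 * snd (\<phi> p))) p"] by (simp add: frame_def)

definition misplaced :: "cell set \<Rightarrow> (cell \<Rightarrow> cell \<times> nat) \<Rightarrow> (cell \<Rightarrow> cell \<times> nat) \<Rightarrow> cell set" where
  "misplaced B fr \<phi> = {p \<in> B. \<phi> p \<noteq> fr p}"

definition facing :: "cell set \<Rightarrow> cell set \<Rightarrow> side set" where
  "facing B D = {s \<in> sides (B - D). fst (across s) \<in> D}"

text \<open>The box contains no neighbour at these sides, hence no constraint; they are what has to
  be subtracted from the isoperimetric gain.\<close>

definition lost :: "cell set \<Rightarrow> cell set \<Rightarrow> side set" where
  "lost B D = {s \<in> sides D. fst (across s) \<notin> B}"

text \<open>
  Side \<open>s'\<close> shows the original partner of side \<open>s\<close>, wherever it has been put; \<open>s' = across s\<close> if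
  the adjacency is preserved.
\<close>

definition mates :: "cell set \<Rightarrow> cell set \<Rightarrow> (cell \<Rightarrow> cell \<times> nat) \<Rightarrow> (side \<times> side) set" where
  "mates B D \<phi> = {(s, s'). s \<in> sides D \<and> s' \<in> sides D \<union> facing B D \<and> orig_side \<phi> s' = across (orig_side \<phi> s)}"

text \<open>Every side of \<open>D\<close> that does not keep its original partner opposite to it
  falls into one of three classes: inner mated, outer mated, unmated. In \<open>rank4_ge\<close>
  they have the weights 1, 0 and 2, since a constraint is worth less if the original partner of its
  side is constrained as well.\<close>

definition inner_mated :: "cell set \<Rightarrow> (side \<times> side) set \<Rightarrow> side set" where
  "inner_mated D \<mu> = {s \<in> sides D. \<exists>s' \<in> sides D. (s, s') \<in> \<mu> \<and> s' \<noteq> across s}"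

definition outer_mated :: "cell set \<Rightarrow> (side \<times> side) set \<Rightarrow> side set" where
  "outer_mated D \<mu> = {s \<in> sides D. \<exists>s'. s' \<notin> sides D \<and> (s, s') \<in> \<mu>}"

definition unmated :: "cell set \<Rightarrow> (side \<times> side) set \<Rightarrow> side set" where
  "unmated D \<mu> = {s \<in> sides D. s \<notin> Domain \<mu>}"

text \<open>Preserved adjacencies are left out because every carving satisfies them.\<close>

definition constrained :: "cell set \<Rightarrow> cell set \<Rightarrow> (cell \<Rightarrow> cell \<times> nat) \<Rightarrow> side set" where
  "constrained B D \<phi> = {s \<in> sides B. fst (across s) \<in> B \<and> (fst s \<in> D \<or> fst (across s) \<in> D)
      \<and> orig_side \<phi> (across s) \<noteq> across (orig_side \<phi> s)}"

locale placed_box =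
  fixes B :: "cell set" and k :: nat and v :: cell and \<phi> :: "cell \<Rightarrow> cell \<times> nat"
  assumes fin: "finite B" and k4: "k < 4"
    and rot: "\<And>p. p \<in> B \<Longrightarrow> snd (\<phi> p) < 4"
    and inj: "inj_on (\<lambda>p. fst (\<phi> p)) B"
begin

abbreviation "fr \<equiv> frame k v"
abbreviation "D \<equiv> misplaced B fr \<phi>"
abbreviation "\<mu> \<equiv> mates B D \<phi>"

lemma D_sub: "D \<subseteq> B" and finD: "finite D"
  using fin by (auto simp: misplaced_def)

lemma facing_sub: "facing B D \<subseteq> sides B"
  by (auto simp: facing_def sides_iff)

lemma sidesD_sub: "sides D \<subseteq> sides B"
  by (rule sides_mono[OF D_sub])

lemma inj_orig_side: "inj_on (orig_side \<phi>) (sides B)"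
proof (rule inj_onI)
  fix s s' assume a: "s \<in> sides B" "s' \<in> sides B" "orig_side \<phi> s = orig_side \<phi> s'"
  then have "fst (\<phi> (fst s)) = fst (\<phi> (fst s'))" by (simp add: orig_side_def)
  moreover have "fst s \<in> B" "fst s' \<in> B" "snd s < 4" "snd s' < 4" using a by (simp_all add: sides_iff)
  ultimately have f: "fst s = fst s'" using inj by (simp add: inj_on_def)
  then have "(snd s + 3 * snd (\<phi> (fst s))) mod 4 = (snd s' + 3 * snd (\<phi> (fst s))) mod 4"
    using a(3) by (simp add: orig_side_def)
  then have "snd s = snd s'" using \<open>snd s < 4\<close> \<open>snd s' < 4\<close> by (rule direction_cancel)
  then show "s = s'" using f by (simp add: prod_eq_iff)
qed

lemma mates_functional:
  assumes "(s, s') \<in> \<mu>" "(s, s'') \<in> \<mu>" shows "s' = s''"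
proof -
  have "s' \<in> sides B" "s'' \<in> sides B" "orig_side \<phi> s' = orig_side \<phi> s''"
    using assms facing_sub sidesD_sub by (auto simp: mates_def)
  then show ?thesis using inj_orig_side by (simp add: inj_on_def)
qed

lemma mates_injective: "(s, s') \<in> \<mu> \<Longrightarrow> (t, s') \<in> \<mu> \<Longrightarrow> s = t"
proof -
  assume a: "(s, s') \<in> \<mu>" "(t, s') \<in> \<mu>"
  then have "across (orig_side \<phi> s) = across (orig_side \<phi> t)" by (auto simp: mates_def)
  then have "orig_side \<phi> s = orig_side \<phi> t" by (metis across_across snd_orig_side_less)
  then show ?thesis using inj_orig_side sidesD_sub a by (auto simp: mates_def inj_on_def)
qed

lemma mates_sym: "(s, s') \<in> \<mu> \<Longrightarrow> s' \<in> sides D \<Longrightarrow> (s', s) \<in> \<mu>"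
  by (auto simp: mates_def across_across)

lemma mates_cell_neq: "(s, s') \<in> \<mu> \<Longrightarrow> fst s \<noteq> fst s'"
proof
  assume a: "(s, s') \<in> \<mu>" "fst s = fst s'"
  then have "fst (across (orig_side \<phi> s)) = fst (\<phi> (fst s'))" by (auto simp: mates_def fst_orig_side dest: sym)
  also have "\<dots> = fst (orig_side \<phi> s)" using a by (simp add: fst_orig_side)
  finally have "fst (across (orig_side \<phi> s)) = fst (orig_side \<phi> s)" .
  then show False using fst_across_neq by blast
qed

text \<open>If the neighbour followed the frame, the frame would spread back along the preserved
  adjacency to the misplaced cell.\<close>

lemma placed_preserved:
  assumes "s \<in> sides D" "fst (across s) \<in> B" "orig_side \<phi> (across s) = across (orig_side \<phi> s)"
  shows "fst (across s) \<in> D"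
proof (rule ccontr)
  assume "fst (across s) \<notin> D"
  then have fa: "\<phi> (fst (across s)) = fr (fst (across s))" using assms(2) by (auto simp: misplaced_def)
  have s: "snd s < 4" "fst s \<in> B" "\<phi> (fst s) \<noteq> fr (fst s)" using assms(1) by (auto simp: sides_iff misplaced_def)
  have aa: "across (across s) = s" using s by (simp add: across_across)
  have "orig_side \<phi> (across (across s)) = across (orig_side \<phi> (across s))"
    using assms(3) aa by (simp add: across_across)
  from preserved_same_frame[OF this _ fa k4] s rot aa show False by simp
qed

lemma preserved_in_mates:
  "s \<in> sides D \<Longrightarrow> (s, across s) \<in> \<mu> \<longleftrightarrow> fst (across s) \<in> B \<and> orig_side \<phi> (across s) = across (orig_side \<phi> s)"
proof
  assume s: "s \<in> sides D" and m: "(s, across s) \<in> \<mu>"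
  then show "fst (across s) \<in> B \<and> orig_side \<phi> (across s) = across (orig_side \<phi> s)"
    using facing_sub sidesD_sub D_sub by (auto simp: mates_def sides_iff)
next
  assume s: "s \<in> sides D" and a: "fst (across s) \<in> B \<and> orig_side \<phi> (across s) = across (orig_side \<phi> s)"
  then have "fst (across s) \<in> D" using placed_preserved by blast
  then show "(s, across s) \<in> \<mu>" using s a by (auto simp: mates_def sides_iff)
qed

lemma lost_sub: "lost B D \<subseteq> boundary D"
  using D_sub by (auto simp: lost_def boundary_def)

lemma across_facing: "across ` facing B D = boundary D - lost B D"
proof
  show "across ` facing B D \<subseteq> boundary D - lost B D"
    by (auto simp: facing_def boundary_def lost_def sides_iff across_across)
  show "boundary D - lost B D \<subseteq> across ` facing B D"
  proof
    fix s assume s: "s \<in> boundary D - lost B D"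
    then have "across s \<in> facing B D" "s = across (across s)"
      by (auto simp: facing_def boundary_def lost_def sides_iff across_across)
    then show "s \<in> across ` facing B D" by blast
  qed
qed

lemma finite_facing: "finite (facing B D)"
  using facing_sub finite_sides[OF fin] finite_subset by blast

lemma card_facing: "card (facing B D) + card (lost B D) = perimeter D"
proof -
  have "inj_on across (facing B D)"
    by (rule inj_on_subset[OF inj_on_across]) (auto simp: facing_def sides_iff)
  then have "card (facing B D) = card (boundary D - lost B D)"
    using across_facing card_image by metis
  also have "\<dots> = perimeter D - card (lost B D)"
    unfolding perimeter_def using lost_sub finite_boundary[OF finD] finite_subset
    by (intro card_Diff_subset) auto
  finally show ?thesis
    using card_mono[OF finite_boundary[OF finD] lost_sub] by (simp add: perimeter_def)
qed

lemma finite_mated: "finite (inner_mated D \<mu>)" "finite (outer_mated D \<mu>)" "finite (unmated D \<mu>)"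
  using finite_sides[OF finD] by (auto simp: inner_mated_def outer_mated_def unmated_def)

lemma outer_mated_facing: "s \<in> outer_mated D \<mu> \<Longrightarrow> \<exists>s' \<in> facing B D. (s, s') \<in> \<mu>"
  by (auto simp: outer_mated_def mates_def)

lemma card_outer_mated: "card (outer_mated D \<mu>) \<le> card (facing B D)"
proof -
  define f where "f s = (SOME s'. s' \<in> facing B D \<and> (s, s') \<in> \<mu>)" for s
  have f: "f s \<in> facing B D \<and> (s, f s) \<in> \<mu>" if "s \<in> outer_mated D \<mu>" for s
    unfolding f_def by (rule someI_ex) (use outer_mated_facing[OF that] in blast)
  have "inj_on f (outer_mated D \<mu>)"
  proof (rule inj_onI)
    fix s t assume a: "s \<in> outer_mated D \<mu>" "t \<in> outer_mated D \<mu>" "f s = f t"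
    then have "(s, f s) \<in> \<mu>" "(t, f s) \<in> \<mu>" using f by metis+
    then show "s = t" by (rule mates_injective)
  qed
  then show ?thesis using f finite_facing by (intro card_inj_on_le[of f]) auto
qed

lemma mated_disjoint:
  "inner_mated D \<mu> \<inter> outer_mated D \<mu> = {}" "inner_mated D \<mu> \<inter> unmated D \<mu> = {}"
  "outer_mated D \<mu> \<inter> unmated D \<mu> = {}"
  using mates_functional unfolding inner_mated_def outer_mated_def unmated_def by blast+

lemma finite_constrained: "finite (constrained B D \<phi>)"
  using finite_sides[OF fin] by (auto simp: constrained_def)

lemma across_constrained: "s \<in> constrained B D \<phi> \<Longrightarrow> across s \<in> constrained B D \<phi>"
proof -
  assume s: "s \<in> constrained B D \<phi>"
  then have "orig_side \<phi> s \<noteq> across (orig_side \<phi> (across s))"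
    by (metis (mono_tags, lifting) across_across constrained_def mem_Collect_eq snd_orig_side_less)
  then show ?thesis using s by (auto simp: constrained_def sides_iff across_across)
qed

lemma facing_constrained: "facing B D \<subseteq> constrained B D \<phi>"
proof
  fix s assume s: "s \<in> facing B D"
  then have sB: "fst s \<in> B - D" "snd s < 4" "fst (across s) \<in> D" by (auto simp: facing_def sides_iff)
  have "orig_side \<phi> (across s) \<noteq> across (orig_side \<phi> s)"
  proof
    assume "orig_side \<phi> (across s) = across (orig_side \<phi> s)"
    then have "orig_side \<phi> (across (across s)) = across (orig_side \<phi> (across s))" using sB by (simp add: across_across)
    then have "fst (across (across s)) \<in> D"
      using sB by (intro placed_preserved) (auto simp: sides_iff across_across)
    then show False using sB by (simp add: across_across)
  qed
  then show "s \<in> constrained B D \<phi>" using sB D_sub by (auto simp: constrained_def sides_iff)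
qed

lemma nonpreserved_constrained:
  "(inner_mated D \<mu> \<union> outer_mated D \<mu> \<union> unmated D \<mu>) - lost B D \<subseteq> constrained B D \<phi>"
proof
  fix s assume s: "s \<in> (inner_mated D \<mu> \<union> outer_mated D \<mu> \<union> unmated D \<mu>) - lost B D"
  then have sD: "s \<in> sides D" "fst (across s) \<in> B"
    by (auto simp: inner_mated_def outer_mated_def unmated_def lost_def)
  have "(s, across s) \<notin> \<mu>"
  proof
    assume m: "(s, across s) \<in> \<mu>"
    then have "fst (across s) \<in> D"
      using preserved_in_mates[OF sD(1)] placed_preserved[OF sD(1)] by blast
    then have "across s \<in> sides D" by (simp add: sides_iff)
    then have "s \<notin> inner_mated D \<mu>" "s \<notin> outer_mated D \<mu>" "s \<notin> unmated D \<mu>"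
      using m mates_functional[OF m] unfolding inner_mated_def outer_mated_def unmated_def by blast+
    then show False using s by blast
  qed
  then show "s \<in> constrained B D \<phi>"
    using sD sidesD_sub by (auto simp: preserved_in_mates constrained_def sides_iff)
qed

text \<open>By \<open>placed_preserved\<close> no adjacency between a correct and a misplaced cell
  is preserved, so both of its sides are constrained.\<close>

lemma card_constrained_facing: "2 * card (facing B D) \<le> card (constrained B D \<phi>)"
proof -
  have sub: "facing B D \<union> across ` facing B D \<subseteq> constrained B D \<phi>"
    using facing_constrained across_constrained by blast
  have dis: "facing B D \<inter> across ` facing B D = {}"
    unfolding across_facing by (auto simp: facing_def boundary_def sides_iff)
  have "card (across ` facing B D) = card (facing B D)"
    by (rule card_image, rule inj_on_subset[OF inj_on_across]) (auto simp: facing_def sides_iff)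
  then have "2 * card (facing B D) = card (facing B D \<union> across ` facing B D)"
    using finite_facing dis by (subst card_Un_disjoint) auto
  also have "\<dots> \<le> card (constrained B D \<phi>)" by (rule card_mono[OF finite_constrained sub])
  finally show ?thesis .
qed

text \<open>The nonpreserved sides of misplaced cells are constrained unless lost, and the
  constrained sides of correct cells number \<open>perimeter D\<close> minus the lost ones. The lost
  sides thus enter twice.\<close>

lemma card_constrained:
  "card (inner_mated D \<mu>) + card (outer_mated D \<mu>) + card (unmated D \<mu>) + perimeter D
    \<le> card (constrained B D \<phi>) + 2 * card (lost B D)"
proof -
  let ?X = "inner_mated D \<mu> \<union> outer_mated D \<mu> \<union> unmated D \<mu>"
  have X: "card ?X = card (inner_mated D \<mu>) + card (outer_mated D \<mu>) + card (unmated D \<mu>)"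
    using finite_mated mated_disjoint by (subst card_Un_disjoint, auto)+
  have finl: "finite (lost B D)" using lost_sub finite_boundary[OF finD] finite_subset by blast
  have "card ?X \<le> card (?X - lost B D) + card (lost B D)"
    using diff_card_le_card_Diff[OF finl, of ?X] by simp
  moreover have "card ((?X - lost B D) \<union> facing B D) = card (?X - lost B D) + card (facing B D)"
    using finite_mated finite_facing
    by (intro card_Un_disjoint) (auto simp: facing_def inner_mated_def outer_mated_def unmated_def sides_iff)
  moreover have "card ((?X - lost B D) \<union> facing B D) \<le> card (constrained B D \<phi>)"
    using nonpreserved_constrained facing_constrained by (intro card_mono finite_constrained) blast
  ultimately show ?thesis using X card_facing by linarith
qed

text \<open>Two correct cells that are original neighbours are also neighbours in the picture, so
  the constrained original partner of a facing side belongs to a misplaced cell. Hence all mated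
  pairs are seen from \<open>D\<close>, and an outer mated pair contributes two sides.\<close>

lemma card_mated:
  "card {s \<in> constrained B D \<phi>. across (orig_side \<phi> s) \<in> orig_side \<phi> ` constrained B D \<phi>}
    \<le> card (inner_mated D \<mu>) + 2 * card (outer_mated D \<mu>)"
proof -
  let ?U = "{s \<in> constrained B D \<phi>. across (orig_side \<phi> s) \<in> orig_side \<phi> ` constrained B D \<phi>}"
  have C: "s \<in> sides D \<or> s \<in> facing B D" if "s \<in> constrained B D \<phi>" for s
    using that by (auto simp: constrained_def facing_def sides_iff)
  define f where "f s = (THE s'. (s, s') \<in> \<mu>)" for s
  have f: "f s = s'" if "(s, s') \<in> \<mu>" for s s'
    unfolding f_def using that mates_functional by (intro the_equality) auto
  have "?U \<subseteq> inner_mated D \<mu> \<union> outer_mated D \<mu> \<union> f ` outer_mated D \<mu>"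
  proof
    fix s assume s: "s \<in> ?U"
    then obtain s' where s': "s' \<in> constrained B D \<phi>" "orig_side \<phi> s' = across (orig_side \<phi> s)" by auto
    have ss: "across (orig_side \<phi> s') = orig_side \<phi> s" using s' by (simp add: across_across)
    have neq: "s' \<noteq> across s" using s s' by (auto simp: constrained_def)
    show "s \<in> inner_mated D \<mu> \<union> outer_mated D \<mu> \<union> f ` outer_mated D \<mu>"
    proof (cases "s \<in> sides D")
      case True
      then have "(s, s') \<in> \<mu>" using C[OF s'(1)] s' by (auto simp: mates_def)
      then show ?thesis using True neq unfolding inner_mated_def outer_mated_def by blast
    next
      case False
      then have sf: "s \<in> facing B D" using C s by blast
      show ?thesis
      proof (cases "s' \<in> sides D")
        case True
        then have "(s', s) \<in> \<mu>" using sf ss by (auto simp: mates_def)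
        then have "s' \<in> outer_mated D \<mu>" "f s' = s" using f False True unfolding outer_mated_def by blast+
        then show ?thesis by blast
      next
        case 2: False
        then have "s' \<in> facing B D" using C s' by blast
        then have p: "\<phi> (fst s) = fr (fst s)" "\<phi> (fst s') = fr (fst s')" "snd s < 4" "snd s' < 4"
          using sf by (auto simp: facing_def misplaced_def sides_iff)
        have "orig_side fr s' = across (orig_side fr s)" using s'(2) p by (simp add: orig_side_def)
        then have e: "orig_side fr s' = orig_side fr (across s)" using p across_orig_side_frame by simp
        then have "fr (fst s') = fr (fst (across s))" by (simp add: orig_side_def frame_def)
        then have "fst s' = fst (across s)" by (rule frame_inj)
        then have "fst (across s) \<notin> D" using \<open>s' \<in> facing B D\<close> by (auto simp: facing_def sides_iff)
        then show ?thesis using sf by (simp add: facing_def)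
      qed
    qed
  qed
  then have "card ?U \<le> card (inner_mated D \<mu> \<union> outer_mated D \<mu> \<union> f ` outer_mated D \<mu>)"
    using finite_mated by (intro card_mono) auto
  also have "\<dots> \<le> card (inner_mated D \<mu>) + card (outer_mated D \<mu>) + card (f ` outer_mated D \<mu>)"
    by (meson add_le_mono1 card_Un_le le_trans)
  also have "card (f ` outer_mated D \<mu>) \<le> card (outer_mated D \<mu>)"
    using finite_mated by (intro card_image_le) auto
  finally show ?thesis by linarith
qed

text \<open>
  The placement fits with probability at most \<open>q powr (- rank4 / 4)\<close>: this is the exponent in
  \<open>card_satisfying\<close>, where each adjacency is counted twice, once from each side.
\<close>

definition rank4 :: real where
  "rank4 = 2 * real (card (constrained B D \<phi>))
     - real (card {s \<in> constrained B D \<phi>. across (orig_side \<phi> s) \<in> orig_side \<phi> ` constrained B D \<phi>})"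

lemma rank4_ge:
  "rank4 \<ge> real (card (inner_mated D \<mu>)) + 2 * real (card (unmated D \<mu>)) + 2 * real (perimeter D)
     - 4 * real (card (lost B D))"
  using card_constrained card_mated unfolding rank4_def by linarith

text \<open>At most all constrained sides are subtracted in \<open>rank4\<close>. Unlike
  \<open>rank4_ge\<close>, where \<open>4 * card (lost B D)\<close> may cancel the whole perimeter
  term, this keeps part of the perimeter when half of it is lost at the border of the grid.\<close>

lemma rank4_ge_perimeter: "rank4 \<ge> 2 * (real (perimeter D) - real (card (lost B D)))"
proof -
  have "card {s \<in> constrained B D \<phi>. across (orig_side \<phi> s) \<in> orig_side \<phi> ` constrained B D \<phi>}
      \<le> card (constrained B D \<phi>)"
    by (intro card_mono finite_constrained) auto
  then have "2 * card (facing B D) + card {s \<in> constrained B D \<phi>. across (orig_side \<phi> s) \<in> orig_side \<phi> ` constrained B D \<phi>}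
      \<le> 2 * card (constrained B D \<phi>)" using card_constrained_facing by linarith
  moreover have "real (card (facing B D)) = real (perimeter D) - real (card (lost B D))"
    using card_facing by linarith
  moreover have "real (2 * card (facing B D) + card {s \<in> constrained B D \<phi>. across (orig_side \<phi> s) \<in> orig_side \<phi> ` constrained B D \<phi>})
      \<le> real (2 * card (constrained B D \<phi>))" using calculation(1) by (rule of_nat_mono)
  ultimately show ?thesis unfolding rank4_def by simp
qed

end

section \<open>Components of misplaced cells\<close>

text \<open>Linked cells carry pieces that were neighbours originally, wherever they are now;
  components are thus connected in the original picture, not in the assembled one.\<close>

definition link :: "cell set \<Rightarrow> (side \<times> side) set \<Rightarrow> (cell \<times> cell) set" where
  "link D \<mu> = {(a, b). a \<in> D \<and> b \<in> D \<and> (\<exists>s s'. (s, s') \<in> \<mu> \<and> fst s = a \<and> fst s' = b)}"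

definition component :: "cell set \<Rightarrow> (side \<times> side) set \<Rightarrow> cell \<Rightarrow> cell set" where
  "component D \<mu> a = (link D \<mu>)\<^sup>* `` {a}"

text \<open>
  Components of pieces glued to their original partners move rigidly. Only those not glued to a
  correctly placed piece have a free choice of position.
\<close>

definition free_components :: "cell set \<Rightarrow> (side \<times> side) set \<Rightarrow> cell set set" where
  "free_components D \<mu> = {K \<in> component D \<mu> ` D. \<forall>(s, s') \<in> \<mu>. fst s \<in> K \<longrightarrow> s' \<in> sides D}"

definition active :: "(side \<times> side) set \<Rightarrow> cell set" where
  "active \<mu> = fst ` Domain \<mu>"

text \<open>Cells without any mate are deliberately absent: they have no slack to pay for their
  description. Where they sit is known once \<open>D\<close> and the active cells are, and these are
  stored by boundaries.\<close>

definition complexity :: "cell set \<Rightarrow> (side \<times> side) set \<Rightarrow> nat" where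
  "complexity D \<mu> = card (inner_mated D \<mu>) + card (unmated D \<mu> \<inter> sides (active \<mu>)) + perimeter D"

lemma component_self: "a \<in> component D \<mu> a"
  by (simp add: component_def)

lemma component_sub: "a \<in> D \<Longrightarrow> component D \<mu> a \<subseteq> D"
proof
  fix b assume a: "a \<in> D" and "b \<in> component D \<mu> a"
  then have "(a, b) \<in> (link D \<mu>)\<^sup>*" by (simp add: component_def)
  then show "b \<in> D" using a by (induction rule: rtrancl_induct) (auto simp: link_def)
qed

lemma free_components_sub: "K \<in> free_components D \<mu> \<Longrightarrow> K \<subseteq> D \<and> K \<noteq> {}"
proof -
  assume "K \<in> free_components D \<mu>"
  then obtain a where a: "a \<in> D" "K = component D \<mu> a" by (auto simp: free_components_def)
  show ?thesis using component_sub[OF a(1)] component_self[of a D \<mu>] a(2) by blast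
qed

lemma component_closed:
  assumes "a \<in> component D \<mu> c" "(s, s') \<in> \<mu>" "fst s = a" "a \<in> D" "fst s' \<in> D"
  shows "fst s' \<in> component D \<mu> c"
proof -
  have "(a, fst s') \<in> link D \<mu>" using assms unfolding link_def by blast
  then show ?thesis using assms(1) by (auto simp: component_def intro: rtrancl_into_rtrancl)
qed

lemma card_subsets_le:
  assumes U: "finite U"
  shows "finite {S. S \<subseteq> U \<and> card S \<le> k} \<and> card {S. S \<subseteq> U \<and> card S \<le> k} \<le> (card U + 1) ^ k"
proof (induction k)
  case 0
  have "{S. S \<subseteq> U \<and> card S \<le> 0} = {{}}" using U by (auto dest: finite_subset)
  then show ?case by simp
next
  case (Suc k)
  let ?f = "\<lambda>(x, S). case x of None \<Rightarrow> S | Some y \<Rightarrow> insert y S"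
  let ?X = "insert None (Some ` U) \<times> {S. S \<subseteq> U \<and> card S \<le> k}"
  have sub: "{S. S \<subseteq> U \<and> card S \<le> Suc k} \<subseteq> ?f ` ?X"
  proof clarify
    fix S assume S: "S \<subseteq> U" "card S \<le> Suc k"
    show "S \<in> ?f ` ?X"
    proof (cases "card S \<le> k")
      case True
      then show ?thesis using S by (intro image_eqI[where x = "(None, S)"]) auto
    next
      case False
      then have "S \<noteq> {}" by auto
      then obtain y where y: "y \<in> S" by blast
      have "finite S" using S U finite_subset by blast
      then have "card (S - {y}) \<le> k" using S y by simp
      then show ?thesis using S y by (intro image_eqI[where x = "(Some y, S - {y})"]) auto
    qed
  qed
  have fin: "finite ?X" using Suc U by simp
  then have "finite {S. S \<subseteq> U \<and> card S \<le> Suc k}" using sub finite_subset by blast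
  moreover have "card {S. S \<subseteq> U \<and> card S \<le> Suc k} \<le> card ?X"
    by (rule surj_card_le[OF fin sub])
  moreover have "card ?X = (card U + 1) * card {S. S \<subseteq> U \<and> card S \<le> k}"
    using U by (simp add: card_cartesian_product card_image)
  ultimately have "card {S. S \<subseteq> U \<and> card S \<le> Suc k} \<le> (card U + 1) * card {S. S \<subseteq> U \<and> card S \<le> k}"
    by simp
  also have "\<dots> \<le> (card U + 1) * (card U + 1) ^ k" using Suc by (intro mult_le_mono2) simp
  finally show ?case using \<open>finite {S. S \<subseteq> U \<and> card S \<le> Suc k}\<close> by simp
qed

context placed_box
begin

lemma mates_domain: "(s, s') \<in> \<mu> \<Longrightarrow> s \<in> sides D \<and> s' \<in> sides D \<union> facing B D"
  by (auto simp: mates_def)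

lemma sym_link: "sym (link D \<mu>)"
proof (rule symI)
  fix a b assume "(a, b) \<in> link D \<mu>"
  then obtain s s' where s: "a \<in> D" "b \<in> D" "(s, s') \<in> \<mu>" "fst s = a" "fst s' = b"
    unfolding link_def by blast
  then have "s' \<in> sides D" using mates_domain[OF s(3)] by (auto simp: facing_def sides_iff)
  then have "(s', s) \<in> \<mu>" using s mates_sym by blast
  then show "(b, a) \<in> link D \<mu>" using s unfolding link_def by blast
qed

lemma component_eq:
  assumes "b \<in> component D \<mu> a" shows "component D \<mu> b = component D \<mu> a"
proof -
  have ab: "(a, b) \<in> (link D \<mu>)\<^sup>*" using assms by (simp add: component_def)
  then have ba: "(b, a) \<in> (link D \<mu>)\<^sup>*" using sym_rtrancl[OF sym_link] by (rule symD[rotated])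
  show ?thesis unfolding component_def using ab ba by (auto intro: rtrancl_trans)
qed

lemma orig_side_surj:
  assumes p: "p \<in> B" and x: "fst x = fst (\<phi> p)" "snd x < 4"
  obtains e where "e < 4" "orig_side \<phi> (p, e) = x"
proof
  show "(snd x + snd (\<phi> p)) mod 4 < 4" by simp
  have "((snd x + snd (\<phi> p)) mod 4 + 3 * snd (\<phi> p)) mod 4 = (snd x + 4 * snd (\<phi> p)) mod 4"
    by (simp add: mod_simps)
  also have "\<dots> = snd x" using x by simp
  finally show "orig_side \<phi> (p, (snd x + snd (\<phi> p)) mod 4) = x"
    using x by (simp add: orig_side_def prod_eq_iff)
qed

text \<open>All mates of a free component lie inside it. So a side of it is unmated exactly if its
  original partner does not belong to a piece of the component, and \<open>orig_side\<close> maps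
  these sides onto the boundary of the region of original cells.\<close>

lemma free_component_perimeter:
  assumes K: "K \<in> free_components D \<mu>"
  shows "perimeter ((\<lambda>p. fst (\<phi> p)) ` K) = card (unmated D \<mu> \<inter> sides K)"
proof -
  let ?A = "(\<lambda>p. fst (\<phi> p)) ` K"
  obtain c where c: "c \<in> D" "K = component D \<mu> c" using K by (auto simp: free_components_def)
  have KD: "K \<subseteq> D" using free_components_sub[OF K] by simp
  have free: "s' \<in> sides D" if "(s, s') \<in> \<mu>" "fst s \<in> K" for s s'
    using K that by (auto simp: free_components_def)
  have "orig_side \<phi> ` (unmated D \<mu> \<inter> sides K) = boundary ?A"
  proof
    show "orig_side \<phi> ` (unmated D \<mu> \<inter> sides K) \<subseteq> boundary ?A"
    proof (rule image_subsetI)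
      fix s assume s: "s \<in> unmated D \<mu> \<inter> sides K"
      have "fst (across (orig_side \<phi> s)) \<notin> ?A"
      proof
        assume "fst (across (orig_side \<phi> s)) \<in> ?A"
        then obtain p where p: "p \<in> K" "fst (across (orig_side \<phi> s)) = fst (\<phi> p)" by auto
        then obtain e where e: "e < 4" "orig_side \<phi> (p, e) = across (orig_side \<phi> s)"
          using orig_side_surj[of p "across (orig_side \<phi> s)"] KD D_sub by auto
        have "(s, (p, e)) \<in> \<mu>" using s p e KD by (auto simp: mates_def sides_iff unmated_def)
        then show False using s by (auto simp: unmated_def)
      qed
      then show "orig_side \<phi> s \<in> boundary ?A" using s by (simp add: boundary_def sides_iff fst_orig_side)
    qed
    show "boundary ?A \<subseteq> orig_side \<phi> ` (unmated D \<mu> \<inter> sides K)"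
    proof
      fix x assume x: "x \<in> boundary ?A"
      then obtain p where p: "p \<in> K" "fst x = fst (\<phi> p)" "snd x < 4" by (auto simp: boundary_def sides_iff)
      then obtain e where e: "e < 4" "orig_side \<phi> (p, e) = x" using orig_side_surj KD D_sub by blast
      have "(p, e) \<notin> Domain \<mu>"
      proof
        assume "(p, e) \<in> Domain \<mu>"
        then obtain s' where s': "((p, e), s') \<in> \<mu>" by blast
        then have "s' \<in> sides D" using free[OF s'] p by simp
        then have "fst s' \<in> K" using component_closed[of p D \<mu> c "(p, e)" s'] s' c p KD by (auto simp: sides_iff)
        moreover have "orig_side \<phi> s' = across x" using s' e by (auto simp: mates_def)
        then have "fst (across x) = fst (\<phi> (fst s'))" using fst_orig_side by metis
        ultimately have "fst (across x) \<in> ?A" by blast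
        then show False using x by (simp add: boundary_def)
      qed
      then have "(p, e) \<in> unmated D \<mu> \<inter> sides K" using p e KD by (auto simp: unmated_def sides_iff)
      then show "x \<in> orig_side \<phi> ` (unmated D \<mu> \<inter> sides K)" using e by (metis imageI)
    qed
  qed
  moreover have "inj_on (orig_side \<phi>) (unmated D \<mu> \<inter> sides K)"
    by (rule inj_on_subset[OF inj_orig_side]) (use sidesD_sub in \<open>auto simp: unmated_def\<close>)
  ultimately show ?thesis unfolding perimeter_def by (metis card_image)
qed

lemma free_component_card:
  assumes "K \<in> free_components D \<mu>" shows "card ((\<lambda>p. fst (\<phi> p)) ` K) = card K" "finite K"
proof -
  have KD: "K \<subseteq> D" using free_components_sub[OF assms] by simp
  show "finite K" using KD finD finite_subset by blast
  show "card ((\<lambda>p. fst (\<phi> p)) ` K) = card K"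
    by (rule card_image, rule inj_on_subset[OF inj]) (use KD D_sub in blast)
qed

lemma finite_free_components: "finite (free_components D \<mu>)"
  using finD by (simp add: free_components_def)

lemma free_components_disjoint:
  assumes "K \<in> free_components D \<mu>" "L \<in> free_components D \<mu>" "K \<noteq> L" shows "K \<inter> L = {}"
proof (rule ccontr)
  assume "K \<inter> L \<noteq> {}"
  then obtain b where "b \<in> K" "b \<in> L" by blast
  moreover obtain a c where "K = component D \<mu> a" "L = component D \<mu> c"
    using assms by (auto simp: free_components_def)
  ultimately have "K = L" using component_eq by metis
  then show False using assms by simp
qed

lemma active_sub: "active \<mu> \<subseteq> D"
  using mates_domain by (auto simp: active_def sides_iff)

lemma unmated_inactive: "sides (D - active \<mu>) \<subseteq> unmated D \<mu>"
  by (force simp: unmated_def active_def sides_iff)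

lemma card_unmated: "card (unmated D \<mu>) = 4 * card (D - active \<mu>) + card (unmated D \<mu> \<inter> sides (active \<mu>))"
proof -
  have "unmated D \<mu> = sides (D - active \<mu>) \<union> (unmated D \<mu> \<inter> sides (active \<mu>))"
    using unmated_inactive active_sub by (auto simp: unmated_def sides_iff)
  then have "card (unmated D \<mu>) = card (sides (D - active \<mu>) \<union> (unmated D \<mu> \<inter> sides (active \<mu>)))" by simp
  also have "\<dots> = card (sides (D - active \<mu>)) + card (unmated D \<mu> \<inter> sides (active \<mu>))"
    using finD finite_mated finite_sides[of "D - active \<mu>"] by (intro card_Un_disjoint) (auto simp: sides_iff)
  finally show ?thesis by (simp add: card_sides)
qed

text \<open>A mate of a free cell lies in the same component, and a piece is never its own
  neighbour; so a free component with only one cell has no mates at all.\<close>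

lemma free_component_cases:
  assumes K: "K \<in> free_components D \<mu>"
  obtains a where "a \<in> D - active \<mu>" "K = {a}" | "2 \<le> card K" "K \<subseteq> active \<mu>"
proof -
  obtain c where c: "c \<in> D" "K = component D \<mu> c" using K by (auto simp: free_components_def)
  have KD: "K \<subseteq> D" using free_components_sub[OF K] by simp
  show ?thesis
  proof (cases "K = {c}")
    case True
    have "c \<notin> active \<mu>"
    proof
      assume "c \<in> active \<mu>"
      then obtain s s' where s: "(s, s') \<in> \<mu>" "fst s = c" by (auto simp: active_def)
      then have "s' \<in> sides D" using K True by (auto simp: free_components_def)
      then have "fst s' \<in> K" using component_closed[OF component_self s(1) s(2) c(1)] c by (auto simp: sides_iff)
      then show False using mates_cell_neq[OF s(1)] s True by auto
    qed
    then show ?thesis using that c True by blast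
  next
    case False
    have cK: "c \<in> K" using c component_self by simp
    then have ne: "card K \<noteq> 1" "card K \<noteq> 0" using False free_component_card(2)[OF K] by (auto simp: card_1_singleton_iff)
    have "K \<subseteq> active \<mu>"
    proof
      fix b assume b: "b \<in> K"
      obtain b' where b': "b' \<in> K" "b' \<noteq> b" using b False cK by blast
      have "b' \<in> component D \<mu> b" using component_eq[of b c] b b' c by simp
      then have "(b, b') \<in> (link D \<mu>)\<^sup>*" by (simp add: component_def)
      then obtain b'' where "(b, b'') \<in> link D \<mu>" using b' by (metis converse_rtranclE)
      then show "b \<in> active \<mu>" unfolding link_def active_def by force
    qed
    moreover have "2 \<le> card K" using ne by linarith
    ultimately show ?thesis using that by blast
  qed
qed

definition big_components :: "cell set set" where
  "big_components = {K \<in> free_components D \<mu>. 2 \<le> card K}"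

lemma card_free_components: "card (free_components D \<mu>) \<le> card (D - active \<mu>) + card big_components"
proof -
  have "free_components D \<mu> \<subseteq> (\<lambda>a. {a}) ` (D - active \<mu>) \<union> big_components"
  proof
    fix K assume K: "K \<in> free_components D \<mu>"
    then show "K \<in> (\<lambda>a. {a}) ` (D - active \<mu>) \<union> big_components"
      by (cases rule: free_component_cases) (use K in \<open>auto simp: big_components_def\<close>)
  qed
  then have "card (free_components D \<mu>) \<le> card ((\<lambda>a. {a}) ` (D - active \<mu>) \<union> big_components)"
    using finD finite_free_components by (intro card_mono) (auto simp: big_components_def)
  also have "\<dots> \<le> card ((\<lambda>a. {a}) ` (D - active \<mu>)) + card big_components" by (rule card_Un_le)
  also have "card ((\<lambda>a. {a}) ` (D - active \<mu>)) \<le> card (D - active \<mu>)" using finD by (intro card_image_le) auto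
  finally show ?thesis by simp
qed

lemma big_component_active:
  assumes "K \<in> big_components" shows "K \<subseteq> active \<mu>"
proof -
  have K: "K \<in> free_components D \<mu>" "2 \<le> card K" using assms by (simp_all add: big_components_def)
  from K(1) show ?thesis by (cases rule: free_component_cases) (use K(2) in simp)
qed

lemma sum_unmated_big:
  "(\<Sum>K \<in> big_components. card (unmated D \<mu> \<inter> sides K)) \<le> card (unmated D \<mu> \<inter> sides (active \<mu>))"
proof -
  have fin': "finite big_components" using finite_free_components by (simp add: big_components_def)
  have "(\<Sum>K \<in> big_components. card (unmated D \<mu> \<inter> sides K)) = card (\<Union>K \<in> big_components. unmated D \<mu> \<inter> sides K)"
  proof (rule card_UN_disjoint[symmetric, OF fin'])
    show "\<forall>K\<in>big_components. finite (unmated D \<mu> \<inter> sides K)" using finite_mated by blast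
    show "\<forall>K\<in>big_components. \<forall>L\<in>big_components. K \<noteq> L \<longrightarrow> (unmated D \<mu> \<inter> sides K) \<inter> (unmated D \<mu> \<inter> sides L) = {}"
    proof (intro ballI impI)
      fix K L assume "K \<in> big_components" "L \<in> big_components" "K \<noteq> L"
      then have "K \<inter> L = {}" using free_components_disjoint by (simp add: big_components_def)
      then show "(unmated D \<mu> \<inter> sides K) \<inter> (unmated D \<mu> \<inter> sides L) = {}" by (auto simp: sides_iff)
    qed
  qed
  also have "\<dots> \<le> card (unmated D \<mu> \<inter> sides (active \<mu>))"
    using big_component_active finite_mated by (intro card_mono) (auto simp: sides_iff, blast)
  finally show ?thesis .
qed

text \<open>A component of at least two pieces comes from a region of perimeter at least 6, and this
  perimeter consists of unmated sides. They contribute 3 to the exponent, against a price of about 2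
  for the position.\<close>

lemma big_components_bound: "6 * card big_components \<le> card (unmated D \<mu> \<inter> sides (active \<mu>))"
proof -
  have "6 \<le> card (unmated D \<mu> \<inter> sides K)" if "K \<in> big_components" for K
  proof -
    have K: "K \<in> free_components D \<mu>" "2 \<le> card K" using that by (auto simp: big_components_def)
    then show ?thesis using perimeter_ge_6[of "(\<lambda>p. fst (\<phi> p)) ` K"] free_component_card[OF K(1)]
      by (simp add: free_component_perimeter)
  qed
  then have "(\<Sum>K \<in> big_components. 6) \<le> (\<Sum>K \<in> big_components. card (unmated D \<mu> \<inter> sides K))"
    by (rule sum_mono)
  then show ?thesis using sum_unmated_big by simp
qed

lemma nonpreserved_active_sub:
  "{s \<in> sides (active \<mu>). (s, across s) \<notin> \<mu>} \<subseteq> inner_mated D \<mu> \<union> outer_mated D \<mu> \<union> (unmated D \<mu> \<inter> sides (active \<mu>))"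
proof
  fix s assume s: "s \<in> {s \<in> sides (active \<mu>). (s, across s) \<notin> \<mu>}"
  then have sD: "s \<in> sides D" using active_sub sides_mono by blast
  show "s \<in> inner_mated D \<mu> \<union> outer_mated D \<mu> \<union> (unmated D \<mu> \<inter> sides (active \<mu>))"
  proof (cases "s \<in> Domain \<mu>")
    case True
    then obtain s' where s': "(s, s') \<in> \<mu>" by blast
    then have "s' \<noteq> across s" using s by auto
    then show ?thesis using s' sD unfolding inner_mated_def outer_mated_def by blast
  qed (use s sD in \<open>auto simp: unmated_def\<close>)
qed

text \<open>The outer mated sides, which do not occur in \<open>complexity\<close>, have distinct
  mates among the facing sides and are therefore paid for by the perimeter.\<close>

lemma card_nonpreserved_active: "card {s \<in> sides (active \<mu>). (s, across s) \<notin> \<mu>} \<le> complexity D \<mu>"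
proof -
  have "card {s \<in> sides (active \<mu>). (s, across s) \<notin> \<mu>}
      \<le> card (inner_mated D \<mu> \<union> outer_mated D \<mu> \<union> (unmated D \<mu> \<inter> sides (active \<mu>)))"
    using finite_mated by (intro card_mono nonpreserved_active_sub) auto
  also have "\<dots> \<le> card (inner_mated D \<mu>) + card (outer_mated D \<mu>) + card (unmated D \<mu> \<inter> sides (active \<mu>))"
    by (meson add_le_mono1 card_Un_le le_trans)
  finally show ?thesis using card_outer_mated card_facing by (simp add: complexity_def)
qed

lemma preserved_mates_sides: "(s, across s) \<in> \<mu> \<Longrightarrow> across s \<in> sides D"
proof -
  assume a: "(s, across s) \<in> \<mu>"
  then have "s \<in> sides D" using mates_domain by blast
  then show ?thesis using a preserved_in_mates[of s] placed_preserved[of s] by (simp add: sides_iff)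
qed

text \<open>A preserved adjacency makes both of its cells active, so the boundary of the active
  region consists of nonpreserved sides.\<close>

lemma boundary_active_sub: "boundary (active \<mu>) \<subseteq> {s \<in> sides (active \<mu>). (s, across s) \<notin> \<mu>}"
proof
  fix s assume s: "s \<in> boundary (active \<mu>)"
  have "(s, across s) \<notin> \<mu>"
  proof
    assume m: "(s, across s) \<in> \<mu>"
    then have "(across s, s) \<in> \<mu>" using mates_sym preserved_mates_sides by blast
    then have "fst (across s) \<in> active \<mu>" by (force simp: active_def)
    then show False using s by (simp add: boundary_def)
  qed
  then show "s \<in> {s \<in> sides (active \<mu>). (s, across s) \<notin> \<mu>}" using s by (simp add: boundary_def)
qed

end

section \<open>Counting patterns\<close>

text \<open>Each of the four entries has at most \<open>complexity\<close> elements. Sides of active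
  cells outside \<open>Z\<close> have the opposite side as mate, inactive cells have no mates, and
  the two boundaries determine \<open>D\<close> and the active cells.\<close>

definition pattern_code :: "cell set \<times> (side \<times> side) set \<Rightarrow> side set \<times> side set \<times> side set \<times> (side \<times> side) set" where
  "pattern_code = (\<lambda>(D, \<mu>). let Z = {s \<in> sides (active \<mu>). (s, across s) \<notin> \<mu>} in
     (boundary D, boundary (active \<mu>), Z, {(s, s') \<in> \<mu>. s \<in> Z}))"

context
  fixes B :: "cell set" and k :: nat and v :: cell
begin

definition patterns :: "(cell set \<times> (side \<times> side) set) set" where
  "patterns = {(misplaced B (frame k v) \<phi>, mates B (misplaced B (frame k v) \<phi>) \<phi>) |\<phi>. placed_box B k \<phi>}"

lemma inj_on_pattern_code: "inj_on pattern_code patterns"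
proof (rule inj_onI)
  fix X Y assume X: "X \<in> patterns" and Y: "Y \<in> patterns" and eq: "pattern_code X = pattern_code Y"
  obtain \<phi> where \<phi>: "X = (misplaced B (frame k v) \<phi>, mates B (misplaced B (frame k v) \<phi>) \<phi>)" "placed_box B k \<phi>"
    using X unfolding patterns_def by blast
  obtain \<psi> where \<psi>: "Y = (misplaced B (frame k v) \<psi>, mates B (misplaced B (frame k v) \<psi>) \<psi>)" "placed_box B k \<psi>"
    using Y unfolding patterns_def by blast
  define D E \<mu> \<nu> where def: "D = misplaced B (frame k v) \<phi>" "E = misplaced B (frame k v) \<psi>"
    "\<mu> = mates B D \<phi>" "\<nu> = mates B E \<psi>"
  have fin: "finite D" "finite E" using placed_box.finD[OF \<phi>(2)] placed_box.finD[OF \<psi>(2)] by (auto simp: def)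
  have "active \<mu> \<subseteq> D" "active \<nu> \<subseteq> E"
    using placed_box.active_sub[OF \<phi>(2)] placed_box.active_sub[OF \<psi>(2)] by (auto simp: def)
  then have fin': "finite (active \<mu>)" "finite (active \<nu>)" using fin finite_subset by blast+
  define Z where "Z \<mu> = {s \<in> sides (active \<mu>). (s, across s) \<notin> \<mu>}" for \<mu>
  have X': "pattern_code X = (boundary D, boundary (active \<mu>), Z \<mu>, {(s, s') \<in> \<mu>. s \<in> Z \<mu>})"
    and Y': "pattern_code Y = (boundary E, boundary (active \<nu>), Z \<nu>, {(s, s') \<in> \<nu>. s \<in> Z \<nu>})"
    unfolding pattern_code_def \<phi>(1) \<psi>(1) def[symmetric] Z_def by (simp_all only: Let_def prod.case)
  have "boundary D = boundary E \<and> boundary (active \<mu>) = boundary (active \<nu>) \<and> Z \<mu> = Z \<nu> \<and>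
    {(s, s') \<in> \<mu>. s \<in> Z \<mu>} = {(s, s') \<in> \<nu>. s \<in> Z \<nu>}"
    using eq[unfolded X' Y'] unfolding prod.inject .
  then have e: "boundary D = boundary E" "boundary (active \<mu>) = boundary (active \<nu>)" "Z \<mu> = Z \<nu>"
    "{(s, s') \<in> \<mu>. s \<in> Z \<mu>} = {(s, s') \<in> \<nu>. s \<in> Z \<nu>}" by blast+
  have DE: "D = E" "active \<mu> = active \<nu>" using e fin fin' boundary_inject by blast+
  \<comment> \<open>Outside of \<open>Z\<close> the mate is the opposite side, so the active cells,
    \<open>Z\<close> and the part of the mates on \<open>Z\<close> give back everything.\<close>
  have rec: "\<mu> = {(s, s'). s \<in> sides (active \<mu>) - Z \<mu> \<and> s' = across s} \<union> {(s, s') \<in> \<mu>. s \<in> Z \<mu>}"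
    if "placed_box B k \<phi>" and \<mu>: "\<mu> = mates B (misplaced B (frame k v) \<phi>) \<phi>" for \<phi> \<mu>
  proof -
    interpret placed_box B k v \<phi> by fact
    have "s \<in> sides (active \<mu>)" if "(s, s') \<in> \<mu>" for s s'
      using that mates_domain[of s s'] by (force simp: active_def sides_iff \<mu>)
    moreover have "s' = across s" if "(s, s') \<in> \<mu>" "(s, across s) \<in> \<mu>" for s s'
      using that mates_functional unfolding \<mu> by blast
    ultimately show ?thesis unfolding Z_def by blast
  qed
  have "\<mu> = \<nu>"
    using rec[OF \<phi>(2), of \<mu>] rec[OF \<psi>(2), of \<nu>] e DE unfolding def by metis
  then show "X = Y" using DE \<phi>(1) \<psi>(1) def by simp
qed

text \<open>There are \<open>16 * (card B)\<^sup>2\<close> pairs of sides of \<open>B\<close>. This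
  bounds the ground set of all four entries of the code, and an entry is a choice of at most
  \<open>m\<close> elements from it.\<close>

lemma card_patterns:
  assumes B: "finite B" "B \<noteq> {}"
  shows "card {X \<in> patterns. (case X of (D, \<mu>) \<Rightarrow> complexity D \<mu>) = m} \<le> ((16 * (card B)\<^sup>2 + 1) ^ 4) ^ m"
proof -
  let ?P = "{X \<in> patterns. (case X of (D, \<mu>) \<Rightarrow> complexity D \<mu>) = m}"
  let ?S = "{S. S \<subseteq> sides B \<and> card S \<le> m}"
  let ?T = "{S. S \<subseteq> sides B \<times> sides B \<and> card S \<le> m}"
  let ?N = "16 * (card B)\<^sup>2 + 1"
  have fs: "finite (sides B)" using B finite_sides by blast
  have b: "card B \<ge> 1" using B by (simp add: Suc_le_eq card_gt_0_iff)
  have N: "card (sides B) + 1 \<le> ?N"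
  proof -
    have "card B * 1 \<le> card B * card B" using b by (intro mult_le_mono2)
    then show ?thesis by (simp add: card_sides power2_eq_square)
  qed
  have S: "finite ?S" "card ?S \<le> ?N ^ m"
    using card_subsets_le[OF fs, of m] power_mono[OF N, of m] by auto
  have "card (sides B \<times> sides B) + 1 = ?N"
    by (simp add: card_cartesian_product card_sides power2_eq_square)
  then have T: "finite ?T" "card ?T \<le> ?N ^ m"
    using card_subsets_le[of "sides B \<times> sides B" m] fs by auto
  have "pattern_code ` ?P \<subseteq> ?S \<times> ?S \<times> ?S \<times> ?T"
  proof (rule image_subsetI)
    fix X assume X: "X \<in> ?P"
    then obtain \<phi> where \<phi>: "X = (misplaced B (frame k v) \<phi>, mates B (misplaced B (frame k v) \<phi>) \<phi>)" "placed_box B k \<phi>"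
      unfolding patterns_def by blast
    interpret placed_box B k v \<phi> by fact
    have m: "complexity D \<mu> = m" using X \<phi> by simp
    define Z where "Z = {s \<in> sides (active \<mu>). (s, across s) \<notin> \<mu>}"
    have finA: "finite (active \<mu>)" using active_sub finD finite_subset by blast
    have finZ: "finite Z" unfolding Z_def using finite_sides[OF finA] by simp
    have Zc: "card Z \<le> m" using card_nonpreserved_active m unfolding Z_def by simp
    have ZB: "Z \<subseteq> sides B" unfolding Z_def using active_sub D_sub by (auto simp: sides_iff)
    have 1: "boundary D \<in> ?S"
      using m boundary_subset[of D] sidesD_sub by (auto simp: complexity_def perimeter_def)
    have "boundary (active \<mu>) \<subseteq> Z" using boundary_active_sub by (simp add: Z_def)
    then have 2: "boundary (active \<mu>) \<in> ?S" using Zc ZB card_mono[OF finZ] by (simp, metis order_trans)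
    have 3: "Z \<in> ?S" using Zc ZB by simp
    have "\<mu> \<subseteq> sides B \<times> sides B"
    proof (rule subrelI)
      fix s s' assume "(s, s') \<in> \<mu>"
      from mates_domain[OF this] show "(s, s') \<in> sides B \<times> sides B" using sidesD_sub facing_sub by auto
    qed
    then have sub: "{(s, s') \<in> \<mu>. s \<in> Z} \<subseteq> sides B \<times> sides B" by blast
    have "inj_on fst {(s, s') \<in> \<mu>. s \<in> Z}"
      using mates_functional by (auto simp: inj_on_def)
    moreover have "fst ` {(s, s') \<in> \<mu>. s \<in> Z} \<subseteq> Z" by auto
    ultimately have "card {(s, s') \<in> \<mu>. s \<in> Z} \<le> card Z" using finZ by (intro card_inj_on_le)
    then have 4: "{(s, s') \<in> \<mu>. s \<in> Z} \<in> ?T" using sub Zc by simp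
    show "pattern_code X \<in> ?S \<times> ?S \<times> ?S \<times> ?T"
      unfolding \<phi>(1) pattern_code_def using 1 2 3 4 by (simp add: Let_def Z_def)
  qed
  moreover have "inj_on pattern_code ?P" by (rule inj_on_subset[OF inj_on_pattern_code]) auto
  moreover have "finite (?S \<times> ?S \<times> ?S \<times> ?T)" using S T by auto
  ultimately have "card ?P \<le> card (?S \<times> ?S \<times> ?S \<times> ?T)" using card_inj_on_le by blast
  also have "\<dots> = card ?S * (card ?S * (card ?S * card ?T))" by (simp add: card_cartesian_product)
  also have "\<dots> \<le> ?N ^ m * (?N ^ m * (?N ^ m * ?N ^ m))"
    using S(2) T(2) by (intro mult_le_mono) auto
  also have "\<dots> = (?N ^ 4) ^ m" by (simp only: power4_eq_xxxx power_mult_distrib mult.assoc)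
  finally show ?thesis .
qed

end

section \<open>The union bound over placements\<close>

lemma placed_box_restrict: "placed_box B k (restrict \<phi> B) \<longleftrightarrow> placed_box B k \<phi>"
  by (auto simp: placed_box_def inj_on_def)

lemma misplaced_restrict: "misplaced B fr (restrict \<phi> B) = misplaced B fr \<phi>"
  by (auto simp: misplaced_def)

context
  fixes B :: "cell set" and k :: nat and v :: cell and O' :: "cell set"
begin

text \<open>Placements are extensional on \<open>B\<close> to make them countable. The set
  \<open>O'\<close> is the stock of original cells from which misplaced positions are
  served.\<close>

definition completions :: "cell set \<times> (side \<times> side) set \<Rightarrow> (cell \<Rightarrow> cell \<times> nat) set" where
  "completions X = {\<phi> \<in> extensional B. placed_box B k \<phi> \<and>
     X = (misplaced B (frame k v) \<phi>, mates B (misplaced B (frame k v) \<phi>) \<phi>) \<and>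
     (\<forall>p \<in> misplaced B (frame k v) \<phi>. fst (\<phi> p) \<in> O')}"

text \<open>A pair of mates carries the placement of one cell over to the other, so one cell
  determines its whole component. A component that is not free is anchored at a correct cell, whose
  placement is prescribed by the frame.\<close>

lemma completions_agree:
  assumes \<phi>: "placed_box B k \<phi>" and \<psi>: "placed_box B k \<psi>"
    and D: "misplaced B (frame k v) \<phi> = D" "misplaced B (frame k v) \<psi> = D"
    and \<mu>: "mates B D \<phi> = \<mu>" "mates B D \<psi> = \<mu>"
    and rep: "\<And>K. K \<in> free_components D \<mu> \<Longrightarrow> r K \<in> K \<and> \<phi> (r K) = \<psi> (r K)"
    and p: "p \<in> D"
  shows "\<phi> p = \<psi> p"
proof -
  interpret P: placed_box B k v \<phi> by fact
  interpret Q: placed_box B k v \<psi> by fact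
  have DB: "D \<subseteq> B" using P.D_sub D by simp
  have one: "\<phi> (fst s') = \<psi> (fst s')" if m: "(s, s') \<in> \<mu>" and a: "\<phi> (fst s) = \<psi> (fst s)" for s s'
  proof (rule placed_eqI)
    have "orig_side \<phi> s' = across (orig_side \<phi> s)" "orig_side \<psi> s' = across (orig_side \<psi> s)" using m \<mu> by (auto simp: mates_def)
    moreover have "orig_side \<phi> s = orig_side \<psi> s" using a by (simp add: orig_side_def)
    ultimately show "orig_side \<phi> s' = orig_side \<psi> s'" by simp
    have "fst s' \<in> B" using P.mates_domain[of s s'] m \<mu> D P.facing_sub DB by (auto simp: sides_iff)
    then show "snd (\<phi> (fst s')) < 4" "snd (\<psi> (fst s')) < 4" using P.rot Q.rot by auto
  qed
  have spread: "\<phi> b = \<psi> b" if "(a, b) \<in> (link D \<mu>)\<^sup>*" "\<phi> a = \<psi> a" for a b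
    using that
  proof (induction rule: rtrancl_induct)
    case (step b c)
    then obtain s s' where s: "(s, s') \<in> \<mu>" "fst s = b" "fst s' = c" unfolding link_def by blast
    show ?case using one[OF s(1)] step.IH step.prems s by simp
  qed simp
  let ?K = "component D \<mu> p"
  have return: "\<phi> p = \<psi> p" if "b \<in> ?K" "\<phi> b = \<psi> b" for b
  proof -
    have "p \<in> component D \<mu> b" using P.component_eq[of b p] that(1) component_self[of p D \<mu>] D \<mu> by simp
    then show ?thesis using spread[of b p] that(2) by (simp add: component_def)
  qed
  show ?thesis
  proof (cases "?K \<in> free_components D \<mu>")
    case True
    then show ?thesis using rep return by blast
  next
    case False
    then obtain s s' where s: "(s, s') \<in> \<mu>" "fst s \<in> ?K" "s' \<notin> sides D"
      using p unfolding free_components_def by blast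
    then have f: "s' \<in> facing B D" using P.mates_domain[of s s'] D \<mu> by auto
    then have "fst s' \<in> B - D" by (auto simp: facing_def sides_iff)
    then have "\<phi> (fst s') = frame k v (fst s')" "\<psi> (fst s') = frame k v (fst s')"
      using D by (auto simp: misplaced_def)
    then have "orig_side \<phi> s' = orig_side \<psi> s'" by (simp add: orig_side_def)
    moreover have "orig_side \<phi> s' = across (orig_side \<phi> s)" "orig_side \<psi> s' = across (orig_side \<psi> s)" using s \<mu> by (auto simp: mates_def)
    ultimately have "orig_side \<phi> s = orig_side \<psi> s" by (metis across_across snd_orig_side_less)
    moreover have "fst s \<in> B" using s(2) component_sub[OF p] DB by blast
    ultimately have "\<phi> (fst s) = \<psi> (fst s)" using placed_eqI P.rot Q.rot by blast
    then show ?thesis using return s(2) by blast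
  qed
qed

lemma card_completions:
  assumes B: "finite B" and O': "finite O'"
  shows "finite (completions (D, \<mu>)) \<and> card (completions (D, \<mu>)) \<le> (4 * card O') ^ card (free_components D \<mu>)"
proof (cases "completions (D, \<mu>) = {}")
  case False
  define r where "r K = (SOME a. a \<in> K)" for K :: "cell set"
  have ne: "r K \<in> K" "K \<subseteq> D" if "K \<in> free_components D \<mu>" for K
    using free_components_sub[OF that] unfolding r_def by (auto simp: some_in_eq)
  have fin: "finite (free_components D \<mu>)"
  proof -
    obtain \<phi> where "\<phi> \<in> completions (D, \<mu>)" using False by blast
    then have "finite D" using B by (auto simp: completions_def misplaced_def)
    then show ?thesis by (simp add: free_components_def)
  qed
  let ?f = "\<lambda>\<phi>. \<lambda>K \<in> free_components D \<mu>. \<phi> (r K)"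
  have "inj_on ?f (completions (D, \<mu>))"
  proof (rule inj_onI)
    fix \<phi> \<psi> assume a: "\<phi> \<in> completions (D, \<mu>)" "\<psi> \<in> completions (D, \<mu>)" "?f \<phi> = ?f \<psi>"
    then have D: "misplaced B (frame k v) \<phi> = D" "misplaced B (frame k v) \<psi> = D"
      and \<mu>: "mates B D \<phi> = \<mu>" "mates B D \<psi> = \<mu>"
      and pb: "placed_box B k \<phi>" "placed_box B k \<psi>" by (auto simp: completions_def)
    have "\<phi> (r K) = \<psi> (r K)" if "K \<in> free_components D \<mu>" for K
      using fun_cong[OF a(3), of K] that by simp
    then have "r K \<in> K \<and> \<phi> (r K) = \<psi> (r K)" if "K \<in> free_components D \<mu>" for K using ne that by blast
    then have onD: "\<phi> p = \<psi> p" if "p \<in> D" for p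
      by (rule completions_agree[OF pb D \<mu> _ that])
    have offD: "\<phi> p = frame k v p" "\<psi> p = frame k v p" if "p \<in> B" "p \<notin> D" for p
      using that D unfolding misplaced_def by blast+
    have "\<phi> p = \<psi> p" if "p \<in> B" for p using onD[of p] offD[of p] that by (cases "p \<in> D") simp_all
    then show "\<phi> = \<psi>" using a(1,2) by (intro extensionalityI[of \<phi> B \<psi>]) (auto simp: completions_def)
  qed
  moreover have "?f ` completions (D, \<mu>) \<subseteq> free_components D \<mu> \<rightarrow>\<^sub>E O' \<times> {..<4}"
  proof (rule image_subsetI, rule restrict_PiE_iff[THEN iffD2], rule ballI)
    fix \<phi> K assume \<phi>: "\<phi> \<in> completions (D, \<mu>)" and K: "K \<in> free_components D \<mu>"
    have rD: "r K \<in> D" using ne[OF K] by blast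
    have Deq: "misplaced B (frame k v) \<phi> = D" using \<phi> by (simp add: completions_def)
    have "r K \<in> B" using rD Deq by (auto simp: misplaced_def)
    moreover have "fst (\<phi> (r K)) \<in> O'" using \<phi> rD Deq unfolding completions_def by blast
    moreover have "snd (\<phi> (r K)) < 4"
    proof -
      have "placed_box B k \<phi>" using \<phi> by (simp add: completions_def)
      then show ?thesis using \<open>r K \<in> B\<close> by (rule placed_box.rot)
    qed
    ultimately show "\<phi> (r K) \<in> O' \<times> {..<4}" by (simp add: mem_Times_iff)
  qed
  moreover have "finite (free_components D \<mu> \<rightarrow>\<^sub>E O' \<times> {..<4::nat})"
    using fin O' by (intro finite_PiE) auto
  moreover have "card (free_components D \<mu> \<rightarrow>\<^sub>E O' \<times> {..<4::nat}) = (4 * card O') ^ card (free_components D \<mu>)"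
    using fin by (simp add: card_PiE card_cartesian_product mult.commute)
  ultimately show ?thesis by (metis (no_types, lifting) card_inj_on_le finite_imageD finite_subset)
qed simp

end

context puzzle
begin

text \<open>A solution seen from the positions of the picture: \<open>\<phi>\<close> tells which
  piece is shown where. On the finite set \<open>G\<close> injectivity already gives a
  bijection.\<close>

definition assembly :: "carving \<Rightarrow> (cell \<Rightarrow> cell \<times> nat) \<Rightarrow> bool" where
  "assembly \<omega> \<phi> \<longleftrightarrow> (\<forall>p \<in> G. fst (\<phi> p) \<in> G \<and> snd (\<phi> p) < 4) \<and> inj_on (\<lambda>p. fst (\<phi> p)) G \<and>
     (\<forall>s \<in> sides G. fst (across s) \<in> G \<longrightarrow> jig \<omega> (orig_side \<phi> (across s)) = \<iota> (jig \<omega> (orig_side \<phi> s)))"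

definition fitting :: "cell set \<Rightarrow> cell set \<Rightarrow> (cell \<Rightarrow> cell \<times> nat) \<Rightarrow> carving set" where
  "fitting B D \<phi> = {\<omega> \<in> \<Omega>. \<forall>s \<in> constrained B D \<phi>. jig \<omega> (orig_side \<phi> (across s)) = \<iota> (jig \<omega> (orig_side \<phi> s))}"

lemma card_fitting:
  assumes pb: "placed_box B k \<phi>" and G: "\<And>p. p \<in> B \<Longrightarrow> fst (\<phi> p) \<in> G"
    and D: "D = misplaced B (frame k v) \<phi>"
  shows "real (card (fitting B D \<phi>)) \<le> real (card \<Omega>) * real q powr (- placed_box.rank4 B k v \<phi> / 4)"
proof -
  interpret placed_box B k v \<phi> by fact
  define C where "C = constrained B D \<phi>"
  define K where "K = orig_side \<phi> ` C"
  have CB: "C \<subseteq> sides B" by (auto simp: C_def constrained_def)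
  have injC: "inj_on (orig_side \<phi>) C" by (rule inj_on_subset[OF inj_orig_side CB])
  have aC: "across s \<in> C" if "s \<in> C" for s using across_constrained that unfolding C_def D by blast
  \<comment> \<open>Two original sides are paired if the placement brings them together; this is
    \<open>across\<close> of the picture, transported to the original sides.\<close>
  define m where "m x = orig_side \<phi> (across (the_inv_into C (orig_side \<phi>) x))" for x
  have m: "m (orig_side \<phi> s) = orig_side \<phi> (across s)" if "s \<in> C" for s
    using that by (simp add: m_def the_inv_into_f_f[OF injC])
  have s4: "snd s < 4" if "s \<in> C" for s using that CB by (auto simp: sides_iff)
  have "fitting B D \<phi> = satisfying K m \<iota>"
    unfolding fitting_def satisfying_def K_def C_def[symmetric] using m by auto
  moreover have "real (card (satisfying K m \<iota>)) \<le> real (card \<Omega>) *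
      real q powr (- (2 * real (card K) - real (card {x \<in> K. across x \<in> K})) / 4)"
  proof (rule card_satisfying)
    show "finite K" using finite_constrained by (simp add: K_def C_def D)
    show "K \<subseteq> sides G" using CB G by (auto simp: K_def sides_iff fst_orig_side)
    fix x assume "x \<in> K"
    then obtain s where s: "s \<in> C" "x = orig_side \<phi> s" by (auto simp: K_def)
    have "m x = orig_side \<phi> (across s)" using m s by simp
    moreover have "m (orig_side \<phi> (across s)) = x" using m[OF aC[OF s(1)]] s s4 by (simp add: across_across)
    moreover have "orig_side \<phi> (across s) \<noteq> orig_side \<phi> s"
      using inj_onD[OF injC _ aC[OF s(1)] s(1)] across_neq[of s] by blast
    moreover have "orig_side \<phi> (across s) \<noteq> across (orig_side \<phi> s)" using s by (auto simp: C_def constrained_def)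
    ultimately show "m x \<in> K \<and> m (m x) = x \<and> m x \<noteq> x \<and> m x \<noteq> across x"
      using s aC by (auto simp: K_def)
  next
    fix t assume "t \<in> {1..q}"
    then show "\<iota> t \<in> {1..q} \<and> \<iota> (\<iota> t) = t" using \<iota>_in \<iota>_invol by blast
  qed
  moreover have "card K = card (constrained B D \<phi>)" unfolding K_def using injC card_image C_def by blast
  moreover have "{x \<in> K. across x \<in> K} = orig_side \<phi> ` {s \<in> C. across (orig_side \<phi> s) \<in> orig_side \<phi> ` C}"
    unfolding K_def by auto
  then have "card {x \<in> K. across x \<in> K} = card {s \<in> C. across (orig_side \<phi> s) \<in> orig_side \<phi> ` C}"
    using card_image[OF inj_on_subset[OF injC]] by (metis (no_types, lifting) mem_Collect_eq subsetI)
  ultimately show ?thesis unfolding rank4_def C_def D by simp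
qed

text \<open>
  The factor \<open>w\<close> collects the positional entropy to be overcome, while the power of \<open>M\<close> pays for
  the choice of the pattern.
\<close>

lemma union_bound:
  fixes q0 w :: real
  assumes B: "B \<subseteq> G" "B \<noteq> {}" and k: "k < 4" and O': "finite O'" and q0: "1 \<le> q0" "q0 \<le> real q" and w: "0 \<le> w"
    and M: "M = (16 * real ((card B)\<^sup>2) + 1) ^ 4"
    and main: "\<And>\<phi>. placed_box B k \<phi> \<Longrightarrow> (\<And>p. p \<in> B \<Longrightarrow> fst (\<phi> p) \<in> G) \<Longrightarrow> X \<phi> \<Longrightarrow>
      (\<And>p. p \<in> misplaced B (frame k v) \<phi> \<Longrightarrow> fst (\<phi> p) \<in> O') \<Longrightarrow>
      (4 * real (card O')) ^ card (free_components (misplaced B (frame k v) \<phi>) (mates B (misplaced B (frame k v) \<phi>) \<phi>))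
        * q0 powr (- placed_box.rank4 B k v \<phi> / 4)
      \<le> w * (1 / (2 * M)) ^ complexity (misplaced B (frame k v) \<phi>) (mates B (misplaced B (frame k v) \<phi>) \<phi>)"
  shows "real (card {\<omega> \<in> \<Omega>. \<exists>\<phi>. assembly \<omega> \<phi> \<and> X (restrict \<phi> B) \<and>
      (\<forall>p \<in> misplaced B (frame k v) \<phi>. fst (\<phi> p) \<in> O')}) \<le> 2 * w * real (card \<Omega>)"
proof -
  define pat where "pat \<phi> = (misplaced B (frame k v) \<phi>, mates B (misplaced B (frame k v) \<phi>) \<phi>)" for \<phi>
  define F where "F = {\<phi> \<in> extensional B. placed_box B k \<phi> \<and> (\<forall>p \<in> B. fst (\<phi> p) \<in> G) \<and> X \<phi> \<and>
     (\<forall>p \<in> misplaced B (frame k v) \<phi>. fst (\<phi> p) \<in> O')}"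
  define cx where "cx = (\<lambda>(D, \<mu>). complexity D \<mu>)"
  define fc where "fc = (\<lambda>(D, \<mu>). card (free_components D \<mu>))"
  have finB: "finite B" using B finite_cells finite_subset by blast
  have Fc: "{\<phi> \<in> F. pat \<phi> = Y} \<subseteq> completions B k v O' Y" for Y
    unfolding F_def completions_def pat_def by auto
  have comp: "finite (completions B k v O' Y)" "real (card (completions B k v O' Y)) \<le> (4 * real (card O')) ^ fc Y" for Y
  proof -
    obtain D \<mu> where Y: "Y = (D, \<mu>)" by force
    note c = card_completions[OF finB O', of k v D \<mu>]
    show "finite (completions B k v O' Y)" using c Y by simp
    have "real (card (completions B k v O' Y)) \<le> real ((4 * card O') ^ fc Y)"
      using c Y by (simp only: fc_def of_nat_le_iff prod.case)
    then show "real (card (completions B k v O' Y)) \<le> (4 * real (card O')) ^ fc Y" by simp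
  qed
  have fp: "pat ` F \<subseteq> patterns B k v" unfolding F_def patterns_def pat_def by blast
  have finP: "finite (patterns B k v)"
  proof -
    have "patterns B k v \<subseteq> Pow B \<times> Pow (sides B \<times> sides B)"
    proof
      fix Y assume "Y \<in> patterns B k v"
      then obtain \<phi> where \<phi>: "Y = pat \<phi>" "placed_box B k \<phi>" unfolding patterns_def pat_def by blast
      interpret placed_box B k v \<phi> by fact
      have "\<mu> \<subseteq> sides B \<times> sides B"
      proof (rule subrelI)
        fix s s' assume "(s, s') \<in> \<mu>"
        from mates_domain[OF this] show "(s, s') \<in> sides B \<times> sides B" using sidesD_sub facing_sub by auto
      qed
      then show "Y \<in> Pow B \<times> Pow (sides B \<times> sides B)" using \<phi>(1) D_sub by (simp add: pat_def)
    qed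
    then show ?thesis by (rule finite_subset) (use finB finite_sides in simp)
  qed
  have finPF: "finite (pat ` F)" using finP fp finite_subset by blast
  have "F = (\<Union>Y \<in> pat ` F. {\<phi> \<in> F. pat \<phi> = Y})" by blast
  moreover have finY: "finite {\<phi> \<in> F. pat \<phi> = Y}" for Y using Fc comp(1) finite_subset by blast
  ultimately have finF: "finite F" using finPF by (metis (no_types, lifting) finite_UN_I)
  define wt where "wt \<phi> = q0 powr (- placed_box.rank4 B k v \<phi> / 4)" for \<phi>
  have fit: "real (card (fitting B (misplaced B (frame k v) \<phi>) \<phi>)) \<le> real (card \<Omega>) * wt \<phi>" if "\<phi> \<in> F" for \<phi>
  proof -
    have pb: "placed_box B k \<phi>" and g: "\<And>p. p \<in> B \<Longrightarrow> fst (\<phi> p) \<in> G" using that by (auto simp: F_def)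
    interpret placed_box B k v \<phi> by fact
    \<comment> \<open>The exponent must not be positive for \<open>q\<close> to be replaced by the
      smaller \<open>q0\<close>.\<close>
    have "rank4 \<ge> 0"
      using card_mono[OF finite_constrained, of "{s \<in> constrained B D \<phi>. across (orig_side \<phi> s) \<in> orig_side \<phi> ` constrained B D \<phi>}"]
      unfolding rank4_def by simp
    then have "real q powr (- rank4 / 4) \<le> q0 powr (- rank4 / 4)"
      using q0 by (intro powr_mono2') auto
    then show ?thesis
      using card_fitting[OF pb g refl, of v] unfolding wt_def
      by (meson mult_left_mono of_nat_0_le_iff order_trans)
  qed
  let ?bad = "{\<omega> \<in> \<Omega>. \<exists>\<phi>. assembly \<omega> \<phi> \<and> X (restrict \<phi> B) \<and>
      (\<forall>p \<in> misplaced B (frame k v) \<phi>. fst (\<phi> p) \<in> O')}"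
  have "?bad \<subseteq> (\<Union>\<phi>\<in>F. fitting B (misplaced B (frame k v) \<phi>) \<phi>)"
  proof
    fix \<omega> assume "\<omega> \<in> ?bad"
    then obtain \<phi> where \<phi>: "\<omega> \<in> \<Omega>" "assembly \<omega> \<phi>" "X (restrict \<phi> B)"
      "\<forall>p \<in> misplaced B (frame k v) \<phi>. fst (\<phi> p) \<in> O'" by blast
    let ?\<psi> = "restrict \<phi> B"
    have "placed_box B k \<phi>"
      using \<phi>(2) B finB k by (auto simp: placed_box_def assembly_def intro: inj_on_subset)
    then have "?\<psi> \<in> F"
      using \<phi> B by (auto simp: F_def placed_box_restrict misplaced_restrict assembly_def misplaced_def)
    moreover have "\<omega> \<in> fitting B (misplaced B (frame k v) ?\<psi>) ?\<psi>"
    proof -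
      have "jig \<omega> (orig_side ?\<psi> (across s)) = \<iota> (jig \<omega> (orig_side ?\<psi> s))"
        if "s \<in> constrained B (misplaced B (frame k v) ?\<psi>) ?\<psi>" for s
      proof -
        have s: "s \<in> sides B" "fst (across s) \<in> B" using that by (auto simp: constrained_def)
        then have "s \<in> sides G" "fst (across s) \<in> G" using B sides_mono by blast+
        then have "jig \<omega> (orig_side \<phi> (across s)) = \<iota> (jig \<omega> (orig_side \<phi> s))" using \<phi>(2) by (simp add: assembly_def)
        moreover have "orig_side ?\<psi> (across s) = orig_side \<phi> (across s)" "orig_side ?\<psi> s = orig_side \<phi> s"
          using s by (simp_all add: orig_side_def sides_iff)
        ultimately show ?thesis by simp
      qed
      then show ?thesis using \<phi>(1) by (simp add: fitting_def)
    qed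
    ultimately show "\<omega> \<in> (\<Union>\<phi>\<in>F. fitting B (misplaced B (frame k v) \<phi>) \<phi>)" by blast
  qed
  then have "card ?bad \<le> card (\<Union>\<phi>\<in>F. fitting B (misplaced B (frame k v) \<phi>) \<phi>)"
    using finF finite_carvings by (intro card_mono) (auto simp: fitting_def)
  also have "\<dots> \<le> (\<Sum>\<phi>\<in>F. card (fitting B (misplaced B (frame k v) \<phi>) \<phi>))"
    by (rule card_UN_le[OF finF])
  finally have "real (card ?bad) \<le> (\<Sum>\<phi>\<in>F. real (card (fitting B (misplaced B (frame k v) \<phi>) \<phi>)))"
    unfolding of_nat_sum[symmetric] by (simp only: of_nat_le_iff)
  also have "\<dots> \<le> (\<Sum>\<phi>\<in>F. real (card \<Omega>) * wt \<phi>)" by (rule sum_mono[OF fit])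
  also have "\<dots> = real (card \<Omega>) * (\<Sum>\<phi>\<in>F. wt \<phi>)" by (simp add: sum_distrib_left)
  also have "\<dots> \<le> real (card \<Omega>) * (2 * w)"
  proof (rule mult_left_mono)
    let ?z = "1 / (2 * M)"
    have M0: "M > 0" unfolding M by (intro zero_less_power) (simp add: add_nonneg_pos)
    have "(\<Sum>\<phi>\<in>F. wt \<phi>) = (\<Sum>Y\<in>pat ` F. \<Sum>\<phi>\<in>{\<phi> \<in> F. pat \<phi> = Y}. wt \<phi>)"
      by (rule sum.image_gen[OF finF])
    also have "\<dots> \<le> (\<Sum>Y\<in>pat ` F. w * ?z ^ cx Y)"
    proof (rule sum_mono)
      fix Y assume "Y \<in> pat ` F"
      let ?FY = "{\<phi> \<in> F. pat \<phi> = Y}" and ?c = "(4 * real (card O')) ^ fc Y"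
      have each: "?c * wt \<phi> \<le> w * ?z ^ cx Y" if "\<phi> \<in> ?FY" for \<phi>
      proof -
        have "Y = (misplaced B (frame k v) \<phi>, mates B (misplaced B (frame k v) \<phi>) \<phi>)"
          using that by (simp add: pat_def)
        moreover have "placed_box B k \<phi>" "\<And>p. p \<in> B \<Longrightarrow> fst (\<phi> p) \<in> G" "X \<phi>"
          "\<And>p. p \<in> misplaced B (frame k v) \<phi> \<Longrightarrow> fst (\<phi> p) \<in> O'" using that by (auto simp: F_def)
        ultimately show ?thesis using main[of \<phi>] by (simp add: fc_def cx_def wt_def)
      qed
      have cd: "real (card ?FY) \<le> ?c"
        using card_mono[OF comp(1) Fc, of Y] comp(2)[of Y] by linarith
      have "?c * (\<Sum>\<phi>\<in>?FY. wt \<phi>) = (\<Sum>\<phi>\<in>?FY. ?c * wt \<phi>)" by (simp add: sum_distrib_left)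
      also have "\<dots> \<le> real (card ?FY) * (w * ?z ^ cx Y)"
        using sum_bounded_above[of ?FY "\<lambda>\<phi>. ?c * wt \<phi>", OF each] by simp
      also have "\<dots> \<le> ?c * (w * ?z ^ cx Y)" using cd w M0 by (intro mult_right_mono) auto
      finally have *: "?c * (\<Sum>\<phi>\<in>?FY. wt \<phi>) \<le> ?c * (w * ?z ^ cx Y)" .
      show "(\<Sum>\<phi>\<in>?FY. wt \<phi>) \<le> w * ?z ^ cx Y"
      \<comment> \<open>The estimate is divided by the bound \<open>?c\<close> on the number of
        completions; if that bound is zero, there is nothing to sum over.\<close>
      proof (cases "?c = 0")
        case True
        have "card ?FY = 0" using cd unfolding True by simp
        then have "?FY = {}" using finY by simp
        then show ?thesis using w M0 by (simp only: sum.empty) simp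
      next
        case False
        then have "?c > 0" by (metis less_eq_real_def of_nat_0_le_iff mult_nonneg_nonneg zero_le_numeral zero_le_power)
        then show ?thesis using * by (simp only: mult_le_cancel_left_pos)
      qed
    qed
    also have "\<dots> = (\<Sum>m\<in>cx ` pat ` F. \<Sum>Y\<in>{Y \<in> pat ` F. cx Y = m}. w * ?z ^ cx Y)"
      by (rule sum.image_gen[OF finPF])
    also have "\<dots> \<le> (\<Sum>m\<in>cx ` pat ` F. w * (1 / 2) ^ m)"
    proof (rule sum_mono)
      fix m
      have "(\<Sum>Y\<in>{Y \<in> pat ` F. cx Y = m}. w * ?z ^ cx Y) = real (card {Y \<in> pat ` F. cx Y = m}) * (w * ?z ^ m)"
        by simp
      \<comment> \<open>There are at most \<open>M ^ m\<close> patterns of complexity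
        \<open>m\<close>, each of weight \<open>w / (2 * M) ^ m\<close>; a geometric series with
        ratio 1/2 remains.\<close>
      also have "real (card {Y \<in> pat ` F. cx Y = m}) \<le> M ^ m"
      proof -
        have "card {Y \<in> pat ` F. cx Y = m} \<le> card {Y \<in> patterns B k v. cx Y = m}"
          using fp finP by (intro card_mono) auto
        also have "\<dots> \<le> ((16 * (card B)\<^sup>2 + 1) ^ 4) ^ m"
          using card_patterns[OF finB B(2), of k v m] by (simp add: cx_def)
        finally have "real (card {Y \<in> pat ` F. cx Y = m}) \<le> real (((16 * (card B)\<^sup>2 + 1) ^ 4) ^ m)"
          by (simp only: of_nat_le_iff)
        then show ?thesis by (simp add: M add.commute)
      qed
      then have "real (card {Y \<in> pat ` F. cx Y = m}) * (w * ?z ^ m) \<le> M ^ m * (w * ?z ^ m)"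
        using w M0 by (intro mult_right_mono) auto
      also have "M ^ m * (w * ?z ^ m) = w * (1 / 2) ^ m"
        using M0 by (simp add: power_divide power_mult_distrib)
      finally show "(\<Sum>Y\<in>{Y \<in> pat ` F. cx Y = m}. w * ?z ^ cx Y) \<le> w * (1 / 2) ^ m" .
    qed
    also have "\<dots> = w * (\<Sum>m\<in>cx ` pat ` F. (1 / 2) ^ m)" by (simp add: sum_distrib_left)
    also have "\<dots> \<le> w * 2"
    proof (rule mult_left_mono[OF _ w])
      have "(\<Sum>m\<in>cx ` pat ` F. (1 / 2) ^ m) \<le> (\<Sum>m. (1 / 2 :: real) ^ m)"
        using finPF by (intro sum_le_suminf summable_geometric) auto
      then show "(\<Sum>m\<in>cx ` pat ` F. (1 / 2) ^ m) \<le> (2 :: real)" by (simp add: suminf_geometric)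
    qed
    finally show "(\<Sum>\<phi>\<in>F. wt \<phi>) \<le> 2 * w" by simp
  qed simp
  finally show ?thesis by (simp add: mult_ac)
qed

end

section \<open>Rank against the number of free components\<close>

context placed_box
begin

lemma free_le_unmated: "6 * card (free_components D \<mu>) \<le> 6 * card (D - active \<mu>) + card (unmated D \<mu> \<inter> sides (active \<mu>))"
  using card_free_components big_components_bound by linarith

lemma sqrt_card_le_perimeter: "sqrt (real (card D)) \<le> real (perimeter D) / 4"
proof (rule real_le_lsqrt)
  have "real (16 * card D) \<le> real ((perimeter D)\<^sup>2)" using isoperimetric[OF finD] by (simp only: of_nat_le_iff)
  then show "real (card D) \<le> (real (perimeter D) / 4)\<^sup>2" by (simp add: power_divide)
qed simp

text \<open>The perimeter enters with the factor 1/2. At least two cells have perimeter at least 6,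
  which gives 3, and 5/2 is left after paying for the lost sides and for the complexity. A single
  cell would give 2 at best, not enough against \<open>n^2\<close> boxes.\<close>

lemma rank_interior:
  assumes "2 \<le> card D" "real (card (lost B D)) \<le> sqrt (real (card D)) / 40" "0 \<le> \<kappa>" "\<kappa> \<le> 1 / 1000"
  shows "2 * real (card (free_components D \<mu>)) + 5 / 2 + \<kappa> * real (complexity D \<mu>) \<le> rank4 / 4"
proof -
  define f t pA u m P l where def: "f = real (card (free_components D \<mu>))" "t = real (card (D - active \<mu>))"
    "pA = real (card (unmated D \<mu> \<inter> sides (active \<mu>)))" "u = real (card (unmated D \<mu>))"
    "m = real (card (inner_mated D \<mu>))" "P = real (perimeter D)" "l = real (card (lost B D))"
  have "real (6 * card (free_components D \<mu>)) \<le> real (6 * card (D - active \<mu>) + card (unmated D \<mu> \<inter> sides (active \<mu>)))"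
    using free_le_unmated by (rule of_nat_mono)
  then have 1: "6 * f \<le> 6 * t + pA" by (simp add: def)
  have 2: "u = 4 * t + pA" using card_unmated by (simp add: def)
  have 3: "l \<le> P / 160" using assms(2) sqrt_card_le_perimeter by (simp add: def)
  have 4: "6 \<le> P" using perimeter_ge_6[OF finD assms(1)] by (simp add: def)
  have 5: "rank4 \<ge> m + 2 * u + 2 * P - 4 * l" using rank4_ge by (simp add: def)
  have c: "real (complexity D \<mu>) = m + pA + P" by (simp add: complexity_def def)
  have nn: "0 \<le> m" "0 \<le> pA" by (simp_all add: def)
  have "\<kappa> * (m + pA + P) \<le> (1 / 1000) * (m + pA + P)" using assms nn 4 by (intro mult_right_mono) auto
  then show ?thesis using 1 2 3 4 5 nn unfolding c def(1)[symmetric] by argo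
qed

text \<open>Up to half of the perimeter may be lost here, so a price of 2 per free component cannot
  be afforded. The price 5/4 suffices where the stock of pieces has size \<open>n\<close> up to
  logarithmic factors, and it leaves room for the perimeter bound on the rank.\<close>

lemma rank_border:
  assumes D: "D \<noteq> {}" and l: "real (card (lost B D)) \<le> b + sqrt (real (card D)) / 40"
    and b: "2 * b + 2 * e \<le> real (perimeter D)" and e: "0 \<le> e" "e \<le> 1" and \<kappa>: "0 \<le> \<kappa>" "\<kappa> \<le> 1 / 1000"
  shows "5 / 4 * real (card (free_components D \<mu>)) + (e + 1 / 60) + \<kappa> * real (complexity D \<mu>) \<le> rank4 / 4"
proof -
  define f t pA u m P l' where def: "f = real (card (free_components D \<mu>))" "t = real (card (D - active \<mu>))"
    "pA = real (card (unmated D \<mu> \<inter> sides (active \<mu>)))" "u = real (card (unmated D \<mu>))"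
    "m = real (card (inner_mated D \<mu>))" "P = real (perimeter D)" "l' = real (card (lost B D))"
  have "real (6 * card (free_components D \<mu>)) \<le> real (6 * card (D - active \<mu>) + card (unmated D \<mu> \<inter> sides (active \<mu>)))"
    using free_le_unmated by (rule of_nat_mono)
  then have 1: "6 * f \<le> 6 * t + pA" by (simp add: def)
  have 2: "u = 4 * t + pA" using card_unmated by (simp add: def)
  have 3: "l' \<le> b + P / 160" using l sqrt_card_le_perimeter by (simp add: def)
  have 4: "4 \<le> P" using perimeter_ge_4[OF finD D] by (simp add: def)
  have 5: "rank4 \<ge> m + 2 * u + 2 * P - 4 * l'" using rank4_ge by (simp add: def)
  have 6: "rank4 \<ge> 2 * P - 2 * l'" using rank4_ge_perimeter by (simp add: def)
  have 7: "2 * b + 2 * e \<le> P" using b by (simp add: def)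
  have c: "real (complexity D \<mu>) = m + pA + P" by (simp add: complexity_def def)
  have nn: "0 \<le> m" "0 \<le> pA" "0 \<le> t" by (simp_all add: def)
  have "\<kappa> * (m + pA + P) \<le> (1 / 1000) * (m + pA + P)" using \<kappa> nn 4 by (intro mult_right_mono) auto
  \<comment> \<open>Weights 5/8 and 3/8 on the bounds 5 and 6 suffice: 5/8 of the contribution
    \<open>2 * t\<close> of the lone cells is exactly \<open>5 / 4 * t\<close>, and 3/8 of the
    perimeter bound supplies the constant terms.\<close>
  then show ?thesis using 1 2 3 4 5 6 7 nn e unfolding c def(1)[symmetric] by argo
qed

end

context puzzle
begin

text \<open>The number of patterns per unit of complexity is polynomial in the size of the box,
  hence below \<open>q0 powr \<kappa>\<close>; all that remains to be checked is an inequality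
  between exponents.\<close>

lemma union_bound_size:
  fixes q0 a \<kappa> :: real
  assumes B: "B \<subseteq> G" "B \<noteq> {}" "card B \<le> b" and k: "k < 4" and O': "finite O'" and q0: "1 \<le> q0" "q0 \<le> real q"
    and \<kappa>: "2 * (16 * real (b\<^sup>2) + 1) ^ 4 \<le> q0 powr \<kappa>"
    and main: "\<And>\<phi>. placed_box B k \<phi> \<Longrightarrow> X \<phi> \<Longrightarrow>
      (4 * real (card O')) ^ card (free_components (misplaced B (frame k v) \<phi>) (mates B (misplaced B (frame k v) \<phi>) \<phi>))
      \<le> q0 powr (placed_box.rank4 B k v \<phi> / 4 - a
          - \<kappa> * real (complexity (misplaced B (frame k v) \<phi>) (mates B (misplaced B (frame k v) \<phi>) \<phi>)))"
  shows "real (card {\<omega> \<in> \<Omega>. \<exists>\<phi>. assembly \<omega> \<phi> \<and> X (restrict \<phi> B) \<and>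
      (\<forall>p \<in> misplaced B (frame k v) \<phi>. fst (\<phi> p) \<in> O')}) \<le> 2 * q0 powr (- a) * real (card \<Omega>)"
proof (rule union_bound[where M = "(16 * real ((card B)\<^sup>2) + 1) ^ 4", OF B(1,2) k O' q0])
  fix \<phi> assume pb: "placed_box B k \<phi>" and X: "X \<phi>"
  let ?D = "misplaced B (frame k v) \<phi>"
  let ?\<mu> = "mates B ?D \<phi>"
  let ?r = "placed_box.rank4 B k v \<phi> / 4" and ?c = "complexity ?D ?\<mu>"
  let ?M = "2 * (16 * real ((card B)\<^sup>2) + 1) ^ 4"
  have q0p: "q0 > 0" using q0 by simp
  have "real ((card B)\<^sup>2) \<le> real (b\<^sup>2)" using B(3) by (intro of_nat_mono power_mono) auto
  then have "?M \<le> 2 * (16 * real (b\<^sup>2) + 1) ^ 4" by (intro mult_left_mono power_mono) auto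
  also have "\<dots> \<le> q0 powr \<kappa>" by (rule \<kappa>)
  finally have M: "?M \<le> q0 powr \<kappa>" .
  have M0: "?M > 0" by (intro mult_pos_pos zero_less_power) (auto simp: add_nonneg_pos)
  have "q0 powr (- \<kappa> * real ?c) = (q0 powr (- \<kappa>)) ^ ?c"
    using q0p by (simp add: powr_power mult_ac)
  also have "\<dots> \<le> (1 / ?M) ^ ?c"
  proof (rule power_mono)
    have "inverse (q0 powr \<kappa>) \<le> inverse ?M" using M M0 by (rule le_imp_inverse_le)
    then show "q0 powr (- \<kappa>) \<le> 1 / ?M" by (simp only: powr_minus inverse_eq_divide)
  qed simp
  finally have z: "q0 powr (- \<kappa> * real ?c) \<le> (1 / ?M) ^ ?c" .
  have "(4 * real (card O')) ^ card (free_components ?D ?\<mu>) * q0 powr (- placed_box.rank4 B k v \<phi> / 4)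
     \<le> q0 powr (?r - a - \<kappa> * real ?c) * q0 powr (- ?r)"
    using main[OF pb X] by (simp add: mult_right_mono)
  also have "\<dots> = q0 powr (- a) * q0 powr (- \<kappa> * real ?c)" by (simp add: powr_add[symmetric])
  also have "\<dots> \<le> q0 powr (- a) * (1 / ?M) ^ ?c" using z by (intro mult_left_mono) auto
  finally show "(4 * real (card O')) ^ card (free_components ?D ?\<mu>) * q0 powr (- placed_box.rank4 B k v \<phi> / 4)
     \<le> q0 powr (- a) * (1 / ?M) ^ ?c" .
qed simp_all

lemma interior_bound:
  fixes q0 \<kappa> :: real
  assumes B: "B \<subseteq> G" "B \<noteq> {}" "card B \<le> b" and k: "k < 4" and q0: "1 \<le> q0" "q0 \<le> real q" "2 * real n \<le> q0"
    and \<kappa>: "2 * (16 * real (b\<^sup>2) + 1) ^ 4 \<le> q0 powr \<kappa>" "0 \<le> \<kappa>" "\<kappa> \<le> 1 / 1000"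
  shows "real (card {\<omega> \<in> \<Omega>. \<exists>\<phi>. assembly \<omega> \<phi> \<and> 2 \<le> card (misplaced B (frame k v) \<phi>) \<and>
      real (card (lost B (misplaced B (frame k v) \<phi>))) \<le> sqrt (real (card (misplaced B (frame k v) \<phi>))) / 40})
    \<le> 2 * q0 powr (- 5 / 2) * real (card \<Omega>)"
proof -
  let ?D = "\<lambda>\<phi>. misplaced B (frame k v) \<phi>"
  let ?X = "\<lambda>\<phi>. 2 \<le> card (?D \<phi>) \<and> real (card (lost B (?D \<phi>))) \<le> sqrt (real (card (?D \<phi>))) / 40"
  have "real (card {\<omega> \<in> \<Omega>. \<exists>\<phi>. assembly \<omega> \<phi> \<and> ?X (restrict \<phi> B) \<and> (\<forall>p \<in> ?D \<phi>. fst (\<phi> p) \<in> G)})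
      \<le> 2 * q0 powr (- (5 / 2)) * real (card \<Omega>)"
  proof (rule union_bound_size[OF B k finite_cells q0(1,2) \<kappa>(1)])
    fix \<phi> assume pb: "placed_box B k \<phi>" and X: "?X \<phi>"
    interpret placed_box B k v \<phi> by fact
    have "4 * real (card G) \<le> q0 powr 2"
    proof -
      have "(2 * real n)\<^sup>2 \<le> q0\<^sup>2" using q0 by (intro power_mono) auto
      then show ?thesis using q0 by (simp add: card_cells power_mult_distrib)
    qed
    then have "(4 * real (card G)) ^ card (free_components D \<mu>) \<le> (q0 powr 2) ^ card (free_components D \<mu>)"
      by (intro power_mono) auto
    also have "\<dots> = q0 powr (2 * real (card (free_components D \<mu>)))"
      using q0 by (subst powr_power) (simp_all add: mult.commute)
    also have "\<dots> \<le> q0 powr (rank4 / 4 - 5 / 2 - \<kappa> * real (complexity D \<mu>))"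
      using rank_interior[of \<kappa>] X \<kappa> q0 by (intro powr_mono) auto
    finally show "(4 * real (card G)) ^ card (free_components D \<mu>) \<le> q0 powr (rank4 / 4 - 5 / 2 - \<kappa> * real (complexity D \<mu>))" .
  qed
  moreover have "fst (\<phi> p) \<in> G" if "assembly \<omega> \<phi>" "p \<in> ?D \<phi>" for \<phi> \<omega> p
    using that B by (auto simp: assembly_def misplaced_def)
  then have "{\<omega> \<in> \<Omega>. \<exists>\<phi>. assembly \<omega> \<phi> \<and> ?X (restrict \<phi> B) \<and> (\<forall>p \<in> ?D \<phi>. fst (\<phi> p) \<in> G)}
     = {\<omega> \<in> \<Omega>. \<exists>\<phi>. assembly \<omega> \<phi> \<and> ?X \<phi>}"
    unfolding misplaced_restrict by blast
  ultimately show ?thesis by simp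
qed

lemma border_bound:
  fixes q0 \<kappa> e :: real
  assumes B: "B \<subseteq> G" "B \<noteq> {}" "card B \<le> b" and k: "k < 4" and q0: "1 \<le> q0" "q0 \<le> real q"
    and O': "finite O'" "4 * real (card O') \<le> q0 powr (5 / 4)"
    and \<kappa>: "2 * (16 * real (b\<^sup>2) + 1) ^ 4 \<le> q0 powr \<kappa>" "0 \<le> \<kappa>" "\<kappa> \<le> 1 / 1000" and e: "0 \<le> e" "e \<le> 1"
    and X: "\<And>D. X D \<Longrightarrow> D \<noteq> {} \<and> (\<exists>d. real (card (lost B D)) \<le> d + sqrt (real (card D)) / 40 \<and> 2 * d + 2 * e \<le> real (perimeter D))"
  shows "real (card {\<omega> \<in> \<Omega>. \<exists>\<phi>. assembly \<omega> \<phi> \<and> X (misplaced B (frame k v) \<phi>) \<and>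
      (\<forall>p \<in> misplaced B (frame k v) \<phi>. fst (\<phi> p) \<in> O')})
    \<le> 2 * q0 powr (- (e + 1 / 60)) * real (card \<Omega>)"
proof -
  let ?D = "\<lambda>\<phi>. misplaced B (frame k v) \<phi>"
  have "real (card {\<omega> \<in> \<Omega>. \<exists>\<phi>. assembly \<omega> \<phi> \<and> X (?D (restrict \<phi> B)) \<and> (\<forall>p \<in> ?D \<phi>. fst (\<phi> p) \<in> O')})
      \<le> 2 * q0 powr (- (e + 1 / 60)) * real (card \<Omega>)"
  proof (rule union_bound_size[OF B k O'(1) q0 \<kappa>(1)])
    fix \<phi> assume pb: "placed_box B k \<phi>" and XD: "X (?D \<phi>)"
    interpret placed_box B k v \<phi> by fact
    obtain d where d: "D \<noteq> {}" "real (card (lost B D)) \<le> d + sqrt (real (card D)) / 40"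
      "2 * d + 2 * e \<le> real (perimeter D)" using X[OF XD] by blast
    have "(4 * real (card O')) ^ card (free_components D \<mu>) \<le> (q0 powr (5 / 4)) ^ card (free_components D \<mu>)"
      using O' by (intro power_mono) auto
    also have "\<dots> = q0 powr (5 / 4 * real (card (free_components D \<mu>)))"
      using q0 by (simp add: powr_power mult_ac)
    also have "\<dots> \<le> q0 powr (rank4 / 4 - (e + 1 / 60) - \<kappa> * real (complexity D \<mu>))"
      using rank_border[OF d e \<kappa>(2,3)] q0 by (intro powr_mono) auto
    finally show "(4 * real (card O')) ^ card (free_components D \<mu>)
      \<le> q0 powr (rank4 / 4 - (e + 1 / 60) - \<kappa> * real (complexity D \<mu>))" .
  qed
  then show ?thesis unfolding misplaced_restrict .
qed

end

section \<open>Windows\<close>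

text \<open>For the largest \<open>y i\<close>, the sum of all \<open>a j\<close> is at most
  \<open>y i * Y\<close>, and the other terms together contribute at most the square of their total
  length \<open>Y - y i\<close>. It is applied to areas \<open>a\<close> and quarter perimeters
  \<open>y\<close>: if the total area is nearly the square of the total length, then one part has
  almost everything.\<close>

lemma dominant_term:
  fixes y a :: "'i \<Rightarrow> real"
  assumes I: "finite I" "I \<noteq> {}" and y: "\<And>i. i \<in> I \<Longrightarrow> 0 \<le> y i" "\<And>i. i \<in> I \<Longrightarrow> a i \<le> (y i)\<^sup>2"
    and Y: "sum y I \<le> Y" and A: "A \<le> sum a I"
  obtains i where "i \<in> I" "A \<le> y i * Y" "A - (Y - y i)\<^sup>2 \<le> a i"
proof -
  obtain i where i: "i \<in> I" "\<And>j. j \<in> I \<Longrightarrow> y j \<le> y i"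
  proof -
    have "Max (y ` I) \<in> y ` I" using I by (intro Max_in) auto
    then obtain i where "i \<in> I" "y i = Max (y ` I)" by force
    then show ?thesis using that[of i] I by simp
  qed
  have Yi: "sum y (I - {i}) = sum y I - y i" using I i by (simp add: sum_diff1)
  have "A \<le> (\<Sum>j\<in>I. y i * y j)"
    using A sum_mono[of I a "\<lambda>j. y i * y j"] y i
    by (smt (verit, best) mult_right_mono power2_eq_square)
  also have "\<dots> = y i * sum y I" by (simp add: sum_distrib_left)
  also have "\<dots> \<le> y i * Y" using Y y i by (intro mult_left_mono) auto
  finally have 1: "A \<le> y i * Y" .
  have nn: "0 \<le> sum y (I - {i})" using y by (intro sum_nonneg) auto
  have "sum a (I - {i}) \<le> (\<Sum>j\<in>I - {i}. sum y (I - {i}) * y j)"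
  proof (rule sum_mono)
    fix j assume j: "j \<in> I - {i}"
    have "y j \<le> sum y (I - {i})" using j I y by (intro member_le_sum) auto
    then have "y j * y j \<le> sum y (I - {i}) * y j" using j y by (intro mult_right_mono) auto
    then show "a j \<le> sum y (I - {i}) * y j" using y(2)[of j] j by (simp add: power2_eq_square)
  qed
  also have "\<dots> = (sum y (I - {i}))\<^sup>2" by (simp add: sum_distrib_left power2_eq_square)
  also have "\<dots> \<le> (Y - y i)\<^sup>2" using nn Yi Y by (intro power_mono) auto
  finally have "sum a I - a i \<le> (Y - y i)\<^sup>2" using I i by (simp add: sum_diff1)
  then show ?thesis using that[OF i(1) 1] A by linarith
qed

lemma perimeter_box:
  "perimeter ({a..<a + int s} \<times> {b..<b + int s}) \<le> 4 * s"
proof -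
  let ?B = "{a..<a + int s} \<times> {b..<b + int s}"
  let ?R = "(\<lambda>y. ((a + int s - 1, y), 0)) ` {b..<b + int s} \<union> (\<lambda>x. ((x, b + int s - 1), 1)) ` {a..<a + int s}
     \<union> (\<lambda>y. ((a, y), 2)) ` {b..<b + int s} \<union> (\<lambda>x. ((x, b), 3)) ` {a..<a + int s} :: side set"
  have "boundary ?B \<subseteq> ?R"
  proof
    fix z assume "z \<in> boundary ?B"
    moreover obtain x y d where z: "z = ((x, y), d)" by (metis prod.exhaust)
    ultimately have *: "a \<le> x" "x < a + int s" "b \<le> y" "y < b + int s" "d < 4" "fst (across ((x, y), d)) \<notin> ?B"
      by (auto simp: boundary_def sides_iff)
    from *(5) show "z \<in> ?R"
    proof (cases rule: less_4_cases)
      case 1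
      then have "x = a + int s - 1" using * by (auto simp: across_def direction_def)
      then show ?thesis using * z 1 by auto
    next
      case 2
      then have "y = b + int s - 1" using * by (auto simp: across_def direction_def)
      then show ?thesis using * z 2 by auto
    next
      case 3
      then have "x = a" using * by (auto simp: across_def direction_def)
      then show ?thesis using * z 3 by auto
    next
      case 4
      then have "y = b" using * by (auto simp: across_def direction_def)
      then show ?thesis using * z 4 by auto
    qed
  qed
  then have "perimeter ?B \<le> card ?R" unfolding perimeter_def by (intro card_mono) auto
  also have "\<dots> \<le> s + s + s + s"
    by (intro order_trans[OF card_Un_le] add_mono order_trans[OF card_image_le]) auto
  finally show ?thesis by simp
qed

context placed_box
begin

lemma free_components_all:
  assumes "D = B" shows "free_components D \<mu> = component D \<mu> ` D"
proof -
  have "facing B D = {}" using assms by (auto simp: facing_def sides_iff)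
  then have "s' \<in> sides D" if "(s, s') \<in> \<mu>" for s s' using mates_domain[OF that] by simp
  then show ?thesis unfolding free_components_def by auto
qed

lemma Union_free_components: "D = B \<Longrightarrow> \<Union> (free_components D \<mu>) = B"
proof -
  assume DB: "D = B"
  have "\<Union> (component D \<mu> ` D) = D" using component_self[of _ D \<mu>] component_sub[of _ D \<mu>] by blast
  then show ?thesis using free_components_all[OF DB] DB by simp
qed

lemma sum_card_free_components:
  assumes "D = B" shows "(\<Sum>K\<in>free_components D \<mu>. card K) = card B"
proof -
  have "card (\<Union> (free_components D \<mu>)) = (\<Sum>K\<in>free_components D \<mu>. card K)"
    using free_components_disjoint free_component_card(2)
    by (intro card_Union_disjoint) (auto simp: pairwise_def disjnt_def)
  then show ?thesis using Union_free_components[OF assms] by simp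
qed

lemma sum_unmated_free_components:
  assumes "D = B" shows "(\<Sum>K\<in>free_components D \<mu>. card (unmated D \<mu> \<inter> sides K)) = card (unmated D \<mu>)"
proof -
  have "(\<Sum>K\<in>free_components D \<mu>. card (unmated D \<mu> \<inter> sides K))
      = card (\<Union>K\<in>free_components D \<mu>. unmated D \<mu> \<inter> sides K)"
  proof (rule card_UN_disjoint[symmetric, OF finite_free_components])
    show "\<forall>K\<in>free_components D \<mu>. finite (unmated D \<mu> \<inter> sides K)" using finite_mated by blast
    show "\<forall>K\<in>free_components D \<mu>. \<forall>L\<in>free_components D \<mu>. K \<noteq> L \<longrightarrow> (unmated D \<mu> \<inter> sides K) \<inter> (unmated D \<mu> \<inter> sides L) = {}"
    proof (intro ballI impI)
      fix K L assume "K \<in> free_components D \<mu>" "L \<in> free_components D \<mu>" "K \<noteq> L"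
      then have "K \<inter> L = {}" by (rule free_components_disjoint)
      then show "(unmated D \<mu> \<inter> sides K) \<inter> (unmated D \<mu> \<inter> sides L) = {}" by (auto simp: sides_iff)
    qed
  qed
  also have "(\<Union>K\<in>free_components D \<mu>. unmated D \<mu> \<inter> sides K) = unmated D \<mu>"
  proof
    show "unmated D \<mu> \<subseteq> (\<Union>K\<in>free_components D \<mu>. unmated D \<mu> \<inter> sides K)"
    proof
      fix s assume s: "s \<in> unmated D \<mu>"
      then have "fst s \<in> \<Union> (free_components D \<mu>)"
        unfolding Union_free_components[OF assms] using assms by (auto simp: unmated_def sides_iff)
      then show "s \<in> (\<Union>K\<in>free_components D \<mu>. unmated D \<mu> \<inter> sides K)"
        using s by (auto simp: unmated_def sides_iff)
    qed
  qed auto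
  finally show ?thesis .
qed

text \<open>The parameters of the unique frame that agrees with \<open>\<phi>\<close> at
  \<open>p\<close>.\<close>

definition frame_data :: "cell \<Rightarrow> nat \<times> cell" where
  "frame_data p = (snd (\<phi> p), fst (\<phi> p) - (quarter_turn ^^ (3 * snd (\<phi> p))) p)"

lemma frame_data_iff: "frame_data p = (k', v') \<longleftrightarrow> \<phi> p = frame k' v' p"
  by (auto simp: frame_data_def frame_def prod_eq_iff)

text \<open>Preserved adjacencies never join two frames. A boundary side of a class of cells with
  equal frames therefore has no mate, or has it at a place other than opposite.\<close>

lemma sum_perimeter_classes:
  assumes K: "K \<in> free_components D \<mu>" and DB: "D = B"
  shows "(\<Sum>f\<in>frame_data ` K. perimeter {p \<in> K. frame_data p = f}) \<le> card (unmated D \<mu> \<inter> sides K) + card (inner_mated D \<mu>)"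
proof -
  obtain c where c: "c \<in> D" "K = component D \<mu> c" using K by (auto simp: free_components_def)
  have KD: "K \<subseteq> D" using free_components_sub[OF K] by simp
  have finK: "finite K" using free_component_card(2)[OF K] .
  have out: "s' \<in> sides D" if "(s, s') \<in> \<mu>" for s s'
    using mates_domain[OF that] DB by (auto simp: facing_def sides_iff)
  have "(\<Sum>f\<in>frame_data ` K. perimeter {p \<in> K. frame_data p = f}) = card (\<Union>f\<in>frame_data ` K. boundary {p \<in> K. frame_data p = f})"
    unfolding perimeter_def using finK
  proof (intro card_UN_disjoint[symmetric] finite_imageI ballI impI finite_boundary)
    fix f g :: "nat \<times> cell" assume "f \<noteq> g"
    then show "boundary {p \<in> K. frame_data p = f} \<inter> boundary {p \<in> K. frame_data p = g} = {}"
      unfolding boundary_def sides_iff by blast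
  qed auto
  also have "(\<Union>f\<in>frame_data ` K. boundary {p \<in> K. frame_data p = f}) \<subseteq> (unmated D \<mu> \<inter> sides K) \<union> inner_mated D \<mu>"
  proof
    fix s assume "s \<in> (\<Union>f\<in>frame_data ` K. boundary {p \<in> K. frame_data p = f})"
    then have s: "fst s \<in> K" "snd s < 4" "fst (across s) \<in> K \<Longrightarrow> frame_data (fst (across s)) \<noteq> frame_data (fst s)"
      by (auto simp: boundary_def sides_iff)
    have sD: "s \<in> sides D" using s KD by (auto simp: sides_iff)
    show "s \<in> (unmated D \<mu> \<inter> sides K) \<union> inner_mated D \<mu>"
    proof (cases "s \<in> Domain \<mu>")
      case True
      then obtain s' where s': "(s, s') \<in> \<mu>" by blast
      have "s' \<noteq> across s"
      proof
        assume e: "s' = across s"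
        have 1: "fst (across s) \<in> D" using out[OF s'] e by (simp add: sides_iff)
        have 2: "fst (across s) \<in> K"
          using component_closed[of "fst s" D \<mu> c s s'] s' e s c KD 1 by auto
        have "orig_side \<phi> (across s) = across (orig_side \<phi> s)" using preserved_in_mates[OF sD] s' e by simp
        moreover obtain v' where "\<phi> (fst s) = frame (snd (\<phi> (fst s))) v' (fst s)"
          using frame_at[of \<phi> "fst s"] rot s(1) KD D_sub by blast
        ultimately have "\<phi> (fst (across s)) = frame (snd (\<phi> (fst s))) v' (fst (across s))"
          using preserved_same_frame s(2) rot s(1) 1 KD D_sub by blast
        then have "frame_data (fst (across s)) = frame_data (fst s)"
          using frame_data_iff \<open>\<phi> (fst s) = frame (snd (\<phi> (fst s))) v' (fst s)\<close> by metis
        then show False using s(3) 2 by simp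
      qed
      then show ?thesis using s' sD out[OF s'] unfolding inner_mated_def by blast
    qed (use s sD in \<open>auto simp: unmated_def sides_iff\<close>)
  qed
  then have "card (\<Union>f\<in>frame_data ` K. boundary {p \<in> K. frame_data p = f}) \<le> card ((unmated D \<mu> \<inter> sides K) \<union> inner_mated D \<mu>)"
    using finite_mated by (intro card_mono) auto
  also have "\<dots> \<le> card (unmated D \<mu> \<inter> sides K) + card (inner_mated D \<mu>)" by (rule card_Un_le)
  finally show ?thesis .
qed

text \<open>
  A window whose rank is too small has, up to small fractions, a single original component, hence
  few unpreserved sides, hence a single frame. Both steps are isoperimetric.
\<close>

lemma window_dominant:
  fixes s \<kappa> \<tau> :: real
  assumes DB: "D = B" and B: "real (card B) = s\<^sup>2" "real (perimeter B) \<le> 4 * s" and s: "100000000 \<le> s"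
    and \<kappa>: "0 \<le> \<kappa>" "\<kappa> \<le> 1 / 100000000" and \<tau>: "3 * 1000000 \<le> \<tau> * s"
    and low: "rank4 / 4 < (2 - \<tau>) * real (card (free_components D \<mu>)) + 3 + \<kappa> * real (complexity D \<mu>)"
  obtains k' v' where "(1 - 3 / 1000000) * s\<^sup>2 \<le> real (card {p \<in> B. \<phi> p = frame k' v' p})"
proof -
  let ?FC = "free_components D \<mu>"
  \<comment> \<open>The quarter perimeter is lowered by 1 to remove the price of the component's
    position. A lone piece gets \<open>x K = 0\<close>, and isoperimetry becomes
    \<open>card K \<le> (x K + 1)^2\<close>.\<close>
  define x where "x K = real (card (unmated D \<mu> \<inter> sides K)) / 4 - 1" for K
  define A where "A = sum x ?FC"
  define f m u P pA where def: "f = real (card ?FC)" "m = real (card (inner_mated D \<mu>))"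
    "u = real (card (unmated D \<mu>))" "P = real (perimeter B)" "pA = real (card (unmated D \<mu> \<inter> sides (active \<mu>)))"
  define t where "t = real (card (D - active \<mu>))"
  have per: "perimeter ((\<lambda>p. fst (\<phi> p)) ` K) = card (unmated D \<mu> \<inter> sides K)" if "K \<in> ?FC" for K
    by (rule free_component_perimeter[OF that])
  have x0: "0 \<le> x K" if "K \<in> ?FC" for K
    using perimeter_ge_4[of "(\<lambda>p. fst (\<phi> p)) ` K"] free_component_card(2)[OF that] free_components_sub[OF that] per[OF that]
    by (simp add: x_def)
  have xK: "real (card K) - 2 * x K - 1 \<le> (x K)\<^sup>2" if "K \<in> ?FC" for K
  proof -
    have "16 * card K \<le> (card (unmated D \<mu> \<inter> sides K))\<^sup>2"
      using isoperimetric[of "(\<lambda>p. fst (\<phi> p)) ` K"] free_component_card[OF that] per[OF that] by simp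
    then have "real (16 * card K) \<le> real ((card (unmated D \<mu> \<inter> sides K))\<^sup>2)" by (rule of_nat_mono)
    then have "16 * real (card K) \<le> (4 * (x K + 1))\<^sup>2" by (simp add: x_def)
    then show ?thesis by (simp add: power2_eq_square algebra_simps)
  qed
  have fin: "finite ?FC" by (rule finite_free_components)
  have u4: "u = 4 * A + 4 * f"
  proof -
    have "u = (\<Sum>K\<in>?FC. real (card (unmated D \<mu> \<inter> sides K)))"
      using sum_unmated_free_components[OF DB] unfolding def by (metis of_nat_sum)
    also have "\<dots> = (\<Sum>K\<in>?FC. 4 * x K + 4)" by (simp add: x_def)
    also have "\<dots> = 4 * A + 4 * f" by (simp add: A_def def sum.distrib sum_distrib_left)
    finally show ?thesis .
  qed
  \<comment> \<open>As all cells of the window count as misplaced, all boundary sides are lost, and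
    the window costs \<open>P / 2 \<le> 2 * s\<close> in the exponent.\<close>
  have lP: "real (card (lost B D)) = P" "real (perimeter D) = P" unfolding def DB by (simp_all add: lost_def perimeter_def boundary_def)
  have r: "rank4 \<ge> m + 2 * u - 2 * P" using rank4_ge unfolding lP by (simp add: def)
  have f6: "6 * f \<le> 6 * t + pA"
  proof -
    have "real (6 * card ?FC) \<le> real (6 * card (D - active \<mu>) + card (unmated D \<mu> \<inter> sides (active \<mu>)))"
      using free_le_unmated by (rule of_nat_mono)
    then show ?thesis by (simp add: def t_def)
  qed
  have ut: "u = 4 * t + pA" using card_unmated by (simp add: def t_def)
  have cx: "real (complexity D \<mu>) = m + pA + P" using lP(2) by (simp add: complexity_def def)
  have nn: "0 \<le> m" "0 \<le> pA" "0 \<le> f" "0 \<le> A" "0 \<le> P" using x0 by (auto simp: def A_def intro: sum_nonneg)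
  have pA12: "pA \<le> 12 * A" using f6 ut u4 by argo
  have P4: "P \<le> 4 * s" using B by (simp add: def)
  have kz: "\<kappa> * (m + pA + P) \<le> 1 / 100000000 * (m + 12 * A + 4 * s)"
    using \<kappa> nn pA12 P4 by (intro mult_mono) auto
  \<comment> \<open>The contribution \<open>2 * f\<close> of the components to the rank is cancelled
    by their price except for \<open>\<tau> * f\<close>.\<close>
  have main: "m / 4 + 2 * A + \<tau> * f \<le> 2 * s + 3 + 1 / 100000000 * (m + 12 * A + 4 * s)"
  proof -
    define z where "z = \<kappa> * (m + pA + P)"
    have "rank4 / 4 < 2 * f - \<tau> * f + 3 + z"
      using low unfolding cx def(1)[symmetric] z_def by (simp add: left_diff_distrib)
    moreover have "z \<le> 1 / 100000000 * (m + 12 * A + 4 * s)" using kz by (simp add: z_def)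
    ultimately show ?thesis using r u4 P4 by argo
  qed
  have \<tau>0: "0 < \<tau>" using \<tau> s by (smt (verit) mult_nonpos_nonneg power_one_right zero_less_power)
  have \<tau>f: "0 \<le> \<tau> * f" using \<tau>0 nn by simp
  have s3: "3 \<le> 3 / 100000000 * s" using s by simp
  have A1: "A \<le> (1 + 1 / 1000000) * s" using main \<tau>f nn s3 s by argo
  \<comment> \<open>A component gains only \<open>\<tau>\<close> by itself, so components are few in
    comparison with the area only if \<open>s\<close> is large against
    \<open>1 / \<tau>\<close>.\<close>
  have "\<tau> * f \<le> 3 * s" using main \<tau>f nn s3 s by argo
  then have "\<tau> * f * s \<le> 3 * s * s" using s by (intro mult_right_mono) auto
  moreover have "3 * 1000000 * f \<le> \<tau> * s * f" using \<tau> nn by (intro mult_right_mono) auto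
  ultimately have f1: "f \<le> 1 / 1000000 * s\<^sup>2" by (simp add: power2_eq_square algebra_simps)
  have ss: "100000000 * s \<le> s\<^sup>2" using mult_right_mono[OF s, of s] s by (simp add: power2_eq_square)
  have cB: "real (card B) = (\<Sum>K\<in>?FC. real (card K))"
    using sum_card_free_components[OF DB] by (metis of_nat_sum)
  have ne: "?FC \<noteq> {}"
  proof
    assume "?FC = {}"
    then have "s\<^sup>2 = 0" using cB B by simp
    then show False using s by simp
  qed
  have sm: "s\<^sup>2 - 2 * A - f \<le> (\<Sum>K\<in>?FC. real (card K) - 2 * x K - 1)"
    using cB B(1) by (simp add: A_def def sum_subtractf sum_distrib_left)
  obtain K where K: "K \<in> ?FC" "s\<^sup>2 - 2 * A - f \<le> x K * A"
    "s\<^sup>2 - 2 * A - f - (A - x K)\<^sup>2 \<le> real (card K) - 2 * x K - 1"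
  proof (rule dominant_term[OF fin ne, of x "\<lambda>K. real (card K) - 2 * x K - 1" A "s\<^sup>2 - 2 * A - f"])
    show "sum x ?FC \<le> A" by (simp add: A_def)
  qed (use x0 xK sm in auto)
  have xKA: "x K \<le> A" unfolding A_def using K(1) fin x0 by (intro member_le_sum) auto
  have xl: "(1 - 3 / 1000000) * s \<le> x K"
  proof -
    have "s\<^sup>2 * (1 - 2 / 1000000) \<le> s\<^sup>2 - 2 * A - f" using A1 f1 ss s by argo
    also have "\<dots> \<le> x K * ((1 + 1 / 1000000) * s)"
      using K(2) mult_left_mono[OF A1 x0[OF K(1)]] by linarith
    finally have "s * (s * (1 - 2 / 1000000)) \<le> s * (x K * (1 + 1 / 1000000))"
      by (simp add: power2_eq_square mult_ac)
    then have "s * (1 - 2 / 1000000) \<le> x K * (1 + 1 / 1000000)" using s by simp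
    then show ?thesis using s by simp
  qed
  \<comment> \<open>The dominant component nearly exhausts the budget of \<open>2 * s\<close> for
    \<open>2 * A\<close>. Hardly any inner mated sides can be left, and these together with the
    unmated ones separate the frames inside the component.\<close>
  have m1: "m \<le> 26 / 1000000 * s" using main \<tau>f nn s3 s xl xKA by argo
  have AxK: "A - x K \<le> 4 / 1000000 * s" using A1 xl s by argo
  have "(A - x K)\<^sup>2 \<le> (4 / 1000000 * s)\<^sup>2" using AxK xKA by (intro power_mono) auto
  then have "(A - x K)\<^sup>2 \<le> 16 / 1000000000000 * s\<^sup>2" by (simp add: power_mult_distrib power_divide)
  then have cK: "(1 - 2 / 1000000) * s\<^sup>2 \<le> real (card K)"
    using K(3) A1 f1 ss s x0[OF K(1)] by argo
  define a y where "a g = real (card {p \<in> K. frame_data p = g})" and "y g = real (perimeter {p \<in> K. frame_data p = g}) / 4" for g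
  have finK: "finite K" using free_component_card(2)[OF K(1)] .
  have "sum y (frame_data ` K) = real (\<Sum>g\<in>frame_data ` K. perimeter {p \<in> K. frame_data p = g}) / 4"
    by (simp add: y_def sum_divide_distrib)
  also have "\<dots> \<le> real (card (unmated D \<mu> \<inter> sides K) + card (inner_mated D \<mu>)) / 4"
    using sum_perimeter_classes[OF K(1) DB] by (intro divide_right_mono of_nat_mono) auto
  also have "\<dots> = x K + 1 + m / 4" by (simp add: x_def def)
  also have "\<dots> \<le> (1 + 9 / 1000000) * s" using xKA A1 m1 s by argo
  finally have ysum: "sum y (frame_data ` K) \<le> (1 + 9 / 1000000) * s" .
  have asum: "sum a (frame_data ` K) = real (card K)"
  proof -
    have "card K = (\<Sum>p\<in>K. 1)" by simp
    also have "\<dots> = (\<Sum>g\<in>frame_data ` K. \<Sum>p\<in>{p \<in> K. frame_data p = g}. 1)" by (rule sum.image_gen[OF finK])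
    finally show ?thesis unfolding a_def by (metis (no_types, lifting) card_eq_sum of_nat_sum sum.cong)
  qed
  have ay: "a g \<le> (y g)\<^sup>2" for g
  proof -
    have "16 * card {p \<in> K. frame_data p = g} \<le> (perimeter {p \<in> K. frame_data p = g})\<^sup>2" using finK by (intro isoperimetric) auto
    then have "real (16 * card {p \<in> K. frame_data p = g}) \<le> real ((perimeter {p \<in> K. frame_data p = g})\<^sup>2)" by (rule of_nat_mono)
    then show ?thesis by (simp add: a_def y_def power_divide)
  qed
  obtain g where g: "(1 - 2 / 1000000) * s\<^sup>2 \<le> y g * ((1 + 9 / 1000000) * s)"
    "(1 - 2 / 1000000) * s\<^sup>2 - ((1 + 9 / 1000000) * s - y g)\<^sup>2 \<le> a g" "g \<in> frame_data ` K"
  proof (rule dominant_term[of "frame_data ` K" y a "(1 + 9 / 1000000) * s" "(1 - 2 / 1000000) * s\<^sup>2"])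
    show "frame_data ` K \<noteq> {}" using free_components_sub[OF K(1)] by simp
    show "(1 - 2 / 1000000) * s\<^sup>2 \<le> sum a (frame_data ` K)" using cK asum by simp
  qed (use finK ysum ay in \<open>auto simp: y_def\<close>)
  have "s * ((1 - 2 / 1000000) * s) \<le> s * (y g * (1 + 9 / 1000000))"
    using g(1) by (simp add: power2_eq_square mult_ac)
  then have "(1 - 2 / 1000000) * s \<le> y g * (1 + 9 / 1000000)" using s by simp
  then have y1: "(1 + 9 / 1000000) * s - y g \<le> 20 / 1000000 * s" using s by argo
  have "y g \<le> sum y (frame_data ` K)" using g(3) finK by (intro member_le_sum) (auto simp: y_def)
  then have "((1 + 9 / 1000000) * s - y g)\<^sup>2 \<le> (20 / 1000000 * s)\<^sup>2"
    using y1 ysum by (intro power_mono) auto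
  then have "((1 + 9 / 1000000) * s - y g)\<^sup>2 \<le> 400 / 1000000000000 * s\<^sup>2" by (simp add: power_mult_distrib power_divide)
  then have "(1 - 3 / 1000000) * s\<^sup>2 \<le> a g" using g(2) ss s by argo
  also have "a g \<le> real (card {p \<in> B. \<phi> p = frame (fst g) (snd g) p})"
  proof -
    have "{p \<in> K. frame_data p = g} \<subseteq> {p \<in> B. \<phi> p = frame (fst g) (snd g) p}"
      using free_components_sub[OF K(1)] D_sub frame_data_iff[of _ "fst g" "snd g"] by auto
    then show ?thesis unfolding a_def using DB finD by (intro of_nat_mono card_mono) auto
  qed
  finally show ?thesis by (rule that)
qed

end

context puzzle
begin

lemma window_bound:
  fixes q0 \<kappa> \<tau> :: real and s :: nat
  assumes B: "B = {a..<a + int s} \<times> {b..<b + int s}" "B \<subseteq> G" and s: "100000000 \<le> s"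
    and q0: "1 < q0" "q0 \<le> real q" "2 * real n \<le> q0 powr (1 - \<tau> / 2)"
    and \<kappa>: "2 * (16 * real ((s\<^sup>2)\<^sup>2) + 1) ^ 4 \<le> q0 powr \<kappa>" "0 \<le> \<kappa>" "\<kappa> \<le> 1 / 100000000"
    and \<tau>: "3 * 1000000 \<le> \<tau> * real s"
  shows "real (card {\<omega> \<in> \<Omega>. \<exists>\<phi>. assembly \<omega> \<phi> \<and>
      (\<forall>k v. real (card {p \<in> B. \<phi> p = frame k v p}) < (1 - 3 / 1000000) * real s ^ 2)})
    \<le> 2 * q0 powr (- 3) * real (card \<Omega>)"
proof -
  define X where "X \<phi> \<longleftrightarrow> (\<forall>p \<in> B. fst (\<phi> p) \<in> G) \<and>
      (\<forall>k v. real (card {p \<in> B. \<phi> p = frame k v p}) < (1 - 3 / 1000000) * real s ^ 2)" for \<phi>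
  have cB: "card B = s\<^sup>2" unfolding B(1) by (simp add: card_cartesian_product power2_eq_square)
  have ne: "B \<noteq> {}" using s unfolding B(1) by auto
  \<comment> \<open>This frame moves the grid off itself, so every cell is misplaced and no frame is
    presupposed.\<close>
  let ?v = "(int n, 0) :: cell"
  have "real (card {\<omega> \<in> \<Omega>. \<exists>\<phi>. assembly \<omega> \<phi> \<and> X (restrict \<phi> B) \<and>
      (\<forall>p \<in> misplaced B (frame 0 ?v) \<phi>. fst (\<phi> p) \<in> G)}) \<le> 2 * q0 powr (- 3) * real (card \<Omega>)"
  proof (rule union_bound_size[OF B(2) ne, where b = "s\<^sup>2" and \<kappa> = \<kappa>])
    fix \<phi> assume pb: "placed_box B 0 \<phi>" and X: "X \<phi>"
    interpret placed_box B 0 ?v \<phi> by fact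
    have DB: "D = B"
    proof -
      have "\<phi> p \<noteq> fr p" if "p \<in> B" for p
      proof
        assume "\<phi> p = fr p"
        then have "p + ?v \<in> G" using X that by (auto simp: X_def frame_def)
        moreover have "p \<in> G" using that B by blast
        ultimately show False by (auto simp: cells_def)
      qed
      then show ?thesis by (auto simp: misplaced_def)
    qed
    have "\<not> rank4 / 4 < (2 - \<tau>) * real (card (free_components D \<mu>)) + 3 + \<kappa> * real (complexity D \<mu>)"
    proof
      assume low: "rank4 / 4 < (2 - \<tau>) * real (card (free_components D \<mu>)) + 3 + \<kappa> * real (complexity D \<mu>)"
      have "real (perimeter B) \<le> 4 * real s" using perimeter_box[of a s b] unfolding B(1) by linarith
      then obtain k' v' where "(1 - 3 / 1000000) * real s ^ 2 \<le> real (card {p \<in> B. \<phi> p = frame k' v' p})"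
        using window_dominant[OF DB, of "real s" \<kappa> \<tau>] cB s \<kappa> \<tau> low by auto
      then show False using X unfolding X_def by (meson not_le)
    qed
    then have le: "(2 - \<tau>) * real (card (free_components D \<mu>)) \<le> rank4 / 4 - 3 - \<kappa> * real (complexity D \<mu>)" by simp
    have "4 * real (card G) = (2 * real n)\<^sup>2" by (simp add: card_cells power_mult_distrib)
    also have "\<dots> \<le> (q0 powr (1 - \<tau> / 2))\<^sup>2" using q0 by (intro power_mono) auto
    also have "\<dots> = q0 powr (2 - \<tau>)" using q0 by (simp add: powr_power right_diff_distrib)
    finally have "(4 * real (card G)) ^ card (free_components D \<mu>) \<le> (q0 powr (2 - \<tau>)) ^ card (free_components D \<mu>)"
      by (intro power_mono) auto
    also have "\<dots> = q0 powr ((2 - \<tau>) * real (card (free_components D \<mu>)))"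
      using q0 by (simp add: powr_power mult_ac)
    also have "\<dots> \<le> q0 powr (rank4 / 4 - 3 - \<kappa> * real (complexity D \<mu>))"
      using le q0 by (intro powr_mono) auto
    finally show "(4 * real (card G)) ^ card (free_components D \<mu>) \<le> q0 powr (rank4 / 4 - 3 - \<kappa> * real (complexity D \<mu>))" .
  qed (use q0 \<kappa> cB finite_cells in auto)
  moreover have "X (restrict \<phi> B) \<longleftrightarrow> X \<phi>" for \<phi>
  proof -
    have "{p \<in> B. restrict \<phi> B p = frame k v p} = {p \<in> B. \<phi> p = frame k v p}" for k v by auto
    then show ?thesis by (simp add: X_def)
  qed
  moreover have "{\<omega> \<in> \<Omega>. \<exists>\<phi>. assembly \<omega> \<phi> \<and> X \<phi> \<and> (\<forall>p \<in> misplaced B (frame 0 ?v) \<phi>. fst (\<phi> p) \<in> G)}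
    = {\<omega> \<in> \<Omega>. \<exists>\<phi>. assembly \<omega> \<phi> \<and>
      (\<forall>k v. real (card {p \<in> B. \<phi> p = frame k v p}) < (1 - 3 / 1000000) * real s ^ 2)}"
    using B(2) unfolding X_def assembly_def misplaced_def by blast
  ultimately show ?thesis by simp
qed

end

section \<open>Boxes\<close>

definition window :: "nat \<Rightarrow> int \<Rightarrow> int \<Rightarrow> cell set" where
  "window s a b = {a..<a + int s} \<times> {b..<b + int s}"

definition cell_box :: "cell \<Rightarrow> nat \<Rightarrow> cell set" where
  "cell_box p j = {fst p - int j..fst p + int j} \<times> {snd p - int j..snd p + int j}"

lemma finite_window: "finite (window s a b)" and card_window: "card (window s a b) = s\<^sup>2"
  by (simp_all add: window_def card_cartesian_product power2_eq_square)

lemma finite_box: "finite (cell_box p j)"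
  by (simp add: cell_box_def)

lemma card_box: "card (cell_box p j) = (2 * j + 1)\<^sup>2"
proof -
  have "card {x - int j..x + int j} = 2 * j + 1" for x by simp
  then show ?thesis by (simp only: cell_box_def card_cartesian_product power2_eq_square)
qed

lemma box_mono: "i \<le> j \<Longrightarrow> cell_box p i \<subseteq> cell_box p j"
  by (auto simp: cell_box_def)

lemma box_self: "p \<in> cell_box p j"
  by (cases p) (simp add: cell_box_def)

lemma window_sub_cells: "0 \<le> a \<Longrightarrow> 0 \<le> b \<Longrightarrow> a + int s \<le> int n \<Longrightarrow> b + int s \<le> int n \<Longrightarrow> window s a b \<subseteq> cells n"
  by (auto simp: window_def cells_def)

lemma box_in_window:
  assumes "2 * j + 1 \<le> s" "s \<le> n"
  obtains a b where "0 \<le> a" "0 \<le> b" "a + int s \<le> int n" "b + int s \<le> int n" "cell_box p j \<inter> cells n \<subseteq> window s a b"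
proof
  \<comment> \<open>The window is pushed back into the grid where the box sticks out of it.\<close>
  define cl where "cl x = max 0 (min (x - int j) (int n - int s))" for x
  have cl: "0 \<le> cl x" "cl x + int s \<le> int n" for x using assms by (auto simp: cl_def)
  have in_cl: "cl x \<le> y \<and> y < cl x + int s" if "x - int j \<le> y" "y \<le> x + int j" "0 \<le> y" "y < int n" for x y
    using that assms by (auto simp: cl_def)
  show "0 \<le> cl (fst p)" "0 \<le> cl (snd p)" "cl (fst p) + int s \<le> int n" "cl (snd p) + int s \<le> int n"
    using cl by auto
  show "cell_box p j \<inter> cells n \<subseteq> window s (cl (fst p)) (cl (snd p))"
    using in_cl by (auto simp: cell_box_def cells_def window_def)
qed

lemma frame_eqD:
  assumes "frame k v p = frame k' v' p" shows "k = k' \<and> v = v'"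
  using assms by (auto simp: frame_def)

text \<open>Two windows shifted by one step overlap so much that their frames agree.\<close>

lemma common_frame:
  assumes s: "2 \<le> s" "s \<le> n"
    and W: "\<And>a b. 0 \<le> a \<Longrightarrow> 0 \<le> b \<Longrightarrow> a + int s \<le> int n \<Longrightarrow> b + int s \<le> int n \<Longrightarrow>
      \<exists>k v. 4 * card {p \<in> window s a b. \<phi> p \<noteq> frame k v p} < s\<^sup>2"
  obtains k v where "\<And>a b. 0 \<le> a \<Longrightarrow> 0 \<le> b \<Longrightarrow> a + int s \<le> int n \<Longrightarrow> b + int s \<le> int n \<Longrightarrow>
      4 * card {p \<in> window s a b. \<phi> p \<noteq> frame k v p} < s\<^sup>2"
proof -
  define good where "good a b k v \<longleftrightarrow> 4 * card {p \<in> window s a b. \<phi> p \<noteq> frame k v p} < s\<^sup>2" for a b k v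
  define ok where "ok a b \<longleftrightarrow> 0 \<le> a \<and> 0 \<le> b \<and> a + int s \<le> int n \<and> b + int s \<le> int n" for a b
  have ex: "\<exists>k v. good a b k v" if "ok a b" for a b using W that by (auto simp: good_def ok_def)
  have same: "k = k' \<and> v = v'"
    if g: "good a b k v" "good a' b' k' v'" and ov: "s * (s - 1) \<le> card (window s a b \<inter> window s a' b')"
    for a b k v a' b' k' v'
  proof -
    let ?I = "window s a b \<inter> window s a' b'"
    let ?X = "{p \<in> window s a b. \<phi> p \<noteq> frame k v p}" and ?Y = "{p \<in> window s a' b'. \<phi> p \<noteq> frame k' v' p}"
    have "card (?X \<union> ?Y) \<le> card ?X + card ?Y" by (rule card_Un_le)
    \<comment> \<open>The overlap is at least half a window, while each of the two exceptional sets
      is less than a quarter.\<close>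
    moreover have "2 * (s * (s - 1)) \<ge> s\<^sup>2"
    proof -
      have "s * s \<le> s * (2 * (s - 1))" using s by (intro mult_le_mono2) auto
      then show ?thesis by (simp add: power2_eq_square mult_ac)
    qed
    ultimately have "card (?X \<union> ?Y) < card ?I" using g ov by (simp add: good_def)
    then have "\<not> ?I \<subseteq> ?X \<union> ?Y" using card_mono[of "?X \<union> ?Y" ?I] finite_window by force
    then obtain p where "p \<in> ?I" "p \<notin> ?X" "p \<notin> ?Y" by blast
    then have "frame k v p = frame k' v' p" by auto
    then show ?thesis by (rule frame_eqD)
  qed
  have ovr: "s * (s - 1) \<le> card (window s a b \<inter> window s (a + 1) b)"
    "s * (s - 1) \<le> card (window s a b \<inter> window s a (b + 1))" for a b
  proof -
    have "window s a b \<inter> window s (a + 1) b = {a + 1..<a + int s} \<times> {b..<b + int s}"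
      "window s a b \<inter> window s a (b + 1) = {a..<a + int s} \<times> {b + 1..<b + int s}"
      by (auto simp: window_def)
    then show "s * (s - 1) \<le> card (window s a b \<inter> window s (a + 1) b)"
      "s * (s - 1) \<le> card (window s a b \<inter> window s a (b + 1))"
      by (simp_all add: card_cartesian_product nat_diff_distrib)
  qed
  have "ok 0 0" using s by (auto simp: ok_def)
  then obtain k v where kv: "good 0 0 k v" using ex by blast
  have row: "good (int a) 0 k v" if "a + s \<le> n" for a
    using that
  proof (induction a)
    case (Suc a)
    then have IH: "good (int a) 0 k v" by simp
    have "ok (int (Suc a)) 0" using Suc.prems s by (auto simp: ok_def)
    then obtain k' v' where g: "good (int (Suc a)) 0 k' v'" using ex by blast
    then have "good (int a + 1) 0 k' v'" by (simp add: add.commute)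
    then have "k = k' \<and> v = v'" using same[OF IH _ ovr(1)] by blast
    then show ?case using g by simp
  qed (use kv in simp)
  have col: "good (int a) (int b) k v" if a: "a + s \<le> n" and "b + s \<le> n" for a b
    using that(2)
  proof (induction b)
    case (Suc b)
    then have IH: "good (int a) (int b) k v" by simp
    have "ok (int a) (int (Suc b))" using Suc.prems a by (auto simp: ok_def)
    then obtain k' v' where g: "good (int a) (int (Suc b)) k' v'" using ex by blast
    then have "good (int a) (int b + 1) k' v'" by (simp add: add.commute)
    then have "k = k' \<and> v = v'" using same[OF IH _ ovr(2)] by blast
    then show ?case using g by simp
  qed (use row[OF a] in simp)
  show ?thesis
  proof (rule that)
    fix a b :: int assume "0 \<le> a" "0 \<le> b" "a + int s \<le> int n" "b + int s \<le> int n"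
    then show "4 * card {p \<in> window s a b. \<phi> p \<noteq> frame k v p} < s\<^sup>2"
      using col[of "nat a" "nat b"] by (simp add: good_def)
  qed
qed

text \<open>Otherwise \<open>sqrt (y i)\<close> would grow by more than 1/160 in every step, so that
  \<open>y J \<ge> J^2 / 25600\<close>. Since \<open>2 * J + 1 \<le> 3 * J\<close>, the assumed
  density allows only \<open>27 / 1000000 * J^2\<close>, which is smaller. This dictates the density
  \<open>3 / 1000000\<close> required of the windows.\<close>

lemma growth:
  fixes y :: "nat \<Rightarrow> nat"
  assumes mono: "\<And>i j. i \<le> j \<Longrightarrow> y i \<le> y j" and y0: "1 \<le> y 0" and J: "1 \<le> J"
    and small: "real (y J) \<le> 3 / 1000000 * real (2 * J + 1) ^ 2"
  obtains j where "1 \<le> j" "j \<le> J" "2 * (real (y j) - real (y (j - 1))) \<le> sqrt (real (y j)) / 40"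
proof (rule ccontr)
  note found = that
  assume no: "\<not> thesis"
  have big: "2 * (real (y j) - real (y (j - 1))) > sqrt (real (y j)) / 40" if "1 \<le> j" "j \<le> J" for j
    using found[OF that] no by (meson not_le)
  have "real i / 160 \<le> sqrt (real (y i))" if "i \<le> J" for i
    using that
  proof (induction i)
    case (Suc i)
    let ?a = "sqrt (real (y (Suc i)))" and ?b = "sqrt (real (y i))"
    have ba: "?b \<le> ?a" using mono[of i "Suc i"] by simp
    have a1: "?a > 0" using y0 mono[of 0 "Suc i"] by simp
    have "2 * (?a\<^sup>2 - ?b\<^sup>2) > ?a / 40" using big[of "Suc i"] Suc.prems by simp
    moreover have "?a\<^sup>2 - ?b\<^sup>2 = (?a - ?b) * (?a + ?b)" by (simp add: power2_eq_square algebra_simps)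
    moreover have "(?a - ?b) * (?a + ?b) \<le> (?a - ?b) * (2 * ?a)" using ba a1 by (intro mult_left_mono) auto
    ultimately have "?a * (1 / 40) < ?a * (4 * (?a - ?b))" by (simp add: algebra_simps)
    then have "1 / 40 < 4 * (?a - ?b)" using a1 by (simp only: mult_less_cancel_left_pos)
    then show ?case using Suc by simp
  qed simp
  then have "real J / 160 \<le> sqrt (real (y J))" by simp
  then have "(real J / 160)\<^sup>2 \<le> (sqrt (real (y J)))\<^sup>2" by (intro power_mono) auto
  then have "(real J / 160)\<^sup>2 \<le> real (y J)" by simp
  also have "\<dots> \<le> 3 / 1000000 * real (2 * J + 1) ^ 2" by (rule small)
  also have "\<dots> \<le> 3 / 1000000 * (3 * real J) ^ 2" using J by (intro mult_left_mono power_mono) auto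
  finally have "(real J)\<^sup>2 * (1 / 25600) \<le> (real J)\<^sup>2 * (27 / 1000000)"
    by (simp add: power_divide power_mult_distrib)
  then show False using J by simp
qed

text \<open>A cell can leave the box through one horizontal and one vertical side at most; with
  radius 0 there would be four exits.\<close>

lemma card_exits:
  assumes "p' \<in> cell_box p j" "1 \<le> j" shows "card {d. d < 4 \<and> p' + direction d \<notin> cell_box p j} \<le> 2"
proof -
  obtain a b x y where e: "p = (a, b)" "p' = (x, y)" by (cases p, cases p')
  define S :: "nat set" where "S = {if x = a + int j then 0 else 2, if y = b + int j then 1 else 3}"
  have "{d. d < 4 \<and> p' + direction d \<notin> cell_box p j} \<subseteq> S"
  proof
    fix d assume d: "d \<in> {d. d < 4 \<and> p' + direction d \<notin> cell_box p j}"
    then have "d < 4" by simp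
    then show "d \<in> S" using d assms
      by (cases rule: less_4_cases) (auto simp: S_def e cell_box_def direction_def)
  qed
  then have "card {d. d < 4 \<and> p' + direction d \<notin> cell_box p j} \<le> card S" by (intro card_mono) (auto simp: S_def)
  also have "card S \<le> 2" by (simp add: S_def card_insert_if)
  finally show ?thesis .
qed

lemma card_exiting_sides:
  assumes j: "1 \<le> j" and D: "finite M" "D = M \<inter> cell_box p j"
  shows "card {s \<in> sides D. fst (across s) \<notin> cell_box p j} \<le> 2 * (card D - card (M \<inter> cell_box p (j - 1)))"
proof -
  let ?R = "D - cell_box p (j - 1)"
  have fin: "finite ?R" using D by simp
  have "{s \<in> sides D. fst (across s) \<notin> cell_box p j} \<subseteq> (SIGMA p':?R. {d. d < 4 \<and> p' + direction d \<notin> cell_box p j})"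
  proof
    fix s assume a: "s \<in> {s \<in> sides D. fst (across s) \<notin> cell_box p j}"
    obtain x y d where sd: "s = ((x, y), d)" by (metis prod.exhaust)
    then have d: "d < 4" "(x, y) \<in> D" "(x, y) + direction d \<notin> cell_box p j" using a by (auto simp: sides_iff across_def)
    have "(x, y) \<notin> cell_box p (j - 1)"
    proof
      assume a: "(x, y) \<in> cell_box p (j - 1)"
      from d(1) show False using a d(3) j
        by (cases rule: less_4_cases) (auto simp: cell_box_def direction_def of_nat_diff)
    qed
    then show "s \<in> (SIGMA p':?R. {d. d < 4 \<and> p' + direction d \<notin> cell_box p j})" using d sd by simp
  qed
  then have "card {s \<in> sides D. fst (across s) \<notin> cell_box p j} \<le> card (SIGMA p':?R. {d. d < 4 \<and> p' + direction d \<notin> cell_box p j})"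
    using fin by (intro card_mono) auto
  also have "\<dots> = (\<Sum>p'\<in>?R. card {d. d < 4 \<and> p' + direction d \<notin> cell_box p j})" using fin by (intro card_SigmaI) auto
  also have "\<dots> \<le> (\<Sum>p'\<in>?R. 2)" using D card_exits[OF _ j] by (intro sum_mono) auto
  also have "\<dots> = 2 * card ?R" by simp
  also have "card ?R = card D - card (M \<inter> cell_box p (j - 1))"
  proof -
    have "?R = D - (M \<inter> cell_box p (j - 1))" using D by auto
    moreover have "M \<inter> cell_box p (j - 1) \<subseteq> D" using D box_mono[of "j - 1" j p] by auto
    ultimately show ?thesis using D by (simp add: card_Diff_subset)
  qed
  finally show ?thesis .
qed

text \<open>
  In a sparse set of misplaced cells some cell_box around a misplaced cell meets few of them near its
  rim: otherwise their number would grow quadratically with the radius.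
\<close>

lemma sparse_box:
  assumes M: "finite M" "p \<in> M" and J: "1 \<le> J"
    and small: "real (card (M \<inter> cell_box p J)) \<le> 3 / 1000000 * real (2 * J + 1) ^ 2"
  obtains j where "1 \<le> j" "j \<le> J"
    "real (card {s \<in> sides (M \<inter> cell_box p j). fst (across s) \<notin> cell_box p j}) \<le> sqrt (real (card (M \<inter> cell_box p j))) / 40"
proof -
  define y where "y j = card (M \<inter> cell_box p j)" for j
  have mono: "y i \<le> y j" if "i \<le> j" for i j
    unfolding y_def using M box_mono[OF that, of p] by (intro card_mono) auto
  have "p \<in> M \<inter> cell_box p 0" using M box_self by simp
  then have "1 \<le> y 0" unfolding y_def using M by (metis One_nat_def Suc_leI card_gt_0_iff empty_iff finite_Int)
  from growth[of y J, OF mono this J] obtain j where j: "1 \<le> j" "j \<le> J"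
    "2 * (real (y j) - real (y (j - 1))) \<le> sqrt (real (y j)) / 40"
    using small by (auto simp: y_def)
  have "real (card {s \<in> sides (M \<inter> cell_box p j). fst (across s) \<notin> cell_box p j}) \<le> real (2 * (y j - y (j - 1)))"
    using card_exiting_sides[OF j(1) M(1) refl, of p] unfolding y_def by (rule of_nat_mono)
  also have "\<dots> = 2 * (real (y j) - real (y (j - 1)))" using mono[of "j - 1" j] by (simp add: of_nat_diff)
  finally show ?thesis using that j by (simp add: y_def)
qed

definition outer_lost :: "nat \<Rightarrow> cell set \<Rightarrow> side set" where
  "outer_lost n D = {s \<in> sides D. fst (across s) \<notin> cells n}"

text \<open>The grid is wider than the box, so a row of \<open>D\<close> meets at most one of the
  left and right borders and a column at most one of the lower and upper ones. Hence the outer sides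
  number at most the sum of the two projections. Away from the corners one kind of outer side is
  missing although its projection still counts at least 1; this is the gain
  \<open>e\<close>.\<close>

lemma card_outer_lost:
  assumes D: "D \<subseteq> cell_box p j \<inter> cells n" "D \<noteq> {}" and n: "2 * j + 1 < n" and e: "e = 0 \<or> e = 1"
    and near: "e = 1 \<Longrightarrow> (int j + 1 \<le> fst p \<and> fst p + int j + 1 < int n) \<or> (int j + 1 \<le> snd p \<and> snd p + int j + 1 < int n)"
  shows "2 * card (outer_lost n D) + 2 * e \<le> perimeter D"
proof -
  have fin: "finite D" using D finite_box finite_subset by (metis finite_Int)
  let ?H = "{s \<in> outer_lost n D. even (snd s)}" and ?V = "{s \<in> outer_lost n D. odd (snd s)}"
  have finL: "finite (outer_lost n D)" unfolding outer_lost_def using finite_sides[OF fin] by simp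
  have side: "(x, y) \<in> D \<and> d < 4 \<and> 0 \<le> x \<and> x < int n \<and> 0 \<le> y \<and> y < int n \<and> \<bar>x - fst p\<bar> \<le> int j \<and> \<bar>y - snd p\<bar> \<le> int j \<and>
      (d = 0 \<and> x = int n - 1 \<or> d = 1 \<and> y = int n - 1 \<or> d = 2 \<and> x = 0 \<or> d = 3 \<and> y = 0)"
    if "((x, y), d) \<in> outer_lost n D" for x y d
  proof -
    have 1: "(x, y) \<in> D" "d < 4" "(x, y) + direction d \<notin> cells n"
      using that by (auto simp: outer_lost_def sides_iff across_def)
    then have 2: "0 \<le> x \<and> x < int n \<and> 0 \<le> y \<and> y < int n \<and> \<bar>x - fst p\<bar> \<le> int j \<and> \<bar>y - snd p\<bar> \<le> int j"
      using subsetD[OF D(1) 1(1)] by (simp add: cell_box_def cells_def abs_le_iff)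
    from 1(2) have "d = 0 \<and> x = int n - 1 \<or> d = 1 \<and> y = int n - 1 \<or> d = 2 \<and> x = 0 \<or> d = 3 \<and> y = 0"
      using 1(3) 2 by (cases rule: less_4_cases) (auto simp: direction_def cells_def)
    then show ?thesis using 1 2 by simp
  qed
  have H: "card ?H \<le> card (snd ` D)"
  proof (rule card_inj_on_le[of "\<lambda>s. snd (fst s)"])
    show "inj_on (\<lambda>s. snd (fst s)) ?H"
    proof (rule inj_onI, clarsimp)
      fix x y d x' d' assume a: "((x, y), d) \<in> outer_lost n D" "even d" "((x', y), d') \<in> outer_lost n D" "even d'"
      have "(d = 0 \<and> x = int n - 1 \<or> d = 2 \<and> x = 0)" "(d' = 0 \<and> x' = int n - 1 \<or> d' = 2 \<and> x' = 0)"
        "\<bar>x - fst p\<bar> \<le> int j" "\<bar>x' - fst p\<bar> \<le> int j"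
        using side[OF a(1)] side[OF a(3)] a(2,4) by auto
      then show "x = x' \<and> d = d'" using n by auto
    qed
    show "(\<lambda>s. snd (fst s)) ` ?H \<subseteq> snd ` D" by (force simp: outer_lost_def sides_iff)
  qed (use fin in simp)
  have V: "card ?V \<le> card (fst ` D)"
  proof (rule card_inj_on_le[of "\<lambda>s. fst (fst s)"])
    show "inj_on (\<lambda>s. fst (fst s)) ?V"
    proof (rule inj_onI, clarsimp)
      fix x y d y' d' assume a: "((x, y), d) \<in> outer_lost n D" "odd d" "((x, y'), d') \<in> outer_lost n D" "odd d'"
      have "(d = 1 \<and> y = int n - 1 \<or> d = 3 \<and> y = 0)" "(d' = 1 \<and> y' = int n - 1 \<or> d' = 3 \<and> y' = 0)"
        "\<bar>y - snd p\<bar> \<le> int j" "\<bar>y' - snd p\<bar> \<le> int j"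
        using side[OF a(1)] side[OF a(3)] a(2,4) by auto
      then show "y = y' \<and> d = d'" using n by auto
    qed
    show "(\<lambda>s. fst (fst s)) ` ?V \<subseteq> fst ` D" by (force simp: outer_lost_def sides_iff)
  qed (use fin in simp)
  have sum: "card (outer_lost n D) = card ?H + card ?V"
  proof -
    have "outer_lost n D = ?H \<union> ?V" by auto
    then show ?thesis using finL by (metis (no_types, lifting) card_Un_disjoint finite_Un disjoint_iff mem_Collect_eq)
  qed
  have one: "1 \<le> card (fst ` D)" "1 \<le> card (snd ` D)"
    using fin D by (simp_all add: Suc_le_eq card_gt_0_iff)
  have "card ?H + card ?V + e \<le> card (fst ` D) + card (snd ` D)"
  proof (cases "e = 0")
    case True
    then show ?thesis using H V by simp
  next
    case False
    then have e1: "e = 1" using e by simp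
    from near[OF e1] show ?thesis
    proof
      assume x: "int j + 1 \<le> fst p \<and> fst p + int j + 1 < int n"
      have "?H = {}"
      proof (rule ccontr)
        assume "?H \<noteq> {}"
        then obtain x y d where "((x, y), d) \<in> outer_lost n D" "even d" by auto
        then show False using side[of x y d] x by auto
      qed
      then have "card ?H = 0" by (simp only: card.empty)
      then show ?thesis using V one e1 by simp
    next
      assume x: "int j + 1 \<le> snd p \<and> snd p + int j + 1 < int n"
      have "?V = {}"
      proof (rule ccontr)
        assume "?V \<noteq> {}"
        then obtain x y d where "((x, y), d) \<in> outer_lost n D" "odd d" by auto
        then show False using side[of x y d] x by auto
      qed
      then have "card ?V = 0" by (simp only: card.empty)
      then show ?thesis using H one e1 by simp
    qed
  qed
  then have "2 * (card ?H + card ?V + e) \<le> 2 * (card (fst ` D) + card (snd ` D))" by simp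
  also have "\<dots> \<le> perimeter D" by (rule perimeter_ge_projections[OF fin])
  finally show ?thesis unfolding sum by simp
qed

section \<open>Assemblies and their frames\<close>

lemma rotate_piece_rotate_piece: "rotate_piece r (rotate_piece s c) = rotate_piece (r + s) c"
proof
  fix d
  have "((d + 3 * r) mod 4 + 3 * s) mod 4 = (d + 3 * (r + s)) mod 4" by (simp add: mod_simps algebra_simps)
  then show "rotate_piece r (rotate_piece s c) d = rotate_piece (r + s) c d" by (simp add: rotate_piece_def)
qed

lemma rotate_piece_mod: "rotate_piece (r mod 4) c = rotate_piece r c"
proof
  fix d
  have "(d + 3 * (r mod 4)) mod 4 = (d + 3 * r) mod 4" by (metis mod_add_right_eq mod_mult_right_eq)
  then show "rotate_piece (r mod 4) c d = rotate_piece r c d" by (simp add: rotate_piece_def)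
qed

definition rotations :: "piece \<Rightarrow> piece set" where
  "rotations c = {rotate_piece r c |r. r < 4}"

lemma rotations_eq: "rotations c = range (\<lambda>r. rotate_piece r c)"
proof -
  have "rotate_piece r c \<in> rotations c" for r
    unfolding rotations_def using rotate_piece_mod[of r c, symmetric] by (intro CollectI exI[of _ "r mod 4"]) simp
  then show ?thesis by (auto simp: rotations_def)
qed

lemma rotations_rotate_piece: "rotations (rotate_piece s c) = rotations c"
proof -
  have "rotate_piece r c \<in> range (\<lambda>r. rotate_piece (r + s) c)" for r
  proof -
    have "r + 3 * s + s = r + 4 * s" by simp
    then have "(r + 3 * s + s) mod 4 = r mod 4" by simp
    then have "rotate_piece r c = rotate_piece (r + 3 * s + s) c" by (metis rotate_piece_mod)
    then show ?thesis by blast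
  qed
  then show ?thesis by (auto simp: rotations_eq rotate_piece_rotate_piece)
qed

lemma matching_exists:
  assumes fin: "finite A" "finite B" and eq: "\<And>\<kappa>. card {a \<in> A. f a = \<kappa>} = card {b \<in> B. g b = \<kappa>}"
  obtains h where "bij_betw h A B" "\<And>a. a \<in> A \<Longrightarrow> g (h a) = f a"
proof -
  have "\<exists>h. bij_betw h {a \<in> A. f a = \<kappa>} {b \<in> B. g b = \<kappa>}" for \<kappa>
    using fin eq by (intro finite_same_card_bij) auto
  then obtain h where h: "bij_betw (h \<kappa>) {a \<in> A. f a = \<kappa>} {b \<in> B. g b = \<kappa>}" for \<kappa> by metis
  have in_B: "h (f a) a \<in> B" "g (h (f a) a) = f a" if "a \<in> A" for a
    using bij_betwE[OF h[of "f a"]] that by auto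
  have "bij_betw (\<lambda>a. h (f a) a) A B"
    unfolding bij_betw_def
  proof
    show "inj_on (\<lambda>a. h (f a) a) A"
    proof (rule inj_onI)
      fix a a' assume a: "a \<in> A" "a' \<in> A" "h (f a) a = h (f a') a'"
      then have "f a = f a'" using in_B by metis
      then show "a = a'" using a bij_betw_imp_inj_on[OF h[of "f a"]] by (auto simp: inj_on_def)
    qed
    show "(\<lambda>a. h (f a) a) ` A = B"
    proof
      show "(\<lambda>a. h (f a) a) ` A \<subseteq> B" using in_B by auto
      show "B \<subseteq> (\<lambda>a. h (f a) a) ` A"
      proof
        fix b assume "b \<in> B"
        then have "b \<in> h (g b) ` {a \<in> A. f a = g b}" using h[of "g b"] by (auto simp: bij_betw_def)
        then obtain a where a: "a \<in> A" "f a = g b" "b = h (g b) a" by blast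
        then have "b = h (f a) a" by simp
        then show "b \<in> (\<lambda>a. h (f a) a) ` A" using a(1) by blast
      qed
    qed
  qed
  then show ?thesis using that in_B by blast
qed

text \<open>The translation that brings the grid, turned about the origin as in
  \<open>frame k\<close>, back onto itself.\<close>

definition corner_shift :: "nat \<Rightarrow> nat \<Rightarrow> cell" where
  "corner_shift n k = (if k = 0 then (0, 0) else if k = 1 then (0, int n - 1)
     else if k = 2 then (int n - 1, int n - 1) else (int n - 1, 0))"

lemma frame_corner_shift:
  "fst (frame 0 (corner_shift n 0 + w) p) = p + w"
  "fst (frame 1 (corner_shift n 1 + w) p) = (snd p, int n - 1 - fst p) + w"
  "fst (frame 2 (corner_shift n 2 + w) p) = (int n - 1 - fst p, int n - 1 - snd p) + w"
  "fst (frame 3 (corner_shift n 3 + w) p) = (int n - 1 - snd p, fst p) + w"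
  by (cases p; cases w; simp add: frame_def corner_shift_def quarter_turn_def numeral_eq_Suc)+

definition deep :: "nat \<Rightarrow> nat \<Rightarrow> cell \<Rightarrow> bool" where
  "deep n K p \<longleftrightarrow> int K \<le> fst p \<and> fst p + int K < int n \<and> int K \<le> snd p \<and> snd p + int K < int n"

lemma deep_box: "deep n K p \<Longrightarrow> cell_box p K \<subseteq> cells n"
  by (auto simp: deep_def cell_box_def cells_def)

lemma deep_in_cells: "deep n K p \<Longrightarrow> p \<in> cells n"
  by (cases p) (auto simp: deep_def cells_def)

lemma frame_surj: obtains p where "fst (frame k v p) = c"
proof
  have "(quarter_turn ^^ (3 * k)) ((quarter_turn ^^ k) (c - v)) = (quarter_turn ^^ (4 * k)) (c - v)"
    by (simp add: funpow_add[symmetric, THEN fun_cong, unfolded comp_apply])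
  then show "fst (frame k v ((quarter_turn ^^ k) (c - v))) = c" by (simp add: frame_def funpow_quarter_turn_4_mult)
qed

context puzzle
begin

definition placed :: "carving \<Rightarrow> (cell \<Rightarrow> cell \<times> nat) \<Rightarrow> cell \<Rightarrow> piece" where
  "placed \<omega> \<phi> p = rotate_piece (snd (\<phi> p)) (\<omega> (nat_cell (fst (\<phi> p))))"

lemma jig_orig_side: "snd s < 4 \<Longrightarrow> jig \<omega> (orig_side \<phi> s) = placed \<omega> \<phi> (fst s) (snd s)"
  by (simp add: jig_def orig_side_def placed_def rotate_piece_def)

lemma placed_piece_eqI:
  assumes "\<And>e. e < 4 \<Longrightarrow> jig \<omega> (orig_side \<phi> (p, e)) = jig \<omega> (orig_side \<psi> (p, e))"
  shows "placed \<omega> \<phi> p = placed \<omega> \<psi> p"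
proof
  fix e show "placed \<omega> \<phi> p e = placed \<omega> \<psi> p e"
  proof (cases "e < 4")
    case True
    then show ?thesis using assms[OF True] jig_orig_side[of "(p, e)"] by simp
  qed (simp add: placed_def rotate_piece_def)
qed

text \<open>Agreement of the visible jigs, not of the pieces themselves: neighbours can force no
  more, and similarity of solutions demands no more.\<close>

definition agreed :: "carving \<Rightarrow> (cell \<Rightarrow> cell \<times> nat) \<Rightarrow> nat \<Rightarrow> cell \<Rightarrow> cell set" where
  "agreed \<omega> \<phi> k v = {p \<in> G. fst (frame k v p) \<in> G \<and> placed \<omega> \<phi> p = placed \<omega> (frame k v) p}"

text \<open>The four neighbours show the pieces that the frame prescribes. The jigs at
  \<open>p\<close> must be complementary to theirs, as are those of the piece that the frame would
  put there; by the involution the two coincide.\<close>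

lemma isolated_agreed:
  assumes \<omega>: "\<omega> \<in> \<Omega>" and \<phi>: "assembly \<omega> \<phi>" and p: "p \<in> G"
    and nb: "\<And>e. e < 4 \<Longrightarrow> fst (across (p, e)) \<in> G \<and> \<phi> (fst (across (p, e))) = frame k v (fst (across (p, e)))"
  shows "p \<in> agreed \<omega> \<phi> k v"
proof -
  let ?fr = "frame k v"
  have nbG: "fst (across (orig_side ?fr (p, e))) \<in> G" if "e < 4" for e
  proof -
    have "\<forall>p\<in>G. fst (\<phi> p) \<in> G" using \<phi> by (simp add: assembly_def)
    then have "fst (\<phi> (fst (across (p, e)))) \<in> G" using nb[OF that] by blast
    then have "fst (orig_side ?fr (across (p, e))) \<in> G" using nb[OF that] by (simp add: fst_orig_side)
    then show ?thesis using across_orig_side_frame[of "(p, e)" k v] that by simp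
  qed
  obtain c where c: "fst (?fr p) = c" by simp
  have dirs: "c + direction d \<in> G" if "d < 4" for d
  proof -
    have "(d + k) mod 4 < 4" "((d + k) mod 4 + 3 * k) mod 4 = (d + 4 * k) mod 4"
      by (simp_all add: mod_simps algebra_simps)
    then show ?thesis using nbG[of "(d + k) mod 4"] that c
      by (simp add: across_def orig_side_def frame_def)
  qed
  \<comment> \<open>The prescribed cell lies between the originals of two opposite neighbours, hence
    in the grid.\<close>
  have cG: "c \<in> G" using dirs[of 0] dirs[of 2] by (cases c) (auto simp: direction_def cells_def)
  have "placed \<omega> \<phi> p = placed \<omega> ?fr p"
  proof (rule placed_piece_eqI)
    fix e :: nat assume e: "e < 4"
    let ?s = "across (p, e)"
    have as: "across ?s = (p, e)" using e by (simp add: across_across)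
    have "jig \<omega> (orig_side \<phi> (across ?s)) = \<iota> (jig \<omega> (orig_side \<phi> ?s))"
    proof -
      have *: "\<forall>s\<in>sides G. fst (across s) \<in> G \<longrightarrow> jig \<omega> (orig_side \<phi> (across s)) = \<iota> (jig \<omega> (orig_side \<phi> s))"
        using \<phi> by (simp add: assembly_def)
      have "?s \<in> sides G" using nb[OF e] by (simp add: sides_iff)
      moreover have "fst (across ?s) \<in> G" using as p by simp
      ultimately show ?thesis using * by blast
    qed
    also have "orig_side \<phi> ?s = across (orig_side ?fr (p, e))"
      using nb[OF e] across_orig_side_frame[of "(p, e)" k v] e by (simp add: orig_side_def)
    also have "jig \<omega> (across (orig_side ?fr (p, e))) = \<iota> (jig \<omega> (orig_side ?fr (p, e)))"
      using \<omega> cG c nbG[OF e] by (auto simp: carvings_iff fits_def sides_iff fst_orig_side)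
    also have "\<iota> (\<iota> (jig \<omega> (orig_side ?fr (p, e)))) = jig \<omega> (orig_side ?fr (p, e))"
      by (rule \<iota>_invol, rule jig_in[OF \<omega>]) (use cG c in \<open>simp add: sides_iff fst_orig_side\<close>)
    finally show "jig \<omega> (orig_side \<phi> (p, e)) = jig \<omega> (orig_side ?fr (p, e))" using as by simp
  qed
  then show ?thesis using p cG c by (simp add: agreed_def)
qed

text \<open>Where the picture agrees with the frame, the prescribed piece itself can be used in
  place of an equal looking one. The other positions and the leftover pieces contain each rotation
  class equally often, so the rest of the picture can be rebuilt without change.\<close>

lemma normalise:
  assumes \<phi>: "assembly \<omega> \<phi>" and k: "k < 4"
  obtains \<phi>' where "assembly \<omega> \<phi>'" "\<And>p. p \<in> agreed \<omega> \<phi> k v \<Longrightarrow> \<phi>' p = frame k v p"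
    "\<And>p. p \<in> G \<Longrightarrow> placed \<omega> \<phi>' p = placed \<omega> \<phi> p"
proof -
  let ?fr = "frame k v" and ?A = "agreed \<omega> \<phi> k v"
  let ?o = "\<lambda>p. fst (?fr p)"
  define f where "f p = rotations (placed \<omega> \<phi> p)" for p
  define g where "g c = rotations (\<omega> (nat_cell c))" for c
  have AG: "?A \<subseteq> G" and oA: "?o ` ?A \<subseteq> G" by (auto simp: agreed_def)
  have fg: "f p = g (fst (\<phi> p))" for p by (simp add: f_def g_def placed_def rotations_rotate_piece)
  have fo: "f p = g (?o p)" if "p \<in> ?A" for p
    using that by (simp add: agreed_def f_def g_def) (simp add: placed_def rotations_rotate_piece)
  have inj: "inj_on (\<lambda>p. fst (\<phi> p)) G" and into: "\<And>p. p \<in> G \<Longrightarrow> fst (\<phi> p) \<in> G" "\<And>p. p \<in> G \<Longrightarrow> snd (\<phi> p) < 4"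
    using \<phi> by (auto simp: assembly_def)
  have img: "(\<lambda>p. fst (\<phi> p)) ` G = G"
    using endo_inj_surj[OF finite_cells _ inj] into by blast
  have injo: "inj_on ?o ?A"
  proof (rule inj_onI)
    fix p p' assume "?o p = ?o p'"
    then have "?fr p = ?fr p'" by (simp add: frame_def)
    then show "p = p'" by (rule frame_inj)
  qed
  \<comment> \<open>Each class occurs equally often in the picture and in the stock, and also among
    the agreed cells and the pieces prescribed for them; the complements are compared by
    subtraction.\<close>
  have "card {p \<in> G - ?A. f p = \<kappa>} = card {c \<in> G - ?o ` ?A. g c = \<kappa>}" for \<kappa>
  proof -
    have "{c \<in> G. g c = \<kappa>} = (\<lambda>p. fst (\<phi> p)) ` {p \<in> G. f p = \<kappa>}" using img fg by force
    then have 1: "card {c \<in> G. g c = \<kappa>} = card {p \<in> G. f p = \<kappa>}"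
      using card_image[OF inj_on_subset[OF inj, of "{p \<in> G. f p = \<kappa>}"]] by auto
    have "{c \<in> ?o ` ?A. g c = \<kappa>} = ?o ` {p \<in> ?A. f p = \<kappa>}" using fo by force
    then have 2: "card {c \<in> ?o ` ?A. g c = \<kappa>} = card {p \<in> ?A. f p = \<kappa>}"
      using card_image[OF inj_on_subset[OF injo, of "{p \<in> ?A. f p = \<kappa>}"]] by auto
    have "{p \<in> G - ?A. f p = \<kappa>} = {p \<in> G. f p = \<kappa>} - {p \<in> ?A. f p = \<kappa>}"
      "{c \<in> G - ?o ` ?A. g c = \<kappa>} = {c \<in> G. g c = \<kappa>} - {c \<in> ?o ` ?A. g c = \<kappa>}" by auto
    moreover have "{p \<in> ?A. f p = \<kappa>} \<subseteq> {p \<in> G. f p = \<kappa>}" "{c \<in> ?o ` ?A. g c = \<kappa>} \<subseteq> {c \<in> G. g c = \<kappa>}"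
      using AG oA by auto
    moreover have "finite {p \<in> ?A. f p = \<kappa>}" "finite {c \<in> ?o ` ?A. g c = \<kappa>}"
      using finite_subset[OF AG finite_cells] by simp_all
    ultimately show ?thesis using 1 2 by (simp add: card_Diff_subset)
  qed
  then obtain h where h: "bij_betw h (G - ?A) (G - ?o ` ?A)" "\<And>p. p \<in> G - ?A \<Longrightarrow> g (h p) = f p"
    using matching_exists[of "G - ?A" "G - ?o ` ?A" f g] finite_cells finite_Diff by blast
  have "\<exists>r<4. placed \<omega> \<phi> p = rotate_piece r (\<omega> (nat_cell (h p)))" if "p \<in> G - ?A" for p
  proof -
    have "placed \<omega> \<phi> p = rotate_piece 0 (placed \<omega> \<phi> p)"
      by (simp add: placed_def rotate_piece_rotate_piece)
    then have "placed \<omega> \<phi> p \<in> f p" unfolding f_def rotations_def by force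
    then have "placed \<omega> \<phi> p \<in> rotations (\<omega> (nat_cell (h p)))" using h(2)[OF that] by (simp add: g_def)
    then show ?thesis unfolding rotations_def by blast
  qed
  then obtain r where r: "\<And>p. p \<in> G - ?A \<Longrightarrow> r p < 4 \<and> placed \<omega> \<phi> p = rotate_piece (r p) (\<omega> (nat_cell (h p)))"
    by metis
  define \<phi>' where "\<phi>' p = (if p \<in> ?A then ?fr p else (h p, r p))" for p
  have pl: "placed \<omega> \<phi>' p = placed \<omega> \<phi> p" if "p \<in> G" for p
  proof (cases "p \<in> ?A")
    case True
    then have "\<phi>' p = ?fr p" by (simp add: \<phi>'_def)
    then have "placed \<omega> \<phi>' p = placed \<omega> ?fr p" by (simp add: placed_def)
    then show ?thesis using True by (simp add: agreed_def)
  next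
    case False
    then have "\<phi>' p = (h p, r p)" by (simp add: \<phi>'_def)
    then show ?thesis using r[of p] that False by (simp add: placed_def[of \<omega> \<phi>'])
  qed
  have hB: "h p \<in> G" "h p \<notin> ?o ` ?A" if "p \<in> G - ?A" for p using bij_betwE[OF h(1)] that by blast+
  have "assembly \<omega> \<phi>'"
    unfolding assembly_def
  proof (intro conjI ballI impI)
    fix p assume p: "p \<in> G"
    show "fst (\<phi>' p) \<in> G" using p oA hB[of p] by (auto simp: \<phi>'_def)
    show "snd (\<phi>' p) < 4" using p k r[of p] by (auto simp: \<phi>'_def frame_def)
  next
    show "inj_on (\<lambda>p. fst (\<phi>' p)) G"
    proof (rule inj_onI)
      fix p p' assume a: "p \<in> G" "p' \<in> G" "fst (\<phi>' p) = fst (\<phi>' p')"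
      consider "p \<in> ?A" "p' \<in> ?A" | "p \<in> ?A" "p' \<notin> ?A" | "p \<notin> ?A" "p' \<in> ?A" | "p \<notin> ?A" "p' \<notin> ?A" by blast
      then show "p = p'"
      proof cases
        case 1 then show ?thesis using a injo by (simp add: \<phi>'_def inj_on_def)
      next
        case 2
        then have "h p' = ?o p" using a by (simp add: \<phi>'_def)
        then have "h p' \<in> ?o ` ?A" using 2 by blast
        then show ?thesis using hB(2)[of p'] 2 a by simp
      next
        case 3
        then have "h p = ?o p'" using a by (simp add: \<phi>'_def)
        then have "h p \<in> ?o ` ?A" using 3 by blast
        then show ?thesis using hB(2)[of p] 3 a by simp
      next
        case 4 then show ?thesis using a bij_betw_imp_inj_on[OF h(1)] by (simp add: \<phi>'_def inj_on_def)
      qed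
    qed
  next
    fix s assume s: "s \<in> sides G" "fst (across s) \<in> G"
    then have s4: "snd s < 4" "fst s \<in> G" by (auto simp: sides_iff)
    have "jig \<omega> (orig_side \<phi> (across s)) = \<iota> (jig \<omega> (orig_side \<phi> s))" using \<phi> s by (simp add: assembly_def)
    then show "jig \<omega> (orig_side \<phi>' (across s)) = \<iota> (jig \<omega> (orig_side \<phi>' s))"
      using s s4 by (simp add: jig_orig_side pl)
  qed
  then show ?thesis using that pl by (simp add: \<phi>'_def)
qed

section \<open>Exceptional carvings and the structure of assemblies outside them\<close>

definition window_bad :: "nat \<Rightarrow> int \<Rightarrow> int \<Rightarrow> carving set" where
  "window_bad s a b = {\<omega> \<in> \<Omega>. \<exists>\<phi>. assembly \<omega> \<phi> \<and>
     (\<forall>k v. real (card {p \<in> window s a b. \<phi> p = frame k v p}) < (1 - 3 / 1000000) * real s ^ 2)}"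

definition interior_bad :: "cell \<Rightarrow> nat \<Rightarrow> nat \<Rightarrow> cell \<Rightarrow> carving set" where
  "interior_bad p j k v = {\<omega> \<in> \<Omega>. \<exists>\<phi>. assembly \<omega> \<phi> \<and> 2 \<le> card (misplaced (cell_box p j) (frame k v) \<phi>) \<and>
     real (card (lost (cell_box p j) (misplaced (cell_box p j) (frame k v) \<phi>)))
       \<le> sqrt (real (card (misplaced (cell_box p j) (frame k v) \<phi>))) / 40}"

definition border_cond :: "cell \<Rightarrow> nat \<Rightarrow> cell set \<Rightarrow> bool" where
  "border_cond p j D \<longleftrightarrow> D \<subseteq> cell_box p j \<inter> G \<and> D \<noteq> {} \<and>
     real (card (lost (cell_box p j \<inter> G) D)) \<le> real (card (outer_lost n D)) + sqrt (real (card D)) / 40"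

text \<open>The stock \<open>O'\<close> is part of the event: a stock of about \<open>n\<close>
  pieces instead of \<open>n^2\<close> lowers the price of a free component to what the reduced rank
  at the border can afford.\<close>

definition border_bad :: "cell set \<Rightarrow> cell \<Rightarrow> nat \<Rightarrow> nat \<Rightarrow> cell \<Rightarrow> carving set" where
  "border_bad O' p j k v = {\<omega> \<in> \<Omega>. \<exists>\<phi>. assembly \<omega> \<phi> \<and>
     border_cond p j (misplaced (cell_box p j \<inter> G) (frame k v) \<phi>) \<and>
     (\<forall>p' \<in> misplaced (cell_box p j \<inter> G) (frame k v) \<phi>. fst (\<phi> p') \<in> O')}"

text \<open>\<open>common_frame\<close> yields only the weak bound of a quarter on every window. But
  the frame with the strong bound on a window shares a cell with the common frame there, and two
  frames that agree at one cell are equal.\<close>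

lemma window_frame:
  assumes s: "2 \<le> s" "s \<le> n" and \<omega>: "\<omega> \<in> \<Omega>" and \<phi>: "assembly \<omega> \<phi>"
    and W: "\<And>a b. 0 \<le> a \<Longrightarrow> 0 \<le> b \<Longrightarrow> a + int s \<le> int n \<Longrightarrow> b + int s \<le> int n \<Longrightarrow> \<omega> \<notin> window_bad s a b"
  obtains k v where "\<And>a b. 0 \<le> a \<Longrightarrow> 0 \<le> b \<Longrightarrow> a + int s \<le> int n \<Longrightarrow> b + int s \<le> int n \<Longrightarrow>
      real (card {p \<in> window s a b. \<phi> p \<noteq> frame k v p}) \<le> 3 / 1000000 * real s ^ 2"
proof -
  have split: "card {p \<in> window s a b. \<phi> p = frame k v p} + card {p \<in> window s a b. \<phi> p \<noteq> frame k v p} = s\<^sup>2" for a b k v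
  proof -
    have "card ({p \<in> window s a b. \<phi> p = frame k v p} \<union> {p \<in> window s a b. \<phi> p \<noteq> frame k v p})
      = card {p \<in> window s a b. \<phi> p = frame k v p} + card {p \<in> window s a b. \<phi> p \<noteq> frame k v p}"
      using finite_window by (intro card_Un_disjoint) auto
    moreover have "{p \<in> window s a b. \<phi> p = frame k v p} \<union> {p \<in> window s a b. \<phi> p \<noteq> frame k v p} = window s a b"
      by auto
    ultimately show ?thesis by (simp add: card_window)
  qed
  have ex: "\<exists>k v. real (card {p \<in> window s a b. \<phi> p \<noteq> frame k v p}) \<le> 3 / 1000000 * real s ^ 2"
    if ab: "0 \<le> a" "0 \<le> b" "a + int s \<le> int n" "b + int s \<le> int n" for a b
  proof -
    obtain k v where kv: "(1 - 3 / 1000000) * real s ^ 2 \<le> real (card {p \<in> window s a b. \<phi> p = frame k v p})"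
      using W[OF ab] \<omega> \<phi> unfolding window_bad_def by (auto simp: not_less)
    have "real (card {p \<in> window s a b. \<phi> p = frame k v p}) + real (card {p \<in> window s a b. \<phi> p \<noteq> frame k v p}) = real s ^ 2"
      using arg_cong[OF split[of a b k v], of real] by simp
    then show ?thesis using kv by (intro exI[of _ k] exI[of _ v]) argo
  qed
  have s2: "real s ^ 2 > 0" using s by simp
  have small: "4 * card {p \<in> window s a b. \<phi> p \<noteq> frame k v p} < s\<^sup>2"
    if "real (card {p \<in> window s a b. \<phi> p \<noteq> frame k v p}) \<le> 3 / 1000000 * real s ^ 2" for a b k v
  proof -
    have "real (4 * card {p \<in> window s a b. \<phi> p \<noteq> frame k v p}) < real (s\<^sup>2)"
      unfolding of_nat_mult of_nat_power of_nat_numeral using that s2 by argo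
    then show ?thesis by (simp only: of_nat_less_iff)
  qed
  have "\<exists>k v. 4 * card {p \<in> window s a b. \<phi> p \<noteq> frame k v p} < s\<^sup>2"
    if "0 \<le> a" "0 \<le> b" "a + int s \<le> int n" "b + int s \<le> int n" for a b
    using ex[OF that] small by blast
  from common_frame[OF s this] obtain k v where kv:
    "\<And>a b. 0 \<le> a \<Longrightarrow> 0 \<le> b \<Longrightarrow> a + int s \<le> int n \<Longrightarrow> b + int s \<le> int n \<Longrightarrow>
      4 * card {p \<in> window s a b. \<phi> p \<noteq> frame k v p} < s\<^sup>2" by blast
  show ?thesis
  proof (rule that)
    fix a b :: int assume ab: "0 \<le> a" "0 \<le> b" "a + int s \<le> int n" "b + int s \<le> int n"
    obtain k' v' where kv': "real (card {p \<in> window s a b. \<phi> p \<noteq> frame k' v' p}) \<le> 3 / 1000000 * real s ^ 2"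
      using ex[OF ab] by blast
    let ?X = "{p \<in> window s a b. \<phi> p \<noteq> frame k v p}" and ?Y = "{p \<in> window s a b. \<phi> p \<noteq> frame k' v' p}"
    have "card (?X \<union> ?Y) \<le> card ?X + card ?Y" by (rule card_Un_le)
    then have "card (?X \<union> ?Y) < card (window s a b)"
      using kv[OF ab] small[OF kv'] by (simp add: card_window)
    then have "?X \<union> ?Y \<noteq> window s a b" by (metis less_irrefl)
    then obtain p where "\<phi> p = frame k v p" "\<phi> p = frame k' v' p" by blast
    then have "k = k' \<and> v = v'" using frame_eqD[of k v p k' v'] by simp
    then show "real (card ?X) \<le> 3 / 1000000 * real s ^ 2" using kv' by simp
  qed
qed

text \<open>In each window some cell follows the frame, so the frame sends it into the grid. Windows
  in two opposite corners confine the displacement from both directions.\<close>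

lemma frame_near:
  assumes s: "1 \<le> s" "s \<le> n" and \<phi>: "assembly \<omega> \<phi>" and k: "k < 4"
    and W: "\<And>a b. 0 \<le> a \<Longrightarrow> 0 \<le> b \<Longrightarrow> a + int s \<le> int n \<Longrightarrow> b + int s \<le> int n \<Longrightarrow>
      real (card {p \<in> window s a b. \<phi> p \<noteq> frame k v p}) \<le> 3 / 1000000 * real s ^ 2"
  obtains w where "v = corner_shift n k + w" "\<bar>fst w\<bar> \<le> int s" "\<bar>snd w\<bar> \<le> int s"
proof -
  define w where "w = v - corner_shift n k"
  have v: "v = corner_shift n k + w" by (simp add: w_def)
  have on: "\<exists>p \<in> window s a b. fst (frame k v p) \<in> G"
    if ab: "0 \<le> a" "0 \<le> b" "a + int s \<le> int n" "b + int s \<le> int n" for a b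
  proof -
    have "real s ^ 2 > 0" using s by simp
    then have "3 / 1000000 * real s ^ 2 < real (card (window s a b))" by (simp add: card_window)
    then have "real (card {p \<in> window s a b. \<phi> p \<noteq> frame k v p}) < real (card (window s a b))"
      using W[OF ab] by linarith
    then have "{p \<in> window s a b. \<phi> p \<noteq> frame k v p} \<noteq> window s a b" by (metis less_irrefl)
    then obtain p where "p \<in> window s a b" "\<phi> p = frame k v p" by blast
    then show ?thesis using window_sub_cells[OF ab] \<phi> by (metis assembly_def subsetD)
  qed
  let ?m = "int n - int s"
  from k have "\<bar>fst w\<bar> \<le> int s \<and> \<bar>snd w\<bar> \<le> int s"
  proof (cases rule: less_4_cases)
    case 1
    obtain p r where "p \<in> window s 0 0" "fst (frame k v p) \<in> G" "r \<in> window s ?m ?m" "fst (frame k v r) \<in> G"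
      using on[of 0 0] on[of ?m ?m] s by auto
    then show ?thesis unfolding v 1 frame_corner_shift by (cases w; cases p; cases r) (auto simp: window_def cells_def)
  next
    case 2
    obtain p r where "p \<in> window s ?m 0" "fst (frame k v p) \<in> G" "r \<in> window s 0 ?m" "fst (frame k v r) \<in> G"
      using on[of ?m 0] on[of 0 ?m] s by auto
    then show ?thesis unfolding v 2 frame_corner_shift by (cases w; cases p; cases r) (auto simp: window_def cells_def)
  next
    case 3
    obtain p r where "p \<in> window s ?m ?m" "fst (frame k v p) \<in> G" "r \<in> window s 0 0" "fst (frame k v r) \<in> G"
      using on[of 0 0] on[of ?m ?m] s by auto
    then show ?thesis unfolding v 3 frame_corner_shift by (cases w; cases p; cases r) (auto simp: window_def cells_def)
  next
    case 4
    obtain p r where "p \<in> window s 0 ?m" "fst (frame k v p) \<in> G" "r \<in> window s ?m 0" "fst (frame k v r) \<in> G"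
      using on[of ?m 0] on[of 0 ?m] s by auto
    then show ?thesis unfolding v 4 frame_corner_shift by (cases w; cases p; cases r) (auto simp: window_def cells_def)
  qed
  then show ?thesis using that v by blast
qed

lemma all_agreed_frame:
  assumes k: "k < 4" and v: "v = corner_shift n k + w" and n: "1 \<le> n" and G: "\<And>p. p \<in> G \<Longrightarrow> fst (frame k v p) \<in> G"
  shows "v = corner_shift n k"
proof -
  have z: "(0, 0) \<in> G" "(int n - 1, int n - 1) \<in> G" "(0, int n - 1) \<in> G" "(int n - 1, 0) \<in> G"
    using n by (auto simp: cells_def)
  from k have "w = 0"
  proof (cases rule: less_4_cases)
    case 1 then show ?thesis using G[OF z(1)] G[OF z(2)] unfolding v 1 frame_corner_shift
      by (cases w) (auto simp: cells_def zero_prod_def)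
  next
    case 2 then show ?thesis using G[OF z(3)] G[OF z(4)] unfolding v 2 frame_corner_shift
      by (cases w) (auto simp: cells_def zero_prod_def)
  next
    case 3 then show ?thesis using G[OF z(1)] G[OF z(2)] unfolding v 3 frame_corner_shift
      by (cases w) (auto simp: cells_def zero_prod_def)
  next
    case 4 then show ?thesis using G[OF z(3)] G[OF z(4)] unfolding v 4 frame_corner_shift
      by (cases w) (auto simp: cells_def zero_prod_def)
  qed
  then show ?thesis using v by simp
qed

lemma deep_frame:
  assumes k: "k < 4" and v: "v = corner_shift n k + w" and w: "\<bar>fst w\<bar> \<le> int s" "\<bar>snd w\<bar> \<le> int s"
    and d: "deep n (J + s) (fst (frame k v p))"
  shows "deep n J p"
  using k
proof (cases rule: less_4_cases)
  case 1 then show ?thesis using d w unfolding v 1 frame_corner_shift by (auto simp: deep_def)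
next
  case 2 then show ?thesis using d w unfolding v 2 frame_corner_shift by (auto simp: deep_def)
next
  case 3 then show ?thesis using d w unfolding v 3 frame_corner_shift by (auto simp: deep_def)
next
  case 4 then show ?thesis using d w unfolding v 4 frame_corner_shift by (auto simp: deep_def)
qed

text \<open>No probability enters here. The interior is settled for \<open>\<phi>\<close> itself;
  pieces are exchanged only afterwards, because the border argument needs every deep piece to be in
  use at its own place.\<close>

lemma assembly_rotation:
  assumes \<omega>: "\<omega> \<in> \<Omega>" and \<phi>: "assembly \<omega> \<phi>" and J: "1 \<le> J" "2 * J + 1 \<le> n"
    and W: "\<And>a b. 0 \<le> a \<Longrightarrow> 0 \<le> b \<Longrightarrow> a + int (2 * J + 1) \<le> int n \<Longrightarrow> b + int (2 * J + 1) \<le> int n \<Longrightarrow>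
      \<omega> \<notin> window_bad (2 * J + 1) a b"
    and I: "\<And>p j k w. 1 \<le> j \<Longrightarrow> j \<le> J \<Longrightarrow> p \<in> G \<Longrightarrow> cell_box p j \<subseteq> G \<Longrightarrow> k < 4 \<Longrightarrow> \<bar>fst w\<bar> \<le> int (2 * J + 1) \<Longrightarrow>
      \<bar>snd w\<bar> \<le> int (2 * J + 1) \<Longrightarrow> \<omega> \<notin> interior_bad p j k (corner_shift n k + w)"
    and Bd: "\<And>p j k w. 1 \<le> j \<Longrightarrow> j \<le> J \<Longrightarrow> p \<in> G \<Longrightarrow> \<not> deep n J p \<Longrightarrow> k < 4 \<Longrightarrow> \<bar>fst w\<bar> \<le> int (2 * J + 1) \<Longrightarrow>
      \<bar>snd w\<bar> \<le> int (2 * J + 1) \<Longrightarrow> \<omega> \<notin> border_bad {c \<in> G. \<not> deep n (3 * J + 1) c} p j k (corner_shift n k + w)"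
  obtains k where "k < 4" "\<And>p. p \<in> G \<Longrightarrow> fst (frame k (corner_shift n k) p) \<in> G \<and> placed \<omega> \<phi> p = placed \<omega> (frame k (corner_shift n k)) p"
proof -
  let ?s = "2 * J + 1"
  have s: "2 \<le> ?s" "?s \<le> n" using J by auto
  from window_frame[OF s \<omega> \<phi> W] obtain k v where kv:
    "\<And>a b. 0 \<le> a \<Longrightarrow> 0 \<le> b \<Longrightarrow> a + int ?s \<le> int n \<Longrightarrow> b + int ?s \<le> int n \<Longrightarrow>
      real (card {p \<in> window ?s a b. \<phi> p \<noteq> frame k v p}) \<le> 3 / 1000000 * real ?s ^ 2" by blast
  \<comment> \<open>The common frame comes with no bound on \<open>k\<close>, so the bound is read
    off from a cell that follows it.\<close>
  have k: "k < 4"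
  proof -
    have "real ?s ^ 2 > 0" using s by simp
    then have "3 / 1000000 * real ?s ^ 2 < real (card (window ?s 0 0))" unfolding card_window of_nat_power by linarith
    moreover have "real (card {p \<in> window ?s 0 0. \<phi> p \<noteq> frame k v p}) \<le> 3 / 1000000 * real ?s ^ 2"
      using s by (intro kv) auto
    ultimately have "real (card {p \<in> window ?s 0 0. \<phi> p \<noteq> frame k v p}) < real (card (window ?s 0 0))" by linarith
    then have "{p \<in> window ?s 0 0. \<phi> p \<noteq> frame k v p} \<noteq> window ?s 0 0" by (metis less_irrefl)
    then obtain p where p: "p \<in> window ?s 0 0" "\<phi> p = frame k v p" by blast
    then have "p \<in> G" using window_sub_cells[of 0 0 ?s n] s by auto
    then have "snd (frame k v p) < 4" using \<phi> p by (metis assembly_def)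
    then show ?thesis by (simp add: frame_def)
  qed
  obtain w where v: "v = corner_shift n k + w" and w: "\<bar>fst w\<bar> \<le> int ?s" "\<bar>snd w\<bar> \<le> int ?s"
    using frame_near[OF le_add2 s(2) \<phi> k kv] by blast
  let ?fr = "frame k v"
  let ?A = "agreed \<omega> \<phi> k v"
  define M where "M = misplaced G ?fr \<phi>"
  have sparse: "real (card (M' \<inter> cell_box p J)) \<le> 3 / 1000000 * real ?s ^ 2" if "M' \<subseteq> M" for M' p
  proof -
    obtain a b where ab: "0 \<le> a" "0 \<le> b" "a + int ?s \<le> int n" "b + int ?s \<le> int n" "cell_box p J \<inter> G \<subseteq> window ?s a b"
      using box_in_window[OF order_refl s(2), of p] by blast
    have "M' \<inter> cell_box p J \<subseteq> {p \<in> window ?s a b. \<phi> p \<noteq> ?fr p}" using that ab(5) by (auto simp: M_def misplaced_def)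
    then have "card (M' \<inter> cell_box p J) \<le> card {p \<in> window ?s a b. \<phi> p \<noteq> ?fr p}"
      using finite_window by (intro card_mono) auto
    then show ?thesis using kv[OF ab(1-4)] by linarith
  qed
  have onfr: "p \<in> ?A" if "p \<in> G" "\<phi> p = ?fr p" for p
  proof -
    have "\<forall>p\<in>G. fst (\<phi> p) \<in> G" using \<phi> by (simp add: assembly_def)
    then have "fst (\<phi> p) \<in> G" using that by blast
    then show ?thesis using that by (simp add: agreed_def placed_def)
  qed
  \<comment> \<open>The box found by \<open>sparse_box\<close> contains at most one misplaced cell,
    since \<open>I\<close> excludes two or more. Then \<open>p\<close> is the only one, and its
    neighbours determine its jigs.\<close>
  have inner: "p \<in> ?A" if p: "p \<in> G" "cell_box p J \<subseteq> G" for p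
  proof (cases "p \<in> M")
    case False
    then show ?thesis using onfr p by (simp add: M_def misplaced_def)
  next
    case True
    have finM: "finite M" using finite_cells by (simp add: M_def misplaced_def)
    obtain j where j: "1 \<le> j" "j \<le> J"
      "real (card {s \<in> sides (M \<inter> cell_box p j). fst (across s) \<notin> cell_box p j}) \<le> sqrt (real (card (M \<inter> cell_box p j))) / 40"
      using sparse_box[OF finM True J(1)] sparse[of M] by blast
    have jG: "cell_box p j \<subseteq> G" using box_mono[OF j(2)] p(2) by blast
    have D: "misplaced (cell_box p j) ?fr \<phi> = M \<inter> cell_box p j" using jG by (auto simp: M_def misplaced_def)
    have nI: "\<omega> \<notin> interior_bad p j k v" unfolding v using I[OF j(1,2) p(1) jG k w] .
    have "\<not> 2 \<le> card (M \<inter> cell_box p j)"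
    proof
      assume "2 \<le> card (M \<inter> cell_box p j)"
      then have "assembly \<omega> \<phi> \<and> 2 \<le> card (misplaced (cell_box p j) ?fr \<phi>) \<and>
        real (card (lost (cell_box p j) (misplaced (cell_box p j) ?fr \<phi>))) \<le> sqrt (real (card (misplaced (cell_box p j) ?fr \<phi>))) / 40"
        using \<phi> j(3) unfolding D lost_def by simp
      then have "\<omega> \<in> interior_bad p j k v" unfolding interior_bad_def using \<omega> by blast
      then show False using nI by simp
    qed
    moreover have pin: "p \<in> M \<inter> cell_box p j" using True box_self by simp
    moreover have finD: "finite (M \<inter> cell_box p j)" using finM by simp
    moreover have "card (M \<inter> cell_box p j) \<noteq> 0" using pin finD by auto
    ultimately have "card (M \<inter> cell_box p j) = 1" by linarith
    then have single: "M \<inter> cell_box p j = {p}" using pin by (metis card_1_singletonE singletonD)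
    show ?thesis
    proof (rule isolated_agreed[OF \<omega> \<phi> p(1)])
      fix e :: nat assume e: "e < 4"
      let ?c = "fst (across (p, e))"
      have "?c \<in> cell_box p j" using e j(1)
        by (cases rule: less_4_cases; cases p) (auto simp: across_def direction_def cell_box_def)
      moreover have "?c \<noteq> p" using fst_across_neq[of "(p, e)"] by simp
      ultimately have "?c \<in> G" "?c \<notin> M" using jG single by auto
      then show "?c \<in> G \<and> \<phi> ?c = ?fr ?c" by (simp add: M_def misplaced_def)
    qed
  qed
  obtain \<phi>' where \<phi>': "assembly \<omega> \<phi>'" "\<And>p. p \<in> ?A \<Longrightarrow> \<phi>' p = ?fr p"
    "\<And>p. p \<in> G \<Longrightarrow> placed \<omega> \<phi>' p = placed \<omega> \<phi> p" using normalise[OF \<phi> k, of v] by blast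
  have M': "\<phi>' p \<noteq> ?fr p" if "p \<in> G" "p \<notin> ?A" for p
  proof
    assume e: "\<phi>' p = ?fr p"
    have "fst (\<phi>' p) \<in> G" using \<phi>'(1) that by (simp add: assembly_def)
    then have "fst (?fr p) \<in> G" using e by simp
    moreover have "placed \<omega> \<phi> p = placed \<omega> ?fr p" using \<phi>'(3)[OF that(1)] e by (simp add: placed_def)
    ultimately show False using that by (simp add: agreed_def)
  qed
  have M'M: "G - ?A \<subseteq> M" using onfr by (auto simp: M_def misplaced_def)
  have "G - ?A = {}"
  proof (rule ccontr)
    assume "G - ?A \<noteq> {}"
    then obtain p where p: "p \<in> G - ?A" by blast
    have nd: "\<not> deep n J p" using inner[of p] deep_box p by blast
    have finM': "finite (G - ?A)" using finite_cells by simp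
    obtain j where j: "1 \<le> j" "j \<le> J"
      "real (card {s \<in> sides ((G - ?A) \<inter> cell_box p j). fst (across s) \<notin> cell_box p j}) \<le> sqrt (real (card ((G - ?A) \<inter> cell_box p j))) / 40"
      using sparse_box[OF finM' p J(1)] sparse[OF M'M] by blast
    let ?D = "(G - ?A) \<inter> cell_box p j"
    have D: "misplaced (cell_box p j \<inter> G) ?fr \<phi>' = ?D" using M' \<phi>'(2) by (auto simp: misplaced_def)
    have finD: "finite (sides ?D)" using finM' by (intro finite_sides) simp
    have "lost (cell_box p j \<inter> G) ?D \<subseteq> outer_lost n ?D \<union> {s \<in> sides ?D. fst (across s) \<notin> cell_box p j}"
      by (auto simp: lost_def outer_lost_def)
    then have "card (lost (cell_box p j \<inter> G) ?D) \<le> card (outer_lost n ?D \<union> {s \<in> sides ?D. fst (across s) \<notin> cell_box p j})"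
      using finD by (intro card_mono) (auto simp: outer_lost_def)
    also have "\<dots> \<le> card (outer_lost n ?D) + card {s \<in> sides ?D. fst (across s) \<notin> cell_box p j}" by (rule card_Un_le)
    finally have "real (card (lost (cell_box p j \<inter> G) ?D)) \<le> real (card (outer_lost n ?D)) + sqrt (real (card ?D)) / 40"
      using j(3) by linarith
    moreover have "?D \<noteq> {}" using p box_self by blast
    ultimately have cond: "border_cond p j ?D" by (auto simp: border_cond_def)
    \<comment> \<open>Offsets are at most \<open>2 * J + 1\<close>, so an original cell of depth
      \<open>3 * J + 1\<close> belongs to a position of depth at least \<open>J\<close>. All such
      positions agree with the frame, and after normalisation their pieces are used there.\<close>
    have "fst (\<phi>' p') \<in> {c \<in> G. \<not> deep n (3 * J + 1) c}" if p': "p' \<in> ?D" for p'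
    proof -
      have "fst (\<phi>' p') \<in> G" using \<phi>'(1) p' by (simp add: assembly_def)
      moreover have "\<not> deep n (3 * J + 1) (fst (\<phi>' p'))"
      proof
        assume d: "deep n (3 * J + 1) (fst (\<phi>' p'))"
        obtain r where r: "fst (?fr r) = fst (\<phi>' p')" using frame_surj by blast
        have e31: "3 * J + 1 = J + ?s" by simp
        have dr: "deep n J r" using deep_frame[OF k v w, of J r] d unfolding r e31 .
        then have rA: "r \<in> ?A" using inner deep_in_cells deep_box by blast
        then have "fst (\<phi>' r) = fst (\<phi>' p')" using \<phi>'(2) r by simp
        moreover have "inj_on (\<lambda>p. fst (\<phi>' p)) G" using \<phi>'(1) by (simp add: assembly_def)
        ultimately have "r = p'" using p' rA by (auto simp: agreed_def inj_on_def)
        then show False using rA p' by simp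
      qed
      ultimately show ?thesis by simp
    qed
    then have "\<omega> \<in> border_bad {c \<in> G. \<not> deep n (3 * J + 1) c} p j k v"
      using \<omega> \<phi>'(1) cond unfolding border_bad_def D[symmetric] by blast
    then show False using Bd[OF j(1,2) _ nd k w] p v by simp
  qed
  then have all: "p \<in> ?A" if "p \<in> G" for p using that by blast
  have "v = corner_shift n k"
    using all_agreed_frame[OF k v] all J by (auto simp: agreed_def)
  then show ?thesis using that[OF k] all by (auto simp: agreed_def)
qed

end

section \<open>The probability of a failure\<close>

lemma card_UN_bound:
  fixes c :: real
  assumes "finite I" "\<And>i. i \<in> I \<Longrightarrow> real (card (A i)) \<le> c"
  shows "real (card (\<Union>i\<in>I. A i)) \<le> real (card I) * c"
proof -
  have "real (card (\<Union>i\<in>I. A i)) \<le> real (\<Sum>i\<in>I. card (A i))"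
    using card_UN_le[OF assms(1), of A] by (rule of_nat_mono)
  also have "\<dots> = (\<Sum>i\<in>I. real (card (A i)))" by simp
  also have "\<dots> \<le> (\<Sum>i\<in>I. c)" using assms(2) by (rule sum_mono)
  finally show ?thesis by simp
qed

lemma card_not_deep: "card {c \<in> cells n. \<not> deep n K c} \<le> 4 * n * K"
proof -
  let ?E = "{0..<int K} \<union> {int n - int K..<int n}"
  have "{c \<in> cells n. \<not> deep n K c} \<subseteq> ?E \<times> {0..<int n} \<union> {0..<int n} \<times> ?E"
    by (auto simp: cells_def deep_def)
  then have "card {c \<in> cells n. \<not> deep n K c} \<le> card (?E \<times> {0..<int n} \<union> {0..<int n} \<times> ?E)"
    by (intro card_mono) auto
  also have "\<dots> \<le> card (?E \<times> {0..<int n}) + card ({0..<int n} \<times> ?E)" by (rule card_Un_le)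
  also have "\<dots> = 2 * n * card ?E" by (simp only: card_cartesian_product) simp
  also have "card ?E \<le> K + K" using card_Un_le[of "{0..<int K}" "{int n - int K..<int n}"] by simp
  then have "2 * n * card ?E \<le> 2 * n * (K + K)" by (intro mult_le_mono2)
  also have "2 * n * (K + K) = 4 * n * K" by simp
  finally show ?thesis .
qed

text \<open>Boxes around these cells may touch a horizontal and a vertical border at once. The gain
  \<open>e\<close> is then lost, but there are only \<open>O(J^2)\<close> such centres.\<close>

definition corner :: "nat \<Rightarrow> nat \<Rightarrow> cell \<Rightarrow> bool" where
  "corner n J p \<longleftrightarrow> \<not> (int J + 1 \<le> fst p \<and> fst p + int J + 1 < int n) \<and> \<not> (int J + 1 \<le> snd p \<and> snd p + int J + 1 < int n)"

lemma card_corner: "card {p \<in> cells n. corner n J p} \<le> (2 * (J + 1))\<^sup>2"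
proof -
  let ?E = "{0..<int (J + 1)} \<union> {int n - int (J + 1)..<int n}"
  have "{p \<in> cells n. corner n J p} \<subseteq> ?E \<times> ?E" by (auto simp: cells_def corner_def)
  then have "card {p \<in> cells n. corner n J p} \<le> card (?E \<times> ?E)" by (intro card_mono) auto
  also have "\<dots> = card ?E * card ?E" by (rule card_cartesian_product)
  also have "card ?E \<le> 2 * (J + 1)" using card_Un_le[of "{0..<int (J + 1)}" "{int n - int (J + 1)..<int n}"] by simp
  then have "card ?E * card ?E \<le> 2 * (J + 1) * (2 * (J + 1))" by (intro mult_le_mono)
  finally show ?thesis by (simp add: power2_eq_square)
qed

definition offsets :: "nat \<Rightarrow> cell set" where
  "offsets s = {- int s..int s} \<times> {- int s..int s}"

lemma card_offsets: "finite (offsets s)" "card (offsets s) = (2 * s + 1)\<^sup>2"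
proof -
  have "card {- int s..int s} = 2 * s + 1" by simp
  then show "card (offsets s) = (2 * s + 1)\<^sup>2" by (simp only: offsets_def card_cartesian_product power2_eq_square)
qed (simp add: offsets_def)

text \<open>The bound \<open>q0\<close> stands in for \<open>q\<close> and can be chosen of order
  \<open>n\<close> even if \<open>q\<close> is huge. The exponent \<open>\<tau>\<close> expresses
  the constant factor between \<open>2 * n\<close> and \<open>q0\<close> as a power of
  \<open>q0\<close>, and \<open>\<kappa>\<close> pays for a unit of complexity. The numerical
  constants are generous choices that make the linear estimates of \<open>window_dominant\<close>
  close.\<close>

locale large_puzzle = puzzle +
  fixes J :: nat and q0 \<kappa> \<tau> :: real
  assumes q0: "1 < q0" "q0 \<le> real q" "2 * real n \<le> q0 powr (1 - \<tau> / 2)"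
    and sizes: "2 * J + 1 < n" "100000000 \<le> 2 * J + 1"
    and \<tau>: "0 \<le> \<tau>" "3 * 1000000 \<le> \<tau> * real (2 * J + 1)"
    and \<kappa>: "2 * (16 * real (((2 * J + 1)\<^sup>2)\<^sup>2) + 1) ^ 4 \<le> q0 powr \<kappa>" "0 \<le> \<kappa>" "\<kappa> \<le> 1 / 100000000"
begin

abbreviation "s \<equiv> 2 * J + 1"

lemma n_le: "2 * real n \<le> q0"
proof -
  have "q0 powr (1 - \<tau> / 2) \<le> q0 powr 1" using q0 \<tau> by (intro powr_mono) auto
  then show ?thesis using q0 by simp
qed

text \<open>The assumption on \<open>\<kappa>\<close> bounds a polynomial with leading term
  \<open>2 * 16^4 * s^16 = 131072 * s^16\<close>; this explains the limits 100000 and 16. All counts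
  of boxes, radii and offsets are absorbed in this way.\<close>

lemma poly_le_powr:
  assumes "C \<le> 100000" "i \<le> 16" shows "real C * real s ^ i \<le> q0 powr (1 / 100000000)"
proof -
  have s1: "real s \<ge> 1" by simp
  have "real C * real s ^ i \<le> 100000 * real s ^ 16"
    using assms s1 by (intro mult_mono power_increasing) auto
  also have "\<dots> \<le> 2 * (16 * real s ^ 4) ^ 4" by (simp add: power_mult_distrib flip: power_mult)
  also have "\<dots> \<le> 2 * (16 * real ((s\<^sup>2)\<^sup>2) + 1) ^ 4"
    by (intro mult_left_mono power_mono) (auto simp flip: power_mult)
  also have "\<dots> \<le> q0 powr \<kappa>" by (rule \<kappa>)
  also have "\<dots> \<le> q0 powr (1 / 100000000)" using q0 \<kappa> by (intro powr_mono) auto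
  finally show ?thesis .
qed

lemma card_box_le: "j \<le> J \<Longrightarrow> card (cell_box p j) \<le> s\<^sup>2"
  unfolding card_box by (intro power_mono) auto

definition failures :: "carving set" where
  "failures = {\<omega> \<in> \<Omega>. \<exists>\<phi>. assembly \<omega> \<phi> \<and> \<not> (\<exists>k<4. \<forall>p \<in> G.
     fst (frame k (corner_shift n k) p) \<in> G \<and> placed \<omega> \<phi> p = placed \<omega> (frame k (corner_shift n k)) p)}"

abbreviation "pool \<equiv> {c \<in> G. \<not> deep n (3 * J + 1) c}"

lemma pool_bound: "4 * real (card pool) \<le> q0 powr (5 / 4)"
proof -
  have "card pool \<le> 4 * n * (3 * J + 1)" by (rule card_not_deep)
  also have "\<dots> \<le> 4 * n * (2 * s)" by (intro mult_le_mono2) simp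
  finally have "real (card pool) \<le> real (4 * n * (2 * s))" by (rule of_nat_mono)
  then have "4 * real (card pool) \<le> 2 * real n * (real 16 * real s ^ 1)" by (simp add: algebra_simps)
  also have "\<dots> \<le> q0 * q0 powr (1 / 100000000)"
    using n_le q0 by (intro mult_mono poly_le_powr) auto
  also have "\<dots> = q0 powr (1 + 1 / 100000000)" using q0 by (subst powr_add) auto
  also have "\<dots> \<le> q0 powr (5 / 4)" using q0 by (intro powr_mono) auto
  finally show ?thesis .
qed

text \<open>With \<open>e = 1\<close> the bound beats the roughly \<open>n\<close> centres along the
  border; with \<open>e = 0\<close> it has to beat only the polylogarithmically many centres near
  the corners.\<close>

lemma border_bad_bound:
  assumes p: "p \<in> G" and j: "1 \<le> j" "j \<le> J" and k: "k < 4" and e: "e = 0 \<or> e = 1" "e = 1 \<Longrightarrow> \<not> corner n J p"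
  shows "real (card (border_bad pool p j k v)) \<le> 2 * q0 powr (- (real e + 1 / 60)) * real (card \<Omega>)"
  unfolding border_bad_def
proof (rule border_bound[where b = "s\<^sup>2" and \<kappa> = \<kappa>])
  show "cell_box p j \<inter> G \<noteq> {}" using p box_self by blast
  have "card (cell_box p j \<inter> G) \<le> card (cell_box p j)" using finite_box by (intro card_mono) auto
  then show "card (cell_box p j \<inter> G) \<le> s\<^sup>2" using card_box_le[OF j(2), of p] by linarith
  fix D assume D: "border_cond p j D"
  have "2 * card (outer_lost n D) + 2 * e \<le> perimeter D"
  proof (rule card_outer_lost[OF _ _ _ e(1)])
    show "D \<subseteq> cell_box p j \<inter> G" "D \<noteq> {}" using D by (auto simp: border_cond_def)
    show "2 * j + 1 < n" using j sizes by simp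
    assume "e = 1"
    then show "int j + 1 \<le> fst p \<and> fst p + int j + 1 < int n \<or> int j + 1 \<le> snd p \<and> snd p + int j + 1 < int n"
      using e(2) j by (auto simp: corner_def)
  qed
  then have "real (2 * card (outer_lost n D) + 2 * e) \<le> real (perimeter D)" by (rule of_nat_mono)
  then show "D \<noteq> {} \<and> (\<exists>d. real (card (lost (cell_box p j \<inter> G) D)) \<le> d + sqrt (real (card D)) / 40 \<and>
      2 * d + 2 * real e \<le> real (perimeter D))"
    using D by (auto simp: border_cond_def)
qed (use q0 \<kappa> k e pool_bound finite_cells in auto)

lemma failures_sub:
  "failures \<subseteq> (\<Union>(a, b)\<in>{(a, b). (a, b) \<in> G \<and> a + int s \<le> int n \<and> b + int s \<le> int n}. window_bad s a b)
    \<union> (\<Union>(p, j, k, w)\<in>{(p, j, k, w). p \<in> G \<and> j \<in> {1..J} \<and> k < 4 \<and> w \<in> offsets s \<and> cell_box p j \<subseteq> G}. interior_bad p j k (corner_shift n k + w))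
    \<union> (\<Union>(p, j, k, w)\<in>{p \<in> G. \<not> deep n J p \<and> \<not> corner n J p} \<times> {1..J} \<times> {..<4} \<times> offsets s. border_bad pool p j k (corner_shift n k + w))
    \<union> (\<Union>(p, j, k, w)\<in>{p \<in> G. corner n J p} \<times> {1..J} \<times> {..<4} \<times> offsets s. border_bad pool p j k (corner_shift n k + w))"
  (is "_ \<subseteq> ?W \<union> ?I \<union> ?B1 \<union> ?B2")
proof
  fix \<omega> assume "\<omega> \<in> failures"
  then obtain \<phi> where \<omega>: "\<omega> \<in> \<Omega>" and \<phi>: "assembly \<omega> \<phi>" and no: "\<not> (\<exists>k<4. \<forall>p \<in> G.
     fst (frame k (corner_shift n k) p) \<in> G \<and> placed \<omega> \<phi> p = placed \<omega> (frame k (corner_shift n k)) p)"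
    by (auto simp: failures_def)
  show "\<omega> \<in> ?W \<union> ?I \<union> ?B1 \<union> ?B2"
  proof (rule ccontr)
    assume nin: "\<omega> \<notin> ?W \<union> ?I \<union> ?B1 \<union> ?B2"
    have nW: "\<omega> \<notin> ?W" and nI: "\<omega> \<notin> ?I" and nB: "\<omega> \<notin> ?B1" "\<omega> \<notin> ?B2"
      by (rule contrapos_nn[OF nin], simp only: Un_iff simp_thms)+
    have UN: "\<omega> \<notin> (\<Union>i\<in>S. A i) \<Longrightarrow> i \<in> S \<Longrightarrow> \<omega> \<notin> A i" for i S and A :: "_ \<Rightarrow> carving set" by blast
    have 1: "\<omega> \<notin> window_bad s a b"
      if "0 \<le> a" "0 \<le> b" "a + int s \<le> int n" "b + int s \<le> int n" for a b
    proof -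
      have "(a, b) \<in> {(a, b). (a, b) \<in> G \<and> a + int s \<le> int n \<and> b + int s \<le> int n}" using that by (simp add: cells_def)
      from UN[OF nW this] show ?thesis by simp
    qed
    have 2: "\<omega> \<notin> interior_bad p j k (corner_shift n k + w)"
      if "1 \<le> j" "j \<le> J" "p \<in> G" "cell_box p j \<subseteq> G" "k < 4" "\<bar>fst w\<bar> \<le> int s" "\<bar>snd w\<bar> \<le> int s" for p j k w
    proof -
      have "(p, j, k, w) \<in> {(p, j, k, w). p \<in> G \<and> j \<in> {1..J} \<and> k < 4 \<and> w \<in> offsets s \<and> cell_box p j \<subseteq> G}"
        using that by (auto simp: offsets_def mem_Times_iff)
      from UN[OF nI this] show ?thesis by simp
    qed
    have 3: "\<omega> \<notin> border_bad pool p j k (corner_shift n k + w)"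
      if "1 \<le> j" "j \<le> J" "p \<in> G" "\<not> deep n J p" "k < 4" "\<bar>fst w\<bar> \<le> int s" "\<bar>snd w\<bar> \<le> int s" for p j k w
    proof -
      have w: "w \<in> offsets s" using that by (auto simp: offsets_def mem_Times_iff)
      show ?thesis
      proof (cases "corner n J p")
        case True
        then have "(p, j, k, w) \<in> {p \<in> G. corner n J p} \<times> {1..J} \<times> {..<4} \<times> offsets s" using that w by simp
        from UN[OF nB(2) this] show ?thesis by simp
      next
        case False
        then have "(p, j, k, w) \<in> {p \<in> G. \<not> deep n J p \<and> \<not> corner n J p} \<times> {1..J} \<times> {..<4} \<times> offsets s" using that w by simp
        from UN[OF nB(1) this] show ?thesis by simp
      qed
    qed
    have J: "1 \<le> J" "s \<le> n" using sizes by auto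
    obtain k where "k < 4" "\<And>p. p \<in> G \<Longrightarrow> fst (frame k (corner_shift n k) p) \<in> G \<and> placed \<omega> \<phi> p = placed \<omega> (frame k (corner_shift n k)) p"
      using assembly_rotation[OF \<omega> \<phi> J 1 2 3] by blast
    then show False using no by blast
  qed
qed

text \<open>Up to powers of \<open>s\<close>, the four families have \<open>n^2\<close>,
  \<open>n^2\<close>, \<open>n\<close> and 1 members, against the exponents -3, -5/2, -1 - 1/60 and
  -1/60 of \<open>q0\<close>. The last one is the tightest and leaves -1/100.\<close>

lemma card_failures: "real (card failures) \<le> 8 * q0 powr (- 1 / 100) * real (card \<Omega>)"
proof -
  let ?Wi = "{(a, b). (a, b) \<in> G \<and> a + int s \<le> int n \<and> b + int s \<le> int n}"
  let ?Ii = "{(p, j, k, w). p \<in> G \<and> j \<in> {1..J} \<and> k < (4::nat) \<and> w \<in> offsets s \<and> cell_box p j \<subseteq> G}"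
  let ?P1 = "{p \<in> G. \<not> deep n J p \<and> \<not> corner n J p}" and ?P2 = "{p \<in> G. corner n J p}"
  let ?R = "{1..J} \<times> {..<4::nat} \<times> offsets s"
  let ?W = "\<Union>(a, b)\<in>?Wi. window_bad s a b"
  let ?I = "\<Union>(p, j, k, w)\<in>?Ii. interior_bad p j k (corner_shift n k + w)"
  let ?B1 = "\<Union>(p, j, k, w)\<in>?P1 \<times> ?R. border_bad pool p j k (corner_shift n k + w)"
  let ?B2 = "\<Union>(p, j, k, w)\<in>?P2 \<times> ?R. border_bad pool p j k (corner_shift n k + w)"
  let ?N = "real (card \<Omega>)"
  let ?d = "1 / 100000000 :: real"
  have q0p: "q0 > 0" using q0 by simp
  have finG: "finite G" by (rule finite_cells)
  have cR: "real (card ?R) \<le> 18 * real s ^ 3"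
  proof -
    have "card ?R = 4 * J * (2 * s + 1)\<^sup>2" by (simp add: card_cartesian_product card_offsets)
    also have "\<dots> \<le> 2 * s * (3 * s)\<^sup>2" by (rule mult_le_mono, simp, rule power_mono) auto
    also have "\<dots> = 18 * s ^ 3" by (simp add: power2_eq_square power3_eq_cube algebra_simps)
    finally have "real (card ?R) \<le> real (18 * s ^ 3)" by (rule of_nat_mono)
    then show ?thesis by simp
  qed
  have finR: "finite ?R" by (simp add: card_offsets)
  have nn: "(real n)\<^sup>2 \<le> q0 powr 2"
  proof -
    have "real n \<le> q0" using n_le by simp
    then have "(real n)\<^sup>2 \<le> q0\<^sup>2" by (intro power_mono) auto
    then show ?thesis using q0p by simp
  qed
  have W: "real (card ?W) \<le> 2 * q0 powr (- 1 / 100) * ?N"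
  proof -
    have sub: "?Wi \<subseteq> G" by auto
    have "real (card ?W) \<le> real (card ?Wi) * (2 * q0 powr (- 3) * ?N)"
    proof (rule card_UN_bound)
      show "finite ?Wi" using sub finG finite_subset by blast
      fix i assume i: "i \<in> ?Wi"
      obtain a b where ab: "i = (a, b)" by force
      have ab2: "0 \<le> a" "0 \<le> b" "a + int s \<le> int n" "b + int s \<le> int n" using i ab by (auto simp: cells_def)
      have "real (card (window_bad s a b)) \<le> 2 * q0 powr (- 3) * ?N"
        unfolding window_bad_def
        by (rule window_bound[OF window_def window_sub_cells[OF ab2] sizes(2) q0 \<kappa> \<tau>(2)])
      then show "real (card (case i of (a, b) \<Rightarrow> window_bad s a b)) \<le> 2 * q0 powr (- 3) * ?N" by (simp add: ab)
    qed
    also have "\<dots> \<le> q0 powr 2 * (2 * q0 powr (- 3) * ?N)"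
    proof (rule mult_right_mono)
      have "real (card ?Wi) \<le> real (card G)" using card_mono[OF finG sub] by (rule of_nat_mono)
      also have "real (card G) = (real n)\<^sup>2" by (simp add: card_cells)
      finally show "real (card ?Wi) \<le> q0 powr 2" using nn by linarith
    qed simp
    also have "\<dots> = 2 * (q0 powr 2 * q0 powr (- 3)) * ?N" by simp
    also have "q0 powr 2 * q0 powr (- 3) = q0 powr (- 1)" by (subst powr_add[symmetric]) simp
    also have "2 * q0 powr (- 1) * ?N \<le> 2 * q0 powr (- 1 / 100) * ?N"
      using q0 by (intro mult_right_mono mult_left_mono powr_mono) auto
    finally show ?thesis .
  qed
  have I: "real (card ?I) \<le> 2 * q0 powr (- 1 / 100) * ?N"
  proof -
    have sub: "?Ii \<subseteq> G \<times> ?R" by auto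
    have fGR: "finite (G \<times> ?R)" using finG finR by blast
    have "real (card ?I) \<le> real (card ?Ii) * (2 * q0 powr (- 5 / 2) * ?N)"
    proof (rule card_UN_bound)
      show "finite ?Ii" using sub fGR finite_subset by blast
      fix i assume i: "i \<in> ?Ii"
      obtain p j k w where pj: "i = (p, j, k, w)" by (metis prod.exhaust)
      have c: "cell_box p j \<subseteq> G" "k < 4" "j \<le> J" using i pj by auto
      have "cell_box p j \<noteq> {}" using box_self by blast
      have "real (card (interior_bad p j k (corner_shift n k + w))) \<le> 2 * q0 powr (- 5 / 2) * ?N"
        unfolding interior_bad_def
        by (rule interior_bound[OF c(1) \<open>cell_box p j \<noteq> {}\<close> card_box_le[OF c(3)] c(2) _ q0(2) n_le \<kappa>(1,2)])
          (use q0 \<kappa> in auto)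
      then show "real (card (case i of (p, j, k, w) \<Rightarrow> interior_bad p j k (corner_shift n k + w))) \<le> 2 * q0 powr (- 5 / 2) * ?N"
        by (simp add: pj)
    qed
    also have "\<dots> \<le> q0 powr (2 + ?d) * (2 * q0 powr (- 5 / 2) * ?N)"
    proof (rule mult_right_mono)
      have "real (card ?Ii) \<le> real (card (G \<times> ?R))" using card_mono[OF fGR sub] by simp
      also have "\<dots> = (real n)\<^sup>2 * real (card ?R)" by (simp only: card_cartesian_product card_cells of_nat_mult of_nat_power)
      also have "\<dots> \<le> q0 powr 2 * q0 powr ?d"
        using nn order_trans[OF cR] poly_le_powr[of 18 3] by (intro mult_mono) auto
      finally show "real (card ?Ii) \<le> q0 powr (2 + ?d)" by (simp only: powr_add)
    qed simp
    also have "\<dots> = 2 * (q0 powr (2 + ?d) * q0 powr (- 5 / 2)) * ?N" by simp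
    also have "q0 powr (2 + ?d) * q0 powr (- 5 / 2) = q0 powr (2 + ?d - 5 / 2)" by (subst powr_add[symmetric]) simp
    also have "2 * q0 powr (2 + ?d - 5 / 2) * ?N \<le> 2 * q0 powr (- 1 / 100) * ?N"
      using q0 by (intro mult_right_mono mult_left_mono powr_mono) auto
    finally show ?thesis .
  qed
  have B1: "real (card ?B1) \<le> 2 * q0 powr (- 1 / 100) * ?N"
  proof -
    have "real (card ?B1) \<le> real (card (?P1 \<times> ?R)) * (2 * q0 powr (- (real 1 + 1 / 60)) * ?N)"
    proof (rule card_UN_bound)
      show "finite (?P1 \<times> ?R)" using finG finR by simp
      fix i assume i: "i \<in> ?P1 \<times> ?R"
      obtain p j k w where pj: "i = (p, j, k, w)" by (metis prod.exhaust)
      have m: "p \<in> G" "1 \<le> j" "j \<le> J" "k < 4" "\<not> corner n J p" using i unfolding pj by auto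
      have "real (card (border_bad pool p j k (corner_shift n k + w))) \<le> 2 * q0 powr (- (real 1 + 1 / 60)) * ?N"
        by (rule border_bad_bound[OF m(1-4)]) (use m(5) in simp_all)
      then show "real (card (case i of (p, j, k, w) \<Rightarrow> border_bad pool p j k (corner_shift n k + w)))
        \<le> 2 * q0 powr (- (real 1 + 1 / 60)) * ?N" by (simp add: pj)
    qed
    also have "\<dots> \<le> q0 powr (1 + ?d) * (2 * q0 powr (- (real 1 + 1 / 60)) * ?N)"
    proof (rule mult_right_mono)
      have "card ?P1 \<le> card {c \<in> G. \<not> deep n J c}" using finG by (intro card_mono) auto
      also have "\<dots> \<le> 4 * n * J" by (rule card_not_deep)
      also have "\<dots> \<le> 4 * n * s" by (intro mult_le_mono2) simp
      finally have "real (card ?P1) \<le> real (4 * n * s)" by (rule of_nat_mono)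
      then have P1: "real (card ?P1) \<le> 4 * real n * real s" by (simp only: of_nat_mult of_nat_numeral)
      have "real (card (?P1 \<times> ?R)) = real (card ?P1) * real (card ?R)" by (simp only: card_cartesian_product of_nat_mult)
      also have "\<dots> \<le> (4 * real n * real s) * (18 * real s ^ 3)" using P1 cR by (intro mult_mono) auto
      also have "\<dots> = (2 * real n) * (real 36 * real s ^ 4)" by (simp add: power3_eq_cube power4_eq_xxxx)
      also have "\<dots> \<le> q0 powr 1 * q0 powr ?d" using n_le q0p by (intro mult_mono poly_le_powr) auto
      finally show "real (card (?P1 \<times> ?R)) \<le> q0 powr (1 + ?d)" by (simp only: powr_add)
    qed simp
    also have "\<dots> = 2 * (q0 powr (1 + ?d) * q0 powr (- (real 1 + 1 / 60))) * ?N" by simp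
    also have "q0 powr (1 + ?d) * q0 powr (- (real 1 + 1 / 60)) = q0 powr (1 + ?d - (1 + 1 / 60))"
      by (subst powr_add[symmetric]) simp
    also have "2 * q0 powr (1 + ?d - (1 + 1 / 60)) * ?N \<le> 2 * q0 powr (- 1 / 100) * ?N"
      using q0 by (intro mult_right_mono mult_left_mono powr_mono) auto
    finally show ?thesis .
  qed
  have B2: "real (card ?B2) \<le> 2 * q0 powr (- 1 / 100) * ?N"
  proof -
    have "real (card ?B2) \<le> real (card (?P2 \<times> ?R)) * (2 * q0 powr (- (real 0 + 1 / 60)) * ?N)"
    proof (rule card_UN_bound)
      show "finite (?P2 \<times> ?R)" using finG finR by simp
      fix i assume i: "i \<in> ?P2 \<times> ?R"
      obtain p j k w where pj: "i = (p, j, k, w)" by (metis prod.exhaust)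
      have m: "p \<in> G" "1 \<le> j" "j \<le> J" "k < 4" "corner n J p" using i unfolding pj by auto
      have "real (card (border_bad pool p j k (corner_shift n k + w))) \<le> 2 * q0 powr (- (real 0 + 1 / 60)) * ?N"
        by (rule border_bad_bound[OF m(1-4)]) (use m(5) in simp_all)
      then show "real (card (case i of (p, j, k, w) \<Rightarrow> border_bad pool p j k (corner_shift n k + w)))
        \<le> 2 * q0 powr (- (real 0 + 1 / 60)) * ?N" by (simp add: pj)
    qed
    also have "\<dots> \<le> q0 powr ?d * (2 * q0 powr (- (real 0 + 1 / 60)) * ?N)"
    proof (rule mult_right_mono)
      have "card ?P2 \<le> (2 * (J + 1))\<^sup>2" by (rule card_corner)
      also have "\<dots> \<le> (2 * s)\<^sup>2" using sizes by (intro power_mono mult_le_mono2) auto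
      finally have "real (card ?P2) \<le> real ((2 * s)\<^sup>2)" by (rule of_nat_mono)
      also have "real ((2 * s)\<^sup>2) = 4 * real s ^ 2" by (simp add: power2_eq_square algebra_simps)
      finally have P2: "real (card ?P2) \<le> 4 * real s ^ 2" .
      have "real (card (?P2 \<times> ?R)) = real (card ?P2) * real (card ?R)" by (simp only: card_cartesian_product of_nat_mult)
      also have "\<dots> \<le> (4 * real s ^ 2) * (18 * real s ^ 3)" using P2 cR by (intro mult_mono) auto
      also have "\<dots> = real 72 * real s ^ 5" by (simp add: power_add[symmetric])
      also have "\<dots> \<le> q0 powr ?d" by (rule poly_le_powr) auto
      finally show "real (card (?P2 \<times> ?R)) \<le> q0 powr ?d" .
    qed simp
    also have "\<dots> = 2 * (q0 powr ?d * q0 powr (- (real 0 + 1 / 60))) * ?N" by simp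
    also have "q0 powr ?d * q0 powr (- (real 0 + 1 / 60)) = q0 powr (?d - 1 / 60)"
      by (subst powr_add[symmetric]) simp
    also have "2 * q0 powr (?d - 1 / 60) * ?N \<le> 2 * q0 powr (- 1 / 100) * ?N"
      using q0 by (intro mult_right_mono mult_left_mono powr_mono) auto
    finally show ?thesis .
  qed
  have "window_bad s a b \<subseteq> \<Omega>" "interior_bad p j k v \<subseteq> \<Omega>" "border_bad pool p j k v \<subseteq> \<Omega>" for a b p j k v
    by (auto simp: window_bad_def interior_bad_def border_bad_def)
  then have "?W \<union> ?I \<union> ?B1 \<union> ?B2 \<subseteq> \<Omega>" by (intro Un_least UN_least) (simp_all split: prod.splits)
  then have "card failures \<le> card (?W \<union> ?I \<union> ?B1 \<union> ?B2)"
    using failures_sub by (intro card_mono) (auto intro: finite_subset[OF _ finite_carvings])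
  also have "\<dots> \<le> card ?W + card ?I + card ?B1 + card ?B2"
    using card_Un_le[of ?W ?I] card_Un_le[of "?W \<union> ?I" ?B1] card_Un_le[of "?W \<union> ?I \<union> ?B1" ?B2] by linarith
  finally have "real (card failures) \<le> real (card ?W + card ?I + card ?B1 + card ?B2)" by (rule of_nat_mono)
  then show ?thesis using W I B1 B2 by simp
qed

end

section \<open>Solutions as assemblies\<close>

definition pos_cell :: "pos \<Rightarrow> cell" where
  "pos_cell p = (int (fst p), int (snd p))"

lemma nat_cell_pos_cell [simp]: "nat_cell (pos_cell p) = p"
  by (simp add: nat_cell_def pos_cell_def)

lemma pos_cell_nat_cell: "c \<in> cells n \<Longrightarrow> pos_cell (nat_cell c) = c"
  by (auto simp: nat_cell_def pos_cell_def cells_def)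

lemma pos_cell_in: "p \<in> grid n \<Longrightarrow> pos_cell p \<in> cells n"
  by (auto simp: pos_cell_def cells_def grid_def)

lemma rotate_pos_in: "p \<in> grid n \<Longrightarrow> rotate_pos n p \<in> grid n"
  by (auto simp: rotate_pos_def grid_def split: prod.splits)

lemma funpow_rotate_pos_in: "p \<in> grid n \<Longrightarrow> (rotate_pos n ^^ k) p \<in> grid n"
  by (induction k) (auto simp: rotate_pos_in)

lemma rotate_pos_4: "p \<in> grid n \<Longrightarrow> (rotate_pos n ^^ 4) p = p"
  by (cases p) (auto simp: rotate_pos_def grid_def numeral_eq_Suc)

lemma funpow_rotate_pos_4_mult: "p \<in> grid n \<Longrightarrow> (rotate_pos n ^^ (4 * k)) p = p"
proof (induction k)
  case (Suc k)
  have "4 * Suc k = 4 + 4 * k" by simp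
  then show ?case using Suc rotate_pos_4[of p n] by (simp add: funpow_add)
qed simp

lemma inj_rotate_pos: "inj_on (rotate_pos n ^^ k) (grid n)"
proof (rule inj_on_inverseI[where g = "rotate_pos n ^^ (3 * k)"])
  fix p assume "p \<in> grid n"
  moreover have "3 * k + k = 4 * k" by simp
  ultimately show "(rotate_pos n ^^ (3 * k)) ((rotate_pos n ^^ k) p) = p"
    by (metis comp_apply funpow_add funpow_rotate_pos_4_mult)
qed

lemma finite_grid: "finite (grid n)"
  by (simp add: grid_def)

lemma bij_rotate_pos: "bij_betw (rotate_pos n ^^ k) (grid n) (grid n)"
  using inj_rotate_pos finite_grid funpow_rotate_pos_in
  by (metis bij_betw_def endo_inj_surj image_subsetI)

lemma global_rotation_in_placements: "k < 4 \<Longrightarrow> global_rotation n k \<in> placements n"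
  using bij_rotate_pos[of k n] by (auto simp: global_rotation_def placements_def cong: bij_betw_cong)

lemma induced_carving_at:
  assumes S: "(\<pi>, \<rho>) \<in> placements n" and c: "c \<in> grid n"
  shows "induced_carving n \<omega> (\<pi>, \<rho>) (\<pi> c) = rotate_piece (\<rho> c) (\<omega> c)"
proof -
  have b: "bij_betw \<pi> (grid n) (grid n)" using S by (simp add: placements_def)
  then have "the_inv_into (grid n) \<pi> (\<pi> c) = c" "\<pi> c \<in> grid n"
    using c by (auto simp: bij_betw_def the_inv_into_f_f)
  then show ?thesis by (simp add: induced_carving_def)
qed

lemma rotate_carving_at:
  assumes "k < 4" "c \<in> grid n"
  shows "rotate_carving n k \<omega> ((rotate_pos n ^^ k) c) = rotate_piece k (\<omega> c)"
proof -
  have "induced_carving n \<omega> (global_rotation n k) ((\<lambda>p\<in>grid n. (rotate_pos n ^^ k) p) c)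
      = rotate_piece ((\<lambda>p\<in>grid n. k) c) (\<omega> c)"
    using induced_carving_at[of "\<lambda>p\<in>grid n. (rotate_pos n ^^ k) p" "\<lambda>p\<in>grid n. k" n c \<omega>]
      global_rotation_in_placements[OF assms(1), of n] assms(2) by (simp add: global_rotation_def)
  then show ?thesis using assms by (simp add: rotate_carving_def)
qed

lemma induced_carving_undefined: "p \<notin> grid n \<Longrightarrow> induced_carving n \<omega> S p = undefined"
  by (simp add: induced_carving_def)

lemma rotate_carving_rotate_carving:
  assumes "j < 4" "k < 4"
  shows "rotate_carving n j (rotate_carving n k \<omega>) = rotate_carving n ((j + k) mod 4) \<omega>"
proof
  fix p
  show "rotate_carving n j (rotate_carving n k \<omega>) p = rotate_carving n ((j + k) mod 4) \<omega> p"
  proof (cases "p \<in> grid n")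
    case True
    then obtain c where c: "c \<in> grid n" "p = (rotate_pos n ^^ (j + k)) c"
      using bij_betw_imp_surj_on[OF bij_rotate_pos[of "j + k" n]] by blast
    have "(rotate_pos n ^^ (j + k)) c = (rotate_pos n ^^ ((j + k) mod 4)) c"
    proof -
      have "j + k = (j + k) mod 4 + 4 * ((j + k) div 4)" by simp
      then show ?thesis using funpow_rotate_pos_4_mult[OF c(1)] by (metis comp_apply funpow_add)
    qed
    then have "rotate_carving n ((j + k) mod 4) \<omega> p = rotate_piece ((j + k) mod 4) (\<omega> c)"
      using c rotate_carving_at[of "(j + k) mod 4" c n \<omega>] by simp
    moreover have "rotate_carving n j (rotate_carving n k \<omega>) p = rotate_piece j (rotate_piece k (\<omega> c))"
      using c rotate_carving_at[OF assms(1) funpow_rotate_pos_in[OF c(1), of k]] rotate_carving_at[OF assms(2) c(1)]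
      by (simp add: funpow_add)
    ultimately show ?thesis by (simp add: rotate_piece_rotate_piece rotate_piece_mod)
  next
    case False
    then show ?thesis by (simp add: rotate_carving_def induced_carving_undefined)
  qed
qed

text \<open>A frame looks up where the piece at a position came from, so it inverts the rotation of
  positions.\<close>

lemma frame_rotate_pos:
  assumes k: "k < 4" and c: "c \<in> grid n"
  shows "frame k (corner_shift n k) (pos_cell ((rotate_pos n ^^ k) c)) = (pos_cell c, k)"
proof -
  obtain x y where xy: "c = (x, y)" "x < n" "y < n" using c by (auto simp: grid_def)
  have "fst (frame k (corner_shift n k + 0) (pos_cell ((rotate_pos n ^^ k) c))) = pos_cell c"
    using k
  proof (cases rule: less_4_cases)
    case 1 then show ?thesis using xy unfolding 1 frame_corner_shift by (simp add: pos_cell_def)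
  next
    case 2 then show ?thesis using xy unfolding 2 frame_corner_shift
      by (simp add: pos_cell_def rotate_pos_def of_nat_diff)
  next
    case 3 then show ?thesis using xy unfolding 3 frame_corner_shift
      by (simp add: pos_cell_def rotate_pos_def of_nat_diff numeral_eq_Suc)
  next
    case 4 then show ?thesis using xy unfolding 4 frame_corner_shift
      by (simp add: pos_cell_def rotate_pos_def of_nat_diff numeral_eq_Suc)
  qed
  then show ?thesis by (simp add: frame_def)
qed

context puzzle
begin

text \<open>A placement sends pieces to positions, an assembly sends positions to pieces; hence the
  inverse.\<close>

definition assembly_of :: "placement \<Rightarrow> cell \<Rightarrow> cell \<times> nat" where
  "assembly_of S c = (let s = the_inv_into (grid n) (fst S) (nat_cell c) in (pos_cell s, snd S s))"

lemma induced_carving_placed: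
  assumes "c \<in> G"
  shows "induced_carving n \<omega> S (nat_cell c) = placed \<omega> (assembly_of S) c"
  using nat_cell_in_grid[OF assms] by (simp add: induced_carving_def placed_def assembly_of_def Let_def)

lemma induced_in:
  assumes \<omega>: "\<omega> \<in> \<Omega>" and S: "S \<in> placements n" and p: "p \<in> grid n"
  shows "induced_carving n \<omega> S p \<in> {..<4} \<rightarrow>\<^sub>E {1..q}"
proof -
  obtain \<pi> \<rho> where Sp: "S = (\<pi>, \<rho>)" by force
  have "bij_betw \<pi> (grid n) (grid n)" using S Sp by (simp add: placements_def)
  then obtain c where c: "c \<in> grid n" "p = \<pi> c" using p bij_betw_imp_surj_on by blast
  have "\<omega> c \<in> {..<4} \<rightarrow>\<^sub>E {1..q}" using \<omega> c by (auto simp: carvings_iff)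
  then have "rotate_piece (\<rho> c) (\<omega> c) \<in> {..<4} \<rightarrow>\<^sub>E {1..q}"
    unfolding rotate_piece_def by (intro restrict_PiE_iff[THEN iffD2]) (auto simp: PiE_def Pi_def)
  then show ?thesis using induced_carving_at[of \<pi> \<rho> n c \<omega>] S c Sp by simp
qed

lemma induced_in_carvings:
  assumes \<omega>: "\<omega> \<in> \<Omega>" and S: "S \<in> solutions n \<iota> \<omega>"
  shows "induced_carving n \<omega> S \<in> \<Omega>"
proof -
  have pl: "S \<in> placements n" using S by (simp add: solutions_def)
  have "induced_carving n \<omega> S \<in> grid n \<rightarrow>\<^sub>E ({..<4} \<rightarrow>\<^sub>E {1..q})"
    by (rule PiE_I, rule induced_in[OF \<omega> pl], assumption, rule induced_carving_undefined)
  then show ?thesis using S by (simp add: solutions_def carvings_def)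
qed

lemma assembly_of_solution:
  assumes \<omega>: "\<omega> \<in> \<Omega>" and S: "S \<in> solutions n \<iota> \<omega>"
  shows "assembly \<omega> (assembly_of S)"
proof -
  obtain \<pi> \<rho> where Sp: "S = (\<pi>, \<rho>)" by force
  have pl: "S \<in> placements n" using S by (simp add: solutions_def)
  have b: "bij_betw \<pi> (grid n) (grid n)" and \<rho>: "\<rho> \<in> grid n \<rightarrow>\<^sub>E {..<4}" using pl Sp by (auto simp: placements_def)
  have b': "bij_betw (the_inv_into (grid n) \<pi>) (grid n) (grid n)" by (rule bij_betw_the_inv_into[OF b])
  have inv: "the_inv_into (grid n) \<pi> (nat_cell c) \<in> grid n" if "c \<in> G" for c
    using bij_betwE[OF b'] nat_cell_in_grid[OF that] by blast
  have "fits (induced_carving n \<omega> S)" using induced_in_carvings[OF assms] by (simp add: carvings_iff)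
  then have f: "jig (induced_carving n \<omega> S) (across s) = \<iota> (jig (induced_carving n \<omega> S) s)"
    if "s \<in> sides G" "fst (across s) \<in> G" for s
    using that by (simp add: fits_def sides_iff)
  have j: "jig (induced_carving n \<omega> S) s = jig \<omega> (orig_side (assembly_of S) s)" if "s \<in> sides G" for s
    using that induced_carving_placed[of "fst s" \<omega> S] jig_orig_side[of s \<omega> "assembly_of S"] by (simp add: jig_def sides_iff)
  show ?thesis
    unfolding assembly_def
  proof (intro conjI ballI impI)
    fix c assume c: "c \<in> G"
    show "fst (assembly_of S c) \<in> G" using pos_cell_in[OF inv[OF c]] by (simp add: assembly_of_def Let_def Sp)
    show "snd (assembly_of S c) < 4" using PiE_mem[OF \<rho> inv[OF c]] by (simp add: assembly_of_def Let_def Sp)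
  next
    show "inj_on (\<lambda>p. fst (assembly_of S p)) G"
    proof (rule inj_onI)
      fix c d assume a: "c \<in> G" "d \<in> G" "fst (assembly_of S c) = fst (assembly_of S d)"
      then have "the_inv_into (grid n) \<pi> (nat_cell c) = the_inv_into (grid n) \<pi> (nat_cell d)"
        by (simp add: assembly_of_def Let_def Sp) (metis nat_cell_pos_cell)
      then have "nat_cell c = nat_cell d"
        using bij_betw_imp_inj_on[OF b'] nat_cell_in_grid a by (auto simp: inj_on_def)
      then show "c = d" using inj_on_nat_cell a by (auto simp: inj_on_def)
    qed
  next
    fix s assume s: "s \<in> sides G" "fst (across s) \<in> G"
    then have "across s \<in> sides G" by (simp add: across_in_sides)
    then show "jig \<omega> (orig_side (assembly_of S) (across s)) = \<iota> (jig \<omega> (orig_side (assembly_of S) s))"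
      using f[OF s] j s by simp
  qed
qed

lemma rotate_carving_placed:
  assumes k: "k < 4" and c: "c \<in> G"
  shows "rotate_carving n k \<omega> (nat_cell c) = placed \<omega> (frame k (corner_shift n k)) c"
proof -
  obtain d where d: "d \<in> grid n" "nat_cell c = (rotate_pos n ^^ k) d"
    using bij_betw_imp_surj_on[OF bij_rotate_pos[of k n]] nat_cell_in_grid[OF c] by blast
  have "c = pos_cell ((rotate_pos n ^^ k) d)" using d pos_cell_nat_cell[OF c] by simp
  then have "frame k (corner_shift n k) c = (pos_cell d, k)" using frame_rotate_pos[OF k d(1)] by simp
  then show ?thesis using rotate_carving_at[OF k d(1), of \<omega>] d by (simp add: placed_def)
qed

lemma induced_eq_rotation:
  assumes k: "k < 4" and eq: "\<And>p. p \<in> G \<Longrightarrow> placed \<omega> (assembly_of S) p = placed \<omega> (frame k (corner_shift n k)) p"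
  shows "induced_carving n \<omega> S = rotate_carving n k \<omega>"
proof
  fix p show "induced_carving n \<omega> S p = rotate_carving n k \<omega> p"
  proof (cases "p \<in> grid n")
    case True
    then have "pos_cell p \<in> G" "p = nat_cell (pos_cell p)" by (simp_all add: pos_cell_in)
    then show ?thesis using induced_carving_placed rotate_carving_placed[OF k] eq by metis
  qed (simp add: rotate_carving_def induced_carving_undefined)
qed

lemma similar_if_rotations:
  assumes "i < 4" "k < 4" and S: "induced_carving n \<omega> S = rotate_carving n i \<omega>" and T: "induced_carving n \<omega> T = rotate_carving n k \<omega>"
  shows "similar n \<omega> S T"
proof -
  let ?j = "(k + 3 * i) mod 4"
  have "rotate_carving n ?j (rotate_carving n i \<omega>) = rotate_carving n ((?j + i) mod 4) \<omega>"
    using assms by (intro rotate_carving_rotate_carving) auto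
  also have "(?j + i) mod 4 = (k + 4 * i) mod 4" by (simp add: mod_simps)
  also have "\<dots> = k" using assms by simp
  finally show ?thesis unfolding similar_def S T by (intro exI[of _ ?j]) auto
qed

end

context large_puzzle
begin

lemma solution_is_rotation:
  assumes \<omega>: "\<omega> \<in> \<Omega> - failures" and S: "S \<in> solutions n \<iota> \<omega>"
  obtains k where "k < 4" "induced_carving n \<omega> S = rotate_carving n k \<omega>"
proof -
  have "assembly \<omega> (assembly_of S)" using assembly_of_solution \<omega> S by blast
  then obtain k where k: "k < 4" "\<forall>p \<in> G. fst (frame k (corner_shift n k) p) \<in> G \<and>
      placed \<omega> (assembly_of S) p = placed \<omega> (frame k (corner_shift n k)) p"
    using \<omega> by (auto simp: failures_def)
  then have "induced_carving n \<omega> S = rotate_carving n k \<omega>" by (intro induced_eq_rotation) auto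
  then show ?thesis using that k by blast
qed

lemma all_similar: "\<omega> \<in> \<Omega> - failures \<Longrightarrow> all_solutions_similar n \<iota> \<omega>"
  unfolding all_solutions_similar_def using solution_is_rotation similar_if_rotations by metis

end

section \<open>Repeated and symmetric pieces\<close>

lemma (in puzzle) prob_ge:
  assumes B: "B \<subseteq> \<Omega>" and good: "\<And>\<omega>. \<omega> \<in> \<Omega> - B \<Longrightarrow> P \<omega>"
    and card: "real (card B) \<le> c * real (card \<Omega>)"
  shows "1 - c \<le> measure_pmf.prob (random_puzzle n q \<iota>) {\<omega>. P \<omega>}"
proof -
  have ne: "\<Omega> \<noteq> {}" using carvings_nonempty q_pos \<iota>_closed by blast
  then have pos: "real (card \<Omega>) > 0" using finite_carvings by (simp add: card_gt_0_iff)
  have "card \<Omega> - card B = card (\<Omega> - B)"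
    using B finite_carvings by (simp add: card_Diff_subset finite_subset)
  also have "\<dots> \<le> card (\<Omega> \<inter> {\<omega>. P \<omega>})" using good finite_carvings by (intro card_mono) auto
  finally have "real (card \<Omega>) - real (card B) \<le> real (card (\<Omega> \<inter> {\<omega>. P \<omega>}))" by linarith
  then have "(1 - c) * real (card \<Omega>) \<le> real (card (\<Omega> \<inter> {\<omega>. P \<omega>}))"
    using card by (simp add: algebra_simps)
  then have "1 - c \<le> real (card (\<Omega> \<inter> {\<omega>. P \<omega>})) / real (card \<Omega>)"
    using pos by (simp add: pos_le_divide_eq)
  then show ?thesis using ne finite_carvings by (simp add: random_puzzle_def measure_pmf_of_set)
qed

lemma direction_inj: "direction d = direction e \<Longrightarrow> d < 4 \<Longrightarrow> e < 4 \<Longrightarrow> d = e"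
  by (elim less_4_cases) (simp_all add: direction_def)

context puzzle
begin

definition coincide :: "nat \<Rightarrow> cell \<Rightarrow> cell \<Rightarrow> carving set" where
  "coincide r c c' = {\<omega> \<in> \<Omega>. \<omega> (nat_cell c') = rotate_piece r (\<omega> (nat_cell c))}"

definition symmetric_at :: "cell \<Rightarrow> carving set" where
  "symmetric_at c = {\<omega> \<in> \<Omega>. \<omega> (nat_cell c) = rotate_piece 2 (\<omega> (nat_cell c))}"

lemma card_between: "card {s \<in> sides {a}. fst (across s) = b} \<le> 1"
proof -
  have "s = t" if "s \<in> {s \<in> sides {a}. fst (across s) = b}" "t \<in> {s \<in> sides {a}. fst (across s) = b}" for s t
  proof -
    have "fst s = fst t" "direction (snd s) = direction (snd t)" "snd s < 4" "snd t < 4"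
      using that by (auto simp: sides_iff across_def)
    then show ?thesis using direction_inj by (simp add: prod_eq_iff)
  qed
  moreover have "finite {s \<in> sides {a}. fst (across s) = b}" by (simp add: finite_sides)
  ultimately show ?thesis unfolding One_nat_def by (subst card_le_Suc0_iff_eq) blast+
qed

text \<open>Cells that are not neighbours have eight sides in four constraints with no constrained
  partner, which gives exponent 4. Neighbours share one edge: at most two sides drop out of
  \<open>K\<close> and at most two have constrained partners, which leaves at least 5/2. The weaker
  exponent 2 is enough, as only order \<open>n^2\<close> pairs are neighbours.\<close>

lemma card_coincide:
  assumes c: "c \<in> G" "c' \<in> G" "c \<noteq> c'"
  shows "real (card (coincide r c c')) \<le> real (card \<Omega>) * real q powr (- 2)"
    "(\<And>d. d < 4 \<Longrightarrow> c' \<noteq> c + direction d) \<Longrightarrow> real (card (coincide r c c')) \<le> real (card \<Omega>) * real q powr (- 4)"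
proof -
  define m where "m x = (if fst x = c then (c', (snd x + r) mod 4) else (c, (snd x + 3 * r) mod 4))" for x :: side
  define K0 where "K0 = sides {c} \<union> sides {c'}"
  \<comment> \<open>Pairs that already form an original adjacency are left out: they need not
    restrict the carving, for example if \<open>\<iota>\<close> is the identity.\<close>
  define K where "K = {x \<in> K0. m x \<noteq> across x}"
  have fin0: "finite K0" by (simp add: K0_def finite_sides)
  have finK: "finite K" using fin0 by (simp add: K_def)
  have mm: "m (m x) = x" "m x \<in> K0" "m x \<noteq> x" if "x \<in> K0" for x
  proof -
    have x: "snd x < 4" "fst x = c \<or> fst x = c'" using that by (auto simp: K0_def sides_iff)
    have "((snd x + r) mod 4 + 3 * r) mod 4 = snd x" "((snd x + 3 * r) mod 4 + r) mod 4 = snd x"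
    proof -
      have "((snd x + r) mod 4 + 3 * r) mod 4 = (snd x + 4 * r) mod 4" "((snd x + 3 * r) mod 4 + r) mod 4 = (snd x + 4 * r) mod 4"
        by (simp_all add: mod_simps algebra_simps)
      then show "((snd x + r) mod 4 + 3 * r) mod 4 = snd x" "((snd x + 3 * r) mod 4 + r) mod 4 = snd x" using x by simp_all
    qed
    then show "m (m x) = x" using x c(3) by (auto simp: m_def prod_eq_iff)
    show "m x \<in> K0" "m x \<noteq> x" using x c(3) by (auto simp: m_def K0_def sides_iff prod_eq_iff)
  qed
  have KG: "K \<subseteq> sides G" using c by (auto simp: K_def K0_def sides_iff)
  have mK: "m x \<in> K \<and> m (m x) = x \<and> m x \<noteq> x \<and> m x \<noteq> across x" if "x \<in> K" for x
  proof -
    have x: "x \<in> K0" "m x \<noteq> across x" using that by (auto simp: K_def)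
    have "m (m x) \<noteq> across (m x)"
    proof
      assume "m (m x) = across (m x)"
      then have "across x = across (across (m x))" using mm(1)[OF x(1)] by simp
      moreover have "snd (m x) < 4" using mm(2)[OF x(1)] by (auto simp: K0_def sides_iff)
      ultimately show False using x(2) across_across by simp
    qed
    then show ?thesis using mm[OF x(1)] x by (simp add: K_def)
  qed
  have sub: "coincide r c c' \<subseteq> satisfying K m (\<lambda>t. t)"
  proof
    fix \<omega> assume \<omega>: "\<omega> \<in> coincide r c c'"
    have e: "jig \<omega> (c', d) = jig \<omega> (c, (d + 3 * r) mod 4)" if "d < 4" for d
      using \<omega> that by (simp add: coincide_def jig_def rotate_piece_def)
    have "jig \<omega> (m x) = jig \<omega> x" if "x \<in> K" for x
    proof -
      have x: "x \<in> K0" using that by (simp add: K_def)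
      then have s: "snd x < 4" "fst x = c \<or> fst x = c'" by (auto simp: K0_def sides_iff)
      show ?thesis
      proof (cases "fst x = c")
        case True
        have "jig \<omega> (c', (snd x + r) mod 4) = jig \<omega> (c, ((snd x + r) mod 4 + 3 * r) mod 4)" by (rule e) simp
        also have "((snd x + r) mod 4 + 3 * r) mod 4 = (snd x + 4 * r) mod 4" by (simp add: mod_simps algebra_simps)
        finally show ?thesis using True s by (simp add: m_def) (metis prod.collapse)
      next
        case False
        then have "x = (c', snd x)" using s by (metis prod.collapse)
        then show ?thesis using e[OF s(1)] False by (simp add: m_def)
      qed
    qed
    then show "\<omega> \<in> satisfying K m (\<lambda>t. t)" using \<omega> by (simp add: satisfying_def coincide_def)
  qed
  have cs: "real (card (coincide r c c')) \<le> real (card \<Omega>) *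
      real q powr (- (2 * real (card K) - real (card {x \<in> K. across x \<in> K})) / 4)"
  proof -
    have "card (coincide r c c') \<le> card (satisfying K m (\<lambda>t. t))" by (rule card_mono[OF finite_satisfying sub])
    then show ?thesis using card_satisfying[OF finK KG mK, of "\<lambda>t. t"] by simp
  qed
  let ?N = "{s \<in> sides {c}. fst (across s) = c'} \<union> {s \<in> sides {c'}. fst (across s) = c}"
  have finN: "finite ?N" by (simp add: finite_sides)
  have N2: "card ?N \<le> 2"
    using card_Un_le[of "{s \<in> sides {c}. fst (across s) = c'}" "{s \<in> sides {c'}. fst (across s) = c}"]
      card_between[of c c'] card_between[of c' c] by linarith
  have u: "{x \<in> K. across x \<in> K} \<subseteq> ?N"
    using fst_across_neq by (auto simp: K_def K0_def sides_iff)
  have bad: "K0 - K \<subseteq> ?N"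
  proof
    fix x assume "x \<in> K0 - K"
    then have x: "x \<in> K0" "m x = across x" by (auto simp: K_def)
    then have "fst (across x) = fst (m x)" by simp
    then show "x \<in> ?N" using x(1) by (auto simp: m_def K0_def sides_iff split: if_splits)
  qed
  have "card K0 = card (sides {c}) + card (sides {c'})"
    unfolding K0_def using c(3) by (intro card_Un_disjoint) (auto simp: finite_sides sides_iff)
  then have K8: "card K0 = 8" by (simp add: card_sides)
  have KK: "K \<subseteq> K0" by (auto simp: K_def)
  have Kc: "card K = 8 - card (K0 - K)" "card K + card (K0 - K) = 8"
    using card_Diff_subset[OF finK KK] card_mono[OF fin0 KK] K8 by auto
  have uN: "card {x \<in> K. across x \<in> K} \<le> card ?N" "card (K0 - K) \<le> card ?N"
    using card_mono[OF finN u] card_mono[OF finN bad] by auto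
  have q1: "real q \<ge> 1" using q_pos by simp
  have "real (card K) + real (card (K0 - K)) = 8" using Kc(2) by linarith
  moreover have "real (card (K0 - K)) \<le> 2" "real (card {x \<in> K. across x \<in> K}) \<le> 2" using uN N2 by linarith+
  ultimately have "- (2 * real (card K) - real (card {x \<in> K. across x \<in> K})) / 4 \<le> - 2" by argo
  then have "real q powr (- (2 * real (card K) - real (card {x \<in> K. across x \<in> K})) / 4) \<le> real q powr (- 2)"
    using q1 by (intro powr_mono) auto
  then show "real (card (coincide r c c')) \<le> real (card \<Omega>) * real q powr (- 2)"
    using cs by (meson mult_left_mono of_nat_0_le_iff order_trans)
  assume nb: "\<And>d. d < 4 \<Longrightarrow> c' \<noteq> c + direction d"
  have "?N = {}"
  proof -
    have "fst (across s) \<noteq> c'" if "s \<in> sides {c}" for s using nb[of "snd s"] that by (auto simp: sides_iff across_def)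
    moreover have "fst (across s) \<noteq> c" if "s \<in> sides {c'}" for s
    proof
      assume "fst (across s) = c"
      have s: "snd s < 4" "fst s = c'" using that by (auto simp: sides_iff)
      have "fst (across (across s)) = fst (across s) + direction (snd (across s))" by (simp add: across_def)
      then have "c' = c + direction (snd (across s))" using \<open>fst (across s) = c\<close> s by (simp add: across_across)
      moreover have "snd (across s) < 4" by (simp add: across_def)
      ultimately show False using nb by blast
    qed
    ultimately show ?thesis by blast
  qed
  then have "card ?N = 0" by (simp only: card.empty)
  then have "card (K0 - K) = 0" "card {x \<in> K. across x \<in> K} = 0" using uN by linarith+
  then have "- (2 * real (card K) - real (card {x \<in> K. across x \<in> K})) / 4 = - 4" using Kc(2) by simp
  then show "real (card (coincide r c c')) \<le> real (card \<Omega>) * real q powr (- 4)" using cs by simp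
qed

text \<open>The half turn pairs the opposite sides of a single cell. These are two constraints, and
  no side of the cell has its original partner on the same cell.\<close>

lemma card_symmetric_at:
  assumes c: "c \<in> G"
  shows "real (card (symmetric_at c)) \<le> real (card \<Omega>) * real q powr (- 2)"
proof -
  define m where "m x = (c, (snd x + 2) mod 4)" for x :: side
  let ?K = "sides {c}"
  have sub: "symmetric_at c \<subseteq> satisfying ?K m (\<lambda>t. t)"
  proof
    fix \<omega> assume \<omega>: "\<omega> \<in> symmetric_at c"
    have "jig \<omega> (m x) = jig \<omega> x" if x: "x \<in> ?K" for x
    proof -
      have "\<omega> (nat_cell c) (snd x) = rotate_piece 2 (\<omega> (nat_cell c)) (snd x)" using \<omega> by (simp add: symmetric_at_def)
      also have "\<dots> = \<omega> (nat_cell c) ((snd x + 2 + 4) mod 4)" using x by (simp add: rotate_piece_def sides_iff add.commute)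
      also have "(snd x + 2 + 4) mod 4 = (snd x + 2) mod 4" by (rule mod_add_self2)
      finally show ?thesis using x by (simp add: m_def jig_def sides_iff)
    qed
    then show "\<omega> \<in> satisfying ?K m (\<lambda>t. t)" using \<omega> by (simp add: satisfying_def symmetric_at_def)
  qed
  have "{x \<in> ?K. across x \<in> ?K} = {}" using fst_across_neq by (auto simp: sides_iff)
  then have u: "card {x \<in> ?K. across x \<in> ?K} = 0" by (simp only: card.empty)
  have "real (card (satisfying ?K m (\<lambda>t. t))) \<le> real (card \<Omega>) *
      real q powr (- (2 * real (card ?K) - real (card {x \<in> ?K. across x \<in> ?K})) / 4)"
  proof (rule card_satisfying)
    show "finite ?K" by (simp add: finite_sides)
    show "?K \<subseteq> sides G" using c by (auto simp: sides_iff)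
    fix x assume x: "x \<in> ?K"
    then have "snd x < 4" "fst x = c" by (auto simp: sides_iff)
    moreover have "m x \<noteq> across x"
    proof -
      have "fst (m x) = fst x" using x by (simp add: m_def sides_iff)
      moreover have "fst (across x) \<noteq> fst x" by (rule fst_across_neq)
      ultimately show ?thesis by metis
    qed
    moreover from \<open>snd x < 4\<close> have "(snd x + 2) mod 4 \<noteq> snd x \<and> ((snd x + 2) mod 4 + 2) mod 4 = snd x"
      by (cases rule: less_4_cases) simp_all
    ultimately show "m x \<in> ?K \<and> m (m x) = x \<and> m x \<noteq> x \<and> m x \<noteq> across x"
      by (auto simp: m_def sides_iff prod_eq_iff)
  qed simp
  moreover have "card (symmetric_at c) \<le> card (satisfying ?K m (\<lambda>t. t))" by (rule card_mono[OF finite_satisfying sub])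
  ultimately show ?thesis unfolding u by (simp add: card_sides)
qed

definition repetitive :: "carving set" where
  "repetitive = (\<Union>(r, c, c')\<in>{(r, c, c'). r < 4 \<and> c \<in> G \<and> c' \<in> G \<and> c \<noteq> c'}. coincide r c c')
     \<union> (\<Union>c\<in>G. symmetric_at c)"

text \<open>The weaker exponent -2 applies to at most \<open>16 * n^2\<close> choices of neighbours
  with a rotation and to \<open>n^2\<close> symmetric pieces, hence the 17.\<close>

lemma card_repetitive:
  "real (card repetitive) \<le> (4 * real n ^ 4 * real q powr (- 4) + 17 * real n ^ 2 * real q powr (- 2)) * real (card \<Omega>)"
proof -
  let ?I = "{..<4::nat} \<times> G \<times> G"
  let ?J = "(\<lambda>(r, c, d). (r, c, c + direction d)) ` ({..<4::nat} \<times> G \<times> {..<4::nat})"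
  let ?V = "{(r, c, c'). r < (4::nat) \<and> c \<in> G \<and> c' \<in> G \<and> c \<noteq> c'}"
  let ?f = "\<lambda>(r, c, c'). coincide r c c'"
  let ?N = "real (card \<Omega>)"
  have finG: "finite G" by (rule finite_cells)
  have 1: "real (card (\<Union>i\<in>?V - ?J. ?f i)) \<le> real (card (?V - ?J)) * (?N * real q powr (- 4))"
  proof (rule card_UN_bound)
    show "finite (?V - ?J)" by (rule finite_subset[of _ ?I]) (use finG in auto)
    fix i assume i: "i \<in> ?V - ?J"
    obtain r c c' where rc: "i = (r, c, c')" by (metis prod.exhaust)
    have "c' \<noteq> c + direction d" if "d < 4" for d
    proof
      assume "c' = c + direction d"
      then have "i = (\<lambda>(r, c, d). (r, c, c + direction d)) (r, c, d)" using rc by simp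
      moreover have "(r, c, d) \<in> {..<4} \<times> G \<times> {..<4}" using i rc that by auto
      ultimately show False using i by blast
    qed
    then show "real (card (?f i)) \<le> ?N * real q powr (- 4)" using i rc card_coincide(2)[of c c' r] by simp
  qed
  have 2: "real (card (\<Union>i\<in>?V \<inter> ?J. ?f i)) \<le> real (card (?V \<inter> ?J)) * (?N * real q powr (- 2))"
  proof (rule card_UN_bound)
    show "finite (?V \<inter> ?J)" using finG by simp
    fix i assume i: "i \<in> ?V \<inter> ?J"
    obtain r c c' where rc: "i = (r, c, c')" by (metis prod.exhaust)
    then show "real (card (?f i)) \<le> ?N * real q powr (- 2)" using i card_coincide(1)[of c c' r] by simp
  qed
  have 3: "real (card (\<Union>c\<in>G. symmetric_at c)) \<le> real (card G) * (?N * real q powr (- 2))"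
    using finG card_symmetric_at by (intro card_UN_bound) auto
  have "card (?V - ?J) \<le> card ?I" using finG by (intro card_mono) auto
  also have "card ?I = 4 * n ^ 4" by (simp add: card_cartesian_product card_cells power2_eq_square power4_eq_xxxx)
  finally have "real (card (?V - ?J)) \<le> real (4 * n ^ 4)" by (rule of_nat_mono)
  then have c1: "real (card (?V - ?J)) \<le> 4 * real n ^ 4" by simp
  have "card (?V \<inter> ?J) \<le> card ?J" using finG by (intro card_mono) auto
  also have "\<dots> \<le> card ({..<4::nat} \<times> G \<times> {..<4::nat})" using finG by (intro card_image_le) auto
  also have "\<dots> = 16 * n ^ 2" by (simp add: card_cartesian_product card_cells)
  finally have "real (card (?V \<inter> ?J)) \<le> real (16 * n ^ 2)" by (rule of_nat_mono)
  then have c2: "real (card (?V \<inter> ?J)) \<le> 16 * real n ^ 2" by simp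
  have sub: "repetitive \<subseteq> (\<Union>i\<in>?V - ?J. ?f i) \<union> (\<Union>i\<in>?V \<inter> ?J. ?f i) \<union> (\<Union>c\<in>G. symmetric_at c)"
  proof -
    have "(\<Union>i\<in>?V. ?f i) = (\<Union>i\<in>?V - ?J. ?f i) \<union> (\<Union>i\<in>?V \<inter> ?J. ?f i)"
      by (simp only: UN_Un[symmetric] Un_Diff_Int)
    then show ?thesis unfolding repetitive_def by (simp only: order_refl)
  qed
  have "coincide r c c' \<subseteq> \<Omega>" "symmetric_at c \<subseteq> \<Omega>" for r c c' by (auto simp: coincide_def symmetric_at_def)
  then have "(\<Union>i\<in>?V - ?J. ?f i) \<union> (\<Union>i\<in>?V \<inter> ?J. ?f i) \<union> (\<Union>c\<in>G. symmetric_at c) \<subseteq> \<Omega>"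
    by (intro Un_least UN_least) (simp_all split: prod.splits)
  then have fin: "finite ((\<Union>i\<in>?V - ?J. ?f i) \<union> (\<Union>i\<in>?V \<inter> ?J. ?f i) \<union> (\<Union>c\<in>G. symmetric_at c))"
    by (rule finite_subset[OF _ finite_carvings])
  have "card repetitive \<le> card ((\<Union>i\<in>?V - ?J. ?f i) \<union> (\<Union>i\<in>?V \<inter> ?J. ?f i) \<union> (\<Union>c\<in>G. symmetric_at c))"
    by (rule card_mono[OF fin sub])
  also have "\<dots> \<le> card (\<Union>i\<in>?V - ?J. ?f i) + card (\<Union>i\<in>?V \<inter> ?J. ?f i) + card (\<Union>c\<in>G. symmetric_at c)"
    by (rule order_trans[OF card_Un_le add_right_mono[OF card_Un_le]])
  finally have "real (card repetitive) \<le> real (card (\<Union>i\<in>?V - ?J. ?f i) + card (\<Union>i\<in>?V \<inter> ?J. ?f i) + card (\<Union>c\<in>G. symmetric_at c))"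
    by (rule of_nat_mono)
  also have "\<dots> \<le> 4 * real n ^ 4 * (?N * real q powr (- 4)) + 16 * real n ^ 2 * (?N * real q powr (- 2)) + real n ^ 2 * (?N * real q powr (- 2))"
  proof -
    have "real (card (?V - ?J)) * (?N * real q powr (- 4)) \<le> 4 * real n ^ 4 * (?N * real q powr (- 4))"
      by (rule mult_right_mono[OF c1]) simp
    moreover have "real (card (?V \<inter> ?J)) * (?N * real q powr (- 2)) \<le> 16 * real n ^ 2 * (?N * real q powr (- 2))"
      by (rule mult_right_mono[OF c2]) simp
    moreover have "real (card G) = real n ^ 2" by (simp add: card_cells)
    with 3 have "real (card (\<Union>c\<in>G. symmetric_at c)) \<le> real n ^ 2 * (?N * real q powr (- 2))" by metis
    ultimately show ?thesis using 1 2 unfolding of_nat_add by argo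
  qed
  finally show ?thesis by (simp add: algebra_simps)
qed

lemma global_rotation_solution:
  assumes \<omega>: "\<omega> \<in> \<Omega>" and k: "k < 4"
  shows "global_rotation n k \<in> solutions n \<iota> \<omega>"
proof -
  let ?\<omega>' = "rotate_carving n k \<omega>" and ?fr = "frame k (corner_shift n k)"
  have pl: "global_rotation n k \<in> placements n" by (rule global_rotation_in_placements[OF k])
  have j: "jig ?\<omega>' s = jig \<omega> (orig_side ?fr s)" if "s \<in> sides G" for s
    using that rotate_carving_placed[OF k, of "fst s" \<omega>] jig_orig_side[of s \<omega> ?fr] by (simp add: jig_def sides_iff)
  have frG: "fst (?fr c) \<in> G" if "c \<in> G" for c
  proof -
    have "nat_cell c \<in> (rotate_pos n ^^ k) ` grid n"
      using bij_betw_imp_surj_on[OF bij_rotate_pos[of k n]] nat_cell_in_grid[OF that] by simp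
    then obtain d where d: "d \<in> grid n" "nat_cell c = (rotate_pos n ^^ k) d" by blast
    have "c = pos_cell ((rotate_pos n ^^ k) d)" using d pos_cell_nat_cell[OF that] by simp
    then show ?thesis using frame_rotate_pos[OF k d(1)] pos_cell_in[OF d(1)] by simp
  qed
  have "fits ?\<omega>'"
    unfolding fits_def
  proof (intro ballI impI)
    fix s assume s: "s \<in> sides G" "across s \<in> sides G"
    then have s4: "snd s < 4" "fst s \<in> G" "fst (across s) \<in> G" by (auto simp: sides_iff)
    have e: "across (orig_side ?fr s) = orig_side ?fr (across s)" by (rule across_orig_side_frame[OF s4(1)])
    have "orig_side ?fr s \<in> sides G" "orig_side ?fr (across s) \<in> sides G" using frG s4 by (simp_all add: sides_iff fst_orig_side)
    then have "jig \<omega> (orig_side ?fr (across s)) = \<iota> (jig \<omega> (orig_side ?fr s))" using \<omega> e unfolding carvings_iff fits_def by metis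
    then show "jig ?\<omega>' (across s) = \<iota> (jig ?\<omega>' s)" using j s by simp
  qed
  moreover have "?\<omega>' p \<in> {..<4} \<rightarrow> {1..q}" if "p \<in> grid n" for p
    using induced_in[OF \<omega> pl that] unfolding rotate_carving_def by (simp add: PiE_def)
  ultimately have "fits_together n \<iota> ?\<omega>'" using fits_together_iff by blast
  then show ?thesis using pl by (simp add: solutions_def rotate_carving_def)
qed

text \<open>A piece fixed by a quarter turn in either direction is also fixed by the half turn, so
  excluding the half turn excludes all symmetries.\<close>

lemma not_repetitive:
  assumes \<omega>: "\<omega> \<in> \<Omega> - repetitive" and c: "c \<in> grid n" "d \<in> grid n" and r: "r < 4"
    and eq: "\<omega> c = rotate_piece r (\<omega> d)"
  shows "c = d \<and> r = 0"
proof -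
  have cd: "pos_cell c \<in> G" "pos_cell d \<in> G" using c pos_cell_in by auto
  have cd_eq: "c = d"
  proof (rule ccontr)
    assume "c \<noteq> d"
    then have "pos_cell d \<noteq> pos_cell c" by (metis nat_cell_pos_cell)
    then have "(r, pos_cell d, pos_cell c) \<in> {(r, c, c'). r < 4 \<and> c \<in> G \<and> c' \<in> G \<and> c \<noteq> c'}" using cd r by simp
    moreover have "\<omega> \<in> coincide r (pos_cell d) (pos_cell c)" using \<omega> eq by (simp add: coincide_def)
    ultimately have "\<omega> \<in> repetitive" unfolding repetitive_def by blast
    then show False using \<omega> by simp
  qed
  have "r = 0"
  proof (rule ccontr)
    assume "r \<noteq> 0"
    have "rotate_piece 2 (\<omega> c) = \<omega> c"
      using r
    proof (cases rule: less_4_cases)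
      case 2
      have "\<omega> c = rotate_piece 1 (rotate_piece 1 (\<omega> c))" using eq cd_eq 2 by metis
      then show ?thesis by (simp add: rotate_piece_rotate_piece numeral_2_eq_2)
    next
      case 4
      have "\<omega> c = rotate_piece 3 (rotate_piece 3 (\<omega> c))" using eq cd_eq 4 by metis
      then show ?thesis using rotate_piece_mod[of 6 "\<omega> c"] by (simp add: rotate_piece_rotate_piece)
    qed (use eq cd_eq \<open>r \<noteq> 0\<close> in simp_all)
    then have "\<omega> \<in> symmetric_at (pos_cell c)" using \<omega> by (simp add: symmetric_at_def)
    then have "\<omega> \<in> repetitive" unfolding repetitive_def using cd by blast
    then show False using \<omega> by simp
  qed
  then show ?thesis using cd_eq by simp
qed

lemma rotated_copy_unique:
  assumes \<omega>: "\<omega> \<in> \<Omega> - repetitive" and S: "S \<in> placements n" and k: "k < 4"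
    and eq: "induced_carving n \<omega> S = rotate_carving n k \<omega>"
  shows "S = global_rotation n k"
proof -
  obtain \<pi> \<rho> where Sp: "S = (\<pi>, \<rho>)" by force
  have b: "bij_betw \<pi> (grid n) (grid n)" "\<pi> \<in> extensional (grid n)" and \<rho>: "\<rho> \<in> grid n \<rightarrow>\<^sub>E {..<4}"
    using S Sp by (auto simp: placements_def)
  have main: "\<pi> c = (rotate_pos n ^^ k) c \<and> \<rho> c = k" if c: "c \<in> grid n" for c
  proof -
    have "\<pi> c \<in> (rotate_pos n ^^ k) ` grid n"
      using bij_betw_imp_surj_on[OF bij_rotate_pos[of k n]] bij_betwE[OF b(1)] c by simp
    then obtain d where d: "d \<in> grid n" "\<pi> c = (rotate_pos n ^^ k) d" by blast
    have \<rho>4: "\<rho> c < 4" using PiE_mem[OF \<rho> c] by simp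
    have "rotate_piece (\<rho> c) (\<omega> c) = rotate_piece k (\<omega> d)"
      using induced_carving_at[of \<pi> \<rho> n c \<omega>] rotate_carving_at[OF k d(1), of \<omega>] S Sp eq c d(2) by simp
    then have "rotate_piece (3 * \<rho> c) (rotate_piece (\<rho> c) (\<omega> c)) = rotate_piece (3 * \<rho> c) (rotate_piece k (\<omega> d))" by simp
    then have "rotate_piece (4 * \<rho> c) (\<omega> c) = rotate_piece (3 * \<rho> c + k) (\<omega> d)"
      by (simp add: rotate_piece_rotate_piece)
    moreover have "rotate_piece (4 * \<rho> c) (\<omega> c) = \<omega> c"
    proof -
      have e: "\<omega> c \<in> {..<4} \<rightarrow>\<^sub>E {1..q}" using \<omega> c by (auto simp: carvings_iff)
      have "rotate_piece (4 * \<rho> c) (\<omega> c) = rotate_piece 0 (\<omega> c)" using rotate_piece_mod[of "4 * \<rho> c" "\<omega> c"] by simp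
      also have "\<dots> = \<omega> c"
      proof
        fix t show "rotate_piece 0 (\<omega> c) t = \<omega> c t"
          using PiE_arb[OF e, of t] by (cases "t < 4") (simp_all add: rotate_piece_def)
      qed
      finally show ?thesis .
    qed
    ultimately have "\<omega> c = rotate_piece ((3 * \<rho> c + k) mod 4) (\<omega> d)" by (simp add: rotate_piece_mod)
    from not_repetitive[OF \<omega> c d(1) _ this] have cd: "c = d" "(3 * \<rho> c + k) mod 4 = 0" by auto
    have "\<rho> c = k" using \<rho>4 k cd(2) by (elim less_4_cases) simp_all
    then show ?thesis using d cd by simp
  qed
  have "\<pi> = (\<lambda>p\<in>grid n. (rotate_pos n ^^ k) p)" using b(2) main by (intro extensionalityI[of _ "grid n"]) auto
  moreover have "\<rho> = (\<lambda>p\<in>grid n. k)" using \<rho> main by (intro extensionalityI[of _ "grid n"]) (auto simp: PiE_def)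
  ultimately show ?thesis by (simp add: Sp global_rotation_def)
qed

end

lemma (in large_puzzle) unique_solution:
  assumes "\<omega> \<in> \<Omega> - (failures \<union> repetitive)" shows "unique_up_to_rotation n \<iota> \<omega>"
  unfolding unique_up_to_rotation_def
proof
  show "global_rotation n ` {..<4} \<subseteq> solutions n \<iota> \<omega>" using assms global_rotation_solution by blast
  show "solutions n \<iota> \<omega> \<subseteq> global_rotation n ` {..<4}"
  proof
    fix S assume S: "S \<in> solutions n \<iota> \<omega>"
    then obtain k where k: "k < 4" "induced_carving n \<omega> S = rotate_carving n k \<omega>"
      using solution_is_rotation[of \<omega> S] assms by blast
    have "S = global_rotation n k"
      by (rule rotated_copy_unique[OF _ _ k]) (use assms S in \<open>auto simp: solutions_def\<close>)
    then show "S \<in> global_rotation n ` {..<4}" using k by blast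
  qed
qed

section \<open>Many types of jigs\<close>

lemma (in large_puzzle) failures_subset: "failures \<subseteq> \<Omega>"
  by (auto simp: failures_def)

text \<open>It outgrows every multiple of \<open>ln n\<close>, so that \<open>\<tau> * s\<close>
  becomes large although \<open>\<tau>\<close> is of order \<open>1 / ln n\<close>, and it stays
  below every positive power of \<open>n\<close>.\<close>

definition core_radius :: "nat \<Rightarrow> nat" where
  "core_radius n = nat \<lceil>(ln (real n))\<^sup>2\<rceil>"

lemma core_radius_bounds:
  "(ln (real n))\<^sup>2 \<le> real (core_radius n)" "real (core_radius n) < (ln (real n))\<^sup>2 + 1"
proof -
  have "real (core_radius n) = of_int \<lceil>(ln (real n))\<^sup>2\<rceil>"
    unfolding core_radius_def by (rule of_nat_nat) (simp add: order_less_le_trans[OF _ zero_le_power2])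
  then show "(ln (real n))\<^sup>2 \<le> real (core_radius n)" "real (core_radius n) < (ln (real n))\<^sup>2 + 1"
    by linarith+
qed

lemma eventually_large_puzzle:
  fixes q :: "nat \<Rightarrow> nat" and \<iota> :: "nat \<Rightarrow> nat \<Rightarrow> nat" and \<epsilon> :: real
  assumes puzzle: "\<And>n. puzzle (q n) (\<iota> n)" and \<epsilon>: "\<epsilon> > 0"
    and q: "\<forall>\<^sub>F n in sequentially. real (q n) \<ge> (2 + \<epsilon>) * real n"
  shows "\<forall>\<^sub>F n in sequentially. \<exists>q0 \<tau>. real n \<le> q0 \<and>
    large_puzzle n (q n) (\<iota> n) (core_radius n) q0 (1 / 100000000) \<tau>"
proof -
  \<comment> \<open>With \<open>\<tau> = \<theta> / ln q0\<close> this gives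
    \<open>q0 powr (1 - \<tau> / 2) = q0 / (1 + \<epsilon> / 2)\<close>, which is exactly
    \<open>2 * n\<close> for \<open>q0 = (2 + \<epsilon>) * n\<close>.\<close>
  define \<theta> where "\<theta> = 2 * ln (1 + \<epsilon> / 2)"
  have \<theta>: "\<theta> > 0" using \<epsilon> by (simp add: \<theta>_def ln_gt_zero)
  have "\<forall>\<^sub>F n in sequentially. real n \<ge> 2 + \<epsilon>" by real_asymp
  moreover have "\<forall>\<^sub>F n in sequentially. ln (real n) \<ge> 3 * 1000000 / \<theta>" using \<theta> by real_asymp
  moreover have "\<forall>\<^sub>F n in sequentially. 2 * ((ln (real n))\<^sup>2 + 1) + 1 < real n" by real_asymp
  moreover have "\<forall>\<^sub>F n in sequentially. 100000000 \<le> 2 * (ln (real n))\<^sup>2 + 1" by real_asymp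
  moreover have "\<forall>\<^sub>F n in sequentially. 2 * (16 * ((2 * ((ln (real n))\<^sup>2 + 1) + 1)\<^sup>2)\<^sup>2 + 1) ^ 4 \<le> real n powr (1 / 100000000)"
    by real_asymp
  ultimately show ?thesis using q
  proof eventually_elim
    case (elim n)
    let ?J = "core_radius n"
    let ?q0 = "(2 + \<epsilon>) * real n"
    let ?\<tau> = "\<theta> / ln ?q0"
    have n: "real n \<ge> 2" "real n \<le> ?q0" using elim(1) \<epsilon> by (auto intro: order_trans[of _ "2 * real n"])
    have lnq: "ln ?q0 = ln (2 + \<epsilon>) + ln (real n)" using n \<epsilon> by (simp add: ln_mult)
    have "ln (2 + \<epsilon>) \<le> ln (real n)" using elim(1) \<epsilon> by simp
    then have lnq2: "ln ?q0 \<le> 2 * ln (real n)" "ln ?q0 > 0" using lnq n \<epsilon> by (auto intro: add_pos_nonneg)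
    have J: "2 * real ?J + 1 < 2 * ((ln (real n))\<^sup>2 + 1) + 1" "2 * (ln (real n))\<^sup>2 + 1 \<le> 2 * real ?J + 1"
      using core_radius_bounds[of n] by auto
    have J': "real (2 * ?J + 1) = 2 * real ?J + 1" by simp
    interpret puzzle n "q n" "\<iota> n" by (rule puzzle)
    have "large_puzzle n (q n) (\<iota> n) ?J ?q0 (1 / 100000000) ?\<tau>"
    proof unfold_locales
      show "1 < ?q0" using n by linarith
      show "?q0 \<le> real (q n)" using elim by simp
      have "?q0 powr (1 - ?\<tau> / 2) = exp ((1 - ?\<tau> / 2) * ln ?q0)" using n by (simp add: powr_def)
      also have "(1 - ?\<tau> / 2) * ln ?q0 = ln ?q0 - ln (1 + \<epsilon> / 2)" using lnq2(2) by (simp add: field_simps \<theta>_def)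
      also have "exp (ln ?q0 - ln (1 + \<epsilon> / 2)) = ?q0 / (1 + \<epsilon> / 2)" using n \<epsilon> by (simp add: exp_diff)
      also have "\<dots> = 2 * real n" using \<epsilon> by (simp add: field_simps)
      finally show "2 * real n \<le> ?q0 powr (1 - ?\<tau> / 2)" by simp
      have "real (2 * ?J + 1) < real n" using J elim(3) by linarith
      then show "2 * ?J + 1 < n" by (simp only: of_nat_less_iff)
      have "real 100000000 \<le> real (2 * ?J + 1)" using J elim(4) by simp
      then show "100000000 \<le> 2 * ?J + 1" by (simp only: of_nat_le_iff)
      show "0 \<le> ?\<tau>" using \<theta> lnq2 by simp
      have "3 * 1000000 \<le> \<theta> * ln (real n)" using elim(2) \<theta> by (simp add: field_simps)
      have "3 * 1000000 * ln ?q0 \<le> 3 * 1000000 * (2 * ln (real n))" using lnq2(1) by (intro mult_left_mono) auto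
      also have "\<dots> \<le> \<theta> * ln (real n) * (2 * ln (real n))"
        using \<open>3 * 1000000 \<le> \<theta> * ln (real n)\<close> n by (intro mult_right_mono) auto
      also have "\<dots> = \<theta> * (2 * (ln (real n))\<^sup>2)" by (simp add: power2_eq_square)
      also have "\<dots> \<le> \<theta> * real (2 * ?J + 1)" using J \<theta> by (intro mult_left_mono) auto
      finally show "3 * 1000000 \<le> ?\<tau> * real (2 * ?J + 1)" using lnq2(2) by (simp only: times_divide_eq_left pos_le_divide_eq)
      have "2 * (16 * real (((2 * ?J + 1)\<^sup>2)\<^sup>2) + 1) ^ 4 = 2 * (16 * ((2 * real ?J + 1)\<^sup>2)\<^sup>2 + 1) ^ 4" by (simp only: of_nat_power J')
      also have "\<dots> \<le> 2 * (16 * ((2 * ((ln (real n))\<^sup>2 + 1) + 1)\<^sup>2)\<^sup>2 + 1) ^ 4"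
        using J by (intro mult_left_mono power_mono add_right_mono) auto
      also have "\<dots> \<le> real n powr (1 / 100000000)" by (rule elim(5))
      also have "\<dots> \<le> ?q0 powr (1 / 100000000)" using n by (intro powr_mono2) auto
      finally show "2 * (16 * real (((2 * ?J + 1)\<^sup>2)\<^sup>2) + 1) ^ 4 \<le> ?q0 powr (1 / 100000000)" .
    qed auto
    then show ?case using n(2) by blast
  qed
qed

lemma prob_tendsto_1:
  fixes p :: "nat \<Rightarrow> 'a pmf"
  assumes "\<forall>\<^sub>F n in sequentially. 1 - c n \<le> measure_pmf.prob (p n) (A n)" and "c \<longlonglongrightarrow> (0::real)"
  shows "(\<lambda>n. measure_pmf.prob (p n) (A n)) \<longlonglongrightarrow> 1"
proof (rule tendsto_sandwich)
  show "(\<lambda>n. 1 - c n) \<longlonglongrightarrow> 1" using tendsto_diff[OF tendsto_const assms(2), of 1] by simp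
  show "\<forall>\<^sub>F n in sequentially. measure_pmf.prob (p n) (A n) \<le> 1" by simp
qed (use assms in simp_all)

lemma prob_all_similar_tendsto_1:
  fixes q :: "nat \<Rightarrow> nat" and \<iota> :: "nat \<Rightarrow> nat \<Rightarrow> nat" and \<epsilon> :: real
  assumes "\<And>n. puzzle (q n) (\<iota> n)" and "\<epsilon> > 0"
    and "\<forall>\<^sub>F n in sequentially. real (q n) \<ge> (2 + \<epsilon>) * real n"
  shows "(\<lambda>n. measure_pmf.prob (random_puzzle n (q n) (\<iota> n)) {\<omega>. all_solutions_similar n (\<iota> n) \<omega>}) \<longlonglongrightarrow> 1"
proof (rule prob_tendsto_1)
  show "(\<lambda>n. 8 * real n powr (- 1 / 100)) \<longlonglongrightarrow> 0" by real_asymp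
  show "\<forall>\<^sub>F n in sequentially. 1 - 8 * real n powr (- 1 / 100)
    \<le> measure_pmf.prob (random_puzzle n (q n) (\<iota> n)) {\<omega>. all_solutions_similar n (\<iota> n) \<omega>}"
    using eventually_large_puzzle[OF assms] eventually_gt_at_top[of 0]
  proof eventually_elim
    case (elim n)
    then obtain q0 \<tau> where q0_ge: "real n \<le> q0"
      and "large_puzzle n (q n) (\<iota> n) (core_radius n) q0 (1 / 100000000) \<tau>" by blast
    then interpret large_puzzle n "q n" "\<iota> n" "core_radius n" q0 "1 / 100000000" \<tau> by simp
    have "8 * q0 powr (- 1 / 100) \<le> 8 * real n powr (- 1 / 100)"
      using q0_ge elim(2) by (intro mult_left_mono powr_mono2') auto
    moreover have "1 - 8 * q0 powr (- 1 / 100)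
        \<le> measure_pmf.prob (random_puzzle n (q n) (\<iota> n)) {\<omega>. all_solutions_similar n (\<iota> n) \<omega>}"
      by (rule prob_ge[OF failures_subset all_similar card_failures])
    ultimately show ?case by linarith
  qed
qed

lemma prob_unique_tendsto_1:
  fixes q :: "nat \<Rightarrow> nat" and \<iota> :: "nat \<Rightarrow> nat \<Rightarrow> nat"
  assumes "\<And>n. puzzle (q n) (\<iota> n)"
    and lim: "filterlim (\<lambda>n. real (q n) / real n) at_top sequentially"
  shows "(\<lambda>n. measure_pmf.prob (random_puzzle n (q n) (\<iota> n)) {\<omega>. unique_up_to_rotation n (\<iota> n) \<omega>}) \<longlonglongrightarrow> 1"
proof (rule prob_tendsto_1)
  let ?c = "\<lambda>n. 8 * real n powr (- 1 / 100) + (4 * (real (q n) / real n) powr (- 4) + 17 * (real (q n) / real n) powr (- 2))"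
  have "(\<lambda>n. (real (q n) / real n) powr (- 4)) \<longlonglongrightarrow> 0" "(\<lambda>n. (real (q n) / real n) powr (- 2)) \<longlonglongrightarrow> 0"
    by (rule tendsto_neg_powr[OF _ lim], simp)+
  then have "(\<lambda>n. 4 * (real (q n) / real n) powr (- 4) + 17 * (real (q n) / real n) powr (- 2)) \<longlonglongrightarrow> 0"
    by (intro tendsto_add_zero tendsto_mult_right_zero)
  moreover have "(\<lambda>n. 8 * real n powr (- 1 / 100)) \<longlonglongrightarrow> 0" by real_asymp
  ultimately show "?c \<longlonglongrightarrow> 0" using tendsto_add_zero by blast
  have "\<forall>\<^sub>F n in sequentially. real (q n) \<ge> (2 + 1) * real n"
    using filterlim_at_top_dense[THEN iffD1, OF lim, rule_format, of 3] eventually_gt_at_top[of 0]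
    by eventually_elim (simp add: field_simps)
  from eventually_large_puzzle[OF assms(1) zero_less_one this]
  show "\<forall>\<^sub>F n in sequentially. 1 - ?c n
    \<le> measure_pmf.prob (random_puzzle n (q n) (\<iota> n)) {\<omega>. unique_up_to_rotation n (\<iota> n) \<omega>}"
    using eventually_gt_at_top[of 0]
  proof eventually_elim
    case (elim n)
    then obtain q0 \<tau> where q0_ge: "real n \<le> q0"
      and "large_puzzle n (q n) (\<iota> n) (core_radius n) q0 (1 / 100000000) \<tau>" by blast
    then interpret large_puzzle n "q n" "\<iota> n" "core_radius n" q0 "1 / 100000000" \<tau> by simp
    have e: "8 * q0 powr (- 1 / 100) \<le> 8 * real n powr (- 1 / 100)"
      using q0_ge elim(2) by (intro mult_left_mono powr_mono2') auto
    have p: "real n ^ 4 * real (q n) powr (- 4) = (real (q n) / real n) powr (- 4)"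
      "real n ^ 2 * real (q n) powr (- 2) = (real (q n) / real n) powr (- 2)"
      using elim(2) q_pos by (simp_all add: powr_divide powr_minus powr_numeral field_simps)
    have "real (card (failures \<union> repetitive)) \<le> real (card failures) + real (card repetitive)"
      using of_nat_mono[OF card_Un_le[of failures repetitive]] by simp
    also have "\<dots> \<le> 8 * q0 powr (- 1 / 100) * real (card \<Omega>) +
        (4 * real n ^ 4 * real (q n) powr (- 4) + 17 * real n ^ 2 * real (q n) powr (- 2)) * real (card \<Omega>)"
      by (rule add_mono[OF card_failures card_repetitive])
    also have "\<dots> \<le> ?c n * real (card \<Omega>)"
      using mult_right_mono[OF e, of "real (card \<Omega>)"] unfolding p[symmetric] by (simp add: algebra_simps)
    finally have "real (card (failures \<union> repetitive)) \<le> ?c n * real (card \<Omega>)" .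
    moreover have "failures \<union> repetitive \<subseteq> \<Omega>"
      using failures_subset by (auto simp: repetitive_def coincide_def symmetric_at_def)
    ultimately show ?case by (intro prob_ge[OF _ unique_solution])
  qed
qed

section \<open>Few types of jigs\<close>

text \<open>A single term of the exponential series at \<open>m\<close>; it takes the place of
  Stirling's formula and is the source of the constant e in the threshold.\<close>

lemma power_le_exp_fact: "real m ^ m \<le> exp (real m) * fact m"
proof -
  have "(\<Sum>k\<in>{m}. real m ^ k /\<^sub>R fact k) \<le> (\<Sum>k. real m ^ k /\<^sub>R fact k)"
    using sums_summable[OF exp_converges[of "real m"]] by (intro sum_le_suminf) auto
  also have "\<dots> = exp (real m)" by (rule sums_unique[OF exp_converges, symmetric])
  finally show ?thesis by (simp add: field_simps)
qed

context puzzle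
begin

lemma card_carvings_ge: "q ^ (2 * n\<^sup>2 + 2 * n) \<le> card \<Omega>"
proof -
  \<comment> \<open>The sides that can be chosen freely: right and top of every cell, left in the
    first column, bottom in the first row. The other sides are forced by their neighbours.\<close>
  define D :: "(pos \<times> nat) set" where
    "D = (grid n \<times> {0, 1} \<union> ({0} \<times> {..<n}) \<times> {2}) \<union> ({..<n} \<times> {0}) \<times> {3}"
  define ext where "ext h = (\<lambda>p\<in>grid n. \<lambda>d\<in>{..<4}.
      if (p, d) \<in> D then h (p, d) else if d = 2 then \<iota> (h ((fst p - 1, snd p), 0)) else \<iota> (h ((fst p, snd p - 1), 1)))"
    for h :: "pos \<times> nat \<Rightarrow> nat"
  have cD: "card D = 2 * n\<^sup>2 + 2 * n"
  proof -
    have "card D = card (grid n \<times> {0::nat, 1}) + card (({0::nat} \<times> {..<n}) \<times> {2::nat}) + card (({..<n} \<times> {0::nat}) \<times> {3::nat})"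
      unfolding D_def by (subst card_Un_disjoint; (subst card_Un_disjoint)?) (auto simp: finite_grid)
    also have "\<dots> = 2 * n\<^sup>2 + 2 * n" by (simp add: card_cartesian_product grid_def power2_eq_square)
    finally show ?thesis .
  qed
  have finD: "finite D" by (simp add: D_def finite_grid)
  have Dg: "((i, j), 0) \<in> D" "((i, j), Suc 0) \<in> D" if "i < n" "j < n" for i j using that by (auto simp: D_def grid_def)
  have D23: "((i, j), 2) \<in> D \<longleftrightarrow> i = 0 \<and> j < n" "((i, j), 3) \<in> D \<longleftrightarrow> j = 0 \<and> i < n" for i j by (auto simp: D_def grid_def)
  have D4: "p \<in> grid n \<and> d < 4" if "(p, d) \<in> D" for p d using that by (auto simp: D_def grid_def)
  have restr: "ext h p d = h (p, d)" if "(p, d) \<in> D" for h p d using that D4[OF that] by (simp add: ext_def)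
  have "ext h \<in> \<Omega>" if h: "h \<in> D \<rightarrow>\<^sub>E {1..q}" for h
  proof -
    have hD: "h x \<in> {1..q}" if "x \<in> D" for x using h that by (rule PiE_mem)
    have "ext h p d \<in> {1..q}" if pd: "p \<in> grid n" "d < 4" for p d
    proof (cases "(p, d) \<in> D")
      case True
      then show ?thesis using hD restr by simp
    next
      case False
      obtain i j where p: "p = (i, j)" "i < n" "j < n" using pd by (auto simp: grid_def)
      have "((i - 1, j), 0) \<in> D" "((i, j - 1), 1) \<in> D" using p Dg by auto
      then have "\<iota> (h ((i - 1, j), 0)) \<in> {1..q}" "\<iota> (h ((i, j - 1), 1)) \<in> {1..q}" using hD \<iota>_in by blast+
      then show ?thesis using False pd p by (simp add: ext_def)
    qed
    then have "ext h \<in> grid n \<rightarrow>\<^sub>E ({..<4} \<rightarrow>\<^sub>E {1..q})"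
      by (intro PiE_I) (auto simp: ext_def)
    moreover have "fits_together n \<iota> (ext h)"
      unfolding fits_together_def by (auto simp: ext_def D23 Dg grid_def)
    ultimately show ?thesis by (simp add: carvings_def)
  qed
  moreover have "inj_on ext (D \<rightarrow>\<^sub>E {1..q})"
  proof (rule inj_onI)
    fix h h' assume h: "h \<in> D \<rightarrow>\<^sub>E {1..q}" "h' \<in> D \<rightarrow>\<^sub>E {1..q}" "ext h = ext h'"
    show "h = h'"
    proof (rule PiE_ext[OF h(1,2)])
      fix x assume "x \<in> D"
      then show "h x = h' x" using restr[of "fst x" "snd x" h] restr[of "fst x" "snd x" h'] h(3) by simp
    qed
  qed
  ultimately have "card (D \<rightarrow>\<^sub>E {1..q}) \<le> card \<Omega>"
    by (intro card_inj_on_le[of ext] finite_carvings) auto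
  then show ?thesis using finD by (simp add: card_funcsetE cD)
qed

abbreviation "pieces \<equiv> {..<4::nat} \<rightarrow>\<^sub>E {1..q}"

lemma finite_pieces: "finite pieces"
  by (intro finite_PiE) simp_all

lemma rotate_piece_0: "c \<in> pieces \<Longrightarrow> rotate_piece 0 c = c"
proof
  fix t assume c: "c \<in> pieces"
  show "rotate_piece 0 c t = c t"
    using PiE_arb[OF c, of t] by (cases "t < 4") (simp_all add: rotate_piece_def)
qed

lemma rotate_piece_in: "c \<in> pieces \<Longrightarrow> rotate_piece r c \<in> pieces"
proof -
  assume c: "c \<in> pieces"
  have "c ((d + 3 * r) mod 4) \<in> {1..q}" for d by (rule PiE_mem[OF c]) simp
  then show "rotate_piece r c \<in> pieces" unfolding rotate_piece_def restrict_PiE_iff by blast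
qed

lemma in_rotations: "c \<in> pieces \<Longrightarrow> c \<in> rotations c"
  unfolding rotations_def using rotate_piece_0[of c] by force

lemma card_symmetric_pieces: "card {c \<in> pieces. rotate_piece 2 c = c} \<le> q\<^sup>2"
proof -
  let ?S = "{c \<in> pieces. rotate_piece 2 c = c}"
  have "inj_on (\<lambda>c. (c 0, c 1)) ?S"
  proof (rule inj_onI)
    fix c c' assume c: "c \<in> ?S" "c' \<in> ?S" "(c 0, c 1) = (c' 0, c' 1)"
    have per: "x 2 = x 0" "x 3 = x 1" if "x \<in> ?S" for x :: piece
    proof -
      have "rotate_piece 2 x 2 = x 2" "rotate_piece 2 x 3 = x 3" using that by simp_all
      then show "x 2 = x 0" "x 3 = x 1" by (simp_all add: rotate_piece_def)
    qed
    show "c = c'"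
    proof (rule PiE_ext[of _ "{..<4::nat}" "\<lambda>_. {1..q}"])
      fix t :: nat assume "t \<in> {..<4}"
      then have "t < 4" by simp
      then show "c t = c' t" by (cases rule: less_4_cases) (use per[OF c(1)] per[OF c(2)] c(3) in auto)
    qed (use c in auto)
  qed
  moreover have "(\<lambda>c. (c 0, c 1)) ` ?S \<subseteq> {1..q} \<times> {1..q}"
  proof
    fix z assume "z \<in> (\<lambda>c. (c 0, c 1)) ` ?S"
    then obtain c where c: "c \<in> pieces" "z = (c 0, c 1)" by blast
    have "c 0 \<in> {1..q}" "c 1 \<in> {1..q}" by (rule PiE_mem[OF c(1)], simp)+
    then show "z \<in> {1..q} \<times> {1..q}" using c(2) by blast
  qed
  ultimately have "card ?S \<le> card ({1..q} \<times> {1..q})" by (intro card_inj_on_le) auto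
  then show ?thesis by (simp add: card_cartesian_product power2_eq_square)
qed

text \<open>A nontrivial rotation that fixes \<open>c\<close> is the half turn or becomes the half
  turn when doubled.\<close>

lemma rotate_piece_cancel:
  assumes c: "c \<in> pieces" and r: "r < 4" "s < 4" and eq: "rotate_piece r c = rotate_piece s c"
    and asym: "rotate_piece 2 c \<noteq> c"
  shows "r = s"
proof (rule ccontr)
  assume "r \<noteq> s"
  let ?t = "(r + 3 * s) mod 4"
  have "rotate_piece (3 * s) (rotate_piece r c) = rotate_piece (3 * s) (rotate_piece s c)" using eq by simp
  then have "rotate_piece (r + 3 * s) c = rotate_piece (4 * s) c"
    by (simp add: rotate_piece_rotate_piece add.commute)
  moreover have "rotate_piece (4 * s) c = c" using rotate_piece_mod[of "4 * s" c] rotate_piece_0[OF c] by simp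
  ultimately have t: "rotate_piece ?t c = c" using rotate_piece_mod[of "r + 3 * s" c] by simp
  have "?t \<noteq> 0" using r(1)
    by (cases rule: less_4_cases) (use r(2) \<open>r \<noteq> s\<close> in \<open>cases rule: less_4_cases; simp\<close>)+
  have "rotate_piece (?t + ?t) c = c" using t rotate_piece_rotate_piece[of ?t ?t c] by simp
  then have tt: "rotate_piece ((?t + ?t) mod 4) c = c" by (simp add: rotate_piece_mod)
  have "?t < 4" by simp
  then have "?t = 2 \<or> (?t + ?t) mod 4 = 2" using \<open>?t \<noteq> 0\<close> by (cases rule: less_4_cases) simp_all
  then show False using t tt asym by metis
qed

text \<open>Pieces without half-turn symmetry have four distinct rotations, so their classes number
  at most a quarter of all pieces. The symmetric ones are at most \<open>q\<^sup>2\<close>, too few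
  for a saving to matter.\<close>

lemma card_piece_classes: "real (card (rotations ` pieces)) \<le> real q ^ 4 / 4 + (real q)\<^sup>2"
proof -
  let ?S = "{c \<in> pieces. rotate_piece 2 c = c}" and ?F = "{c \<in> pieces. rotate_piece 2 c \<noteq> c}"
  define rep where "rep \<kappa> = (SOME c. c \<in> ?F \<and> rotations c = \<kappa>)" for \<kappa>
  have rep: "rep \<kappa> \<in> ?F" "rotations (rep \<kappa>) = \<kappa>" if "\<kappa> \<in> rotations ` ?F" for \<kappa>
  proof -
    have "\<exists>c. c \<in> ?F \<and> rotations c = \<kappa>" using that by blast
    then have "rep \<kappa> \<in> ?F \<and> rotations (rep \<kappa>) = \<kappa>" unfolding rep_def by (rule someI_ex)
    then show "rep \<kappa> \<in> ?F" "rotations (rep \<kappa>) = \<kappa>" by blast+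
  qed
  have "inj_on (\<lambda>(\<kappa>, r). rotate_piece r (rep \<kappa>)) (rotations ` ?F \<times> {..<4})"
  proof (rule inj_onI)
    fix x y assume x: "x \<in> rotations ` ?F \<times> {..<4}" and y: "y \<in> rotations ` ?F \<times> {..<4}"
      and e: "(\<lambda>(\<kappa>, r). rotate_piece r (rep \<kappa>)) x = (\<lambda>(\<kappa>, r). rotate_piece r (rep \<kappa>)) y"
    have xy: "fst x \<in> rotations ` ?F" "snd x < 4" "fst y \<in> rotations ` ?F" "snd y < 4"
      using x y unfolding mem_Times_iff by (simp_all only: lessThan_iff)
    have e': "rotate_piece (snd x) (rep (fst x)) = rotate_piece (snd y) (rep (fst y))" using e by (simp add: split_beta)
    then have "rotations (rep (fst x)) = rotations (rep (fst y))" by (metis rotations_rotate_piece)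
    then have f: "fst x = fst y" by (simp only: rep(2)[OF xy(1)] rep(2)[OF xy(3)])
    have "snd x = snd y"
    proof (rule rotate_piece_cancel)
      show "rep (fst x) \<in> pieces" "rotate_piece 2 (rep (fst x)) \<noteq> rep (fst x)" using rep(1)[OF xy(1)] by blast+
      show "rotate_piece (snd x) (rep (fst x)) = rotate_piece (snd y) (rep (fst x))" using e' f by simp
    qed (rule xy)+
    then show "x = y" using f by (simp add: prod_eq_iff)
  qed
  moreover have "(\<lambda>(\<kappa>, r). rotate_piece r (rep \<kappa>)) ` (rotations ` ?F \<times> {..<4}) \<subseteq> pieces"
  proof (rule image_subsetI)
    fix z :: "piece set \<times> nat" assume "z \<in> rotations ` ?F \<times> {..<4}"
    then have "rep (fst z) \<in> pieces" using rep(1)[of "fst z"] unfolding mem_Times_iff mem_Collect_eq by (elim conjE) simp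
    then show "(\<lambda>(\<kappa>, r). rotate_piece r (rep \<kappa>)) z \<in> pieces" unfolding split_beta by (rule rotate_piece_in)
  qed
  ultimately have "card (rotations ` ?F \<times> {..<4::nat}) \<le> card pieces" using finite_pieces by (intro card_inj_on_le)
  then have "4 * card (rotations ` ?F) \<le> q ^ 4" by (simp add: card_cartesian_product card_funcsetE mult.commute)
  then have "real (4 * card (rotations ` ?F)) \<le> real (q ^ 4)" by (rule of_nat_mono)
  then have 1: "real (card (rotations ` ?F)) \<le> real q ^ 4 / 4" by simp
  have "card (rotations ` ?S) \<le> q\<^sup>2"
    using card_image_le[of ?S rotations] card_symmetric_pieces finite_pieces by simp
  then have "real (card (rotations ` ?S)) \<le> real (q\<^sup>2)" by (rule of_nat_mono)
  then have 2: "real (card (rotations ` ?S)) \<le> (real q)\<^sup>2" by simp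
  have "rotations ` pieces = rotations ` ?F \<union> rotations ` ?S"
    unfolding image_Un[symmetric] by (rule arg_cong[where f = "image rotations"]) blast
  then have "card (rotations ` pieces) \<le> card (rotations ` ?F) + card (rotations ` ?S)"
    by (simp only: card_Un_le)
  then have "real (card (rotations ` pieces)) \<le> real (card (rotations ` ?F) + card (rotations ` ?S))" by (rule of_nat_mono)
  then show ?thesis using 1 2 unfolding of_nat_add by linarith
qed

definition piece_multiset :: "carving \<Rightarrow> piece set multiset" where
  "piece_multiset \<omega> = image_mset (\<lambda>p. rotations (\<omega> p)) (mset_set (grid n))"

lemma piece_multiset_in:
  assumes "\<omega> \<in> \<Omega>" shows "piece_multiset \<omega> \<in> multisets_of_size (rotations ` pieces) (n\<^sup>2)"
proof -
  have "\<omega> p \<in> pieces" if "p \<in> grid n" for p using assms that by (auto simp: carvings_iff)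
  then have "set_mset (piece_multiset \<omega>) \<subseteq> rotations ` pieces"
    unfolding piece_multiset_def using finite_grid by auto
  moreover have "size (piece_multiset \<omega>) = n\<^sup>2"
    unfolding piece_multiset_def by (simp add: grid_def card_cartesian_product power2_eq_square)
  ultimately show ?thesis by (simp add: multisets_of_size_def)
qed

text \<open>Each piece of \<open>\<omega>\<close> can be sent to a position of
  \<open>\<omega>'\<close> with the same rotation class and turned to fit. The rearrangement shows
  \<open>\<omega>'\<close>, which is a carving, so it is a solution.\<close>

lemma solution_with_same_pieces:
  assumes \<omega>: "\<omega> \<in> \<Omega>" "\<omega>' \<in> \<Omega>" and eq: "piece_multiset \<omega> = piece_multiset \<omega>'"
  obtains S where "S \<in> solutions n \<iota> \<omega>" "induced_carving n \<omega> S = \<omega>'"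
proof -
  have cnt: "count (piece_multiset w) \<kappa> = card {p \<in> grid n. rotations (w p) = \<kappa>}" for w \<kappa>
    unfolding piece_multiset_def using finite_grid by (simp add: count_image_mset_eq_card_vimage)
  have "card {p \<in> grid n. rotations (\<omega> p) = \<kappa>} = card {p \<in> grid n. rotations (\<omega>' p) = \<kappa>}" for \<kappa>
    using cnt eq by metis
  from matching_exists[OF finite_grid finite_grid this]
  obtain h where h: "bij_betw h (grid n) (grid n)" "\<And>p. p \<in> grid n \<Longrightarrow> rotations (\<omega>' (h p)) = rotations (\<omega> p)" by metis
  have hg: "h p \<in> grid n" if "p \<in> grid n" for p using bij_betwE[OF h(1)] that by blast
  have "\<exists>r<4. \<omega>' (h p) = rotate_piece r (\<omega> p)" if "p \<in> grid n" for p
  proof -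
    have "\<omega>' (h p) \<in> pieces" using \<omega>(2) hg[OF that] by (auto simp: carvings_iff)
    then have "\<omega>' (h p) \<in> rotations (\<omega> p)" using in_rotations h(2)[OF that] by metis
    then show ?thesis unfolding rotations_def by blast
  qed
  then obtain r where r: "\<And>p. p \<in> grid n \<Longrightarrow> r p < 4 \<and> \<omega>' (h p) = rotate_piece (r p) (\<omega> p)" by metis
  define S where "S = (restrict h (grid n), restrict r (grid n))"
  have S: "S \<in> placements n" using h(1) r by (auto simp: S_def placements_def cong: bij_betw_cong)
  have ind: "induced_carving n \<omega> S = \<omega>'"
  proof
    fix p show "induced_carving n \<omega> S p = \<omega>' p"
    proof (cases "p \<in> grid n")
      case True
      then obtain c where c: "c \<in> grid n" "p = h c" using bij_betw_imp_surj_on[OF h(1)] by blast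
      then show ?thesis
        using induced_carving_at[of "restrict h (grid n)" "restrict r (grid n)" n c \<omega>] S r[of c] by (simp add: S_def)
    next
      case False
      have "\<omega>' \<in> grid n \<rightarrow>\<^sub>E pieces" using \<omega>(2) by (simp add: carvings_def)
      then have "\<omega>' p = undefined" using False by (rule PiE_arb)
      then show ?thesis using False by (simp add: induced_carving_undefined)
    qed
  qed
  moreover have "S \<in> solutions n \<iota> \<omega>" using S ind \<omega>(2) by (simp add: solutions_def carvings_def)
  ultimately show thesis using that by blast
qed

lemma same_pieces_rotation:
  assumes \<omega>: "\<omega> \<in> \<Omega>" "\<omega>' \<in> \<Omega>" and eq: "piece_multiset \<omega> = piece_multiset \<omega>'"
    and similar: "\<not> two_nonsimilar_solutions n \<iota> \<omega>"
  shows "\<omega>' \<in> (\<lambda>k. rotate_carving n k \<omega>) ` {..<4}"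
proof -
  obtain S where S: "S \<in> solutions n \<iota> \<omega>" "induced_carving n \<omega> S = \<omega>'"
    using solution_with_same_pieces[OF \<omega> eq] .
  obtain T where T: "T \<in> solutions n \<iota> \<omega>" "induced_carving n \<omega> T = \<omega>"
    using solution_with_same_pieces[OF \<omega>(1) \<omega>(1) refl] .
  have "similar n \<omega> T S" using similar S T by (auto simp: two_nonsimilar_solutions_def)
  then show ?thesis unfolding similar_def S T by blast
qed

text \<open>If all solutions of \<open>\<omega>\<close> are similar, every carving with the same
  multiset of rotation classes is one of the four rotations of \<open>\<omega>\<close>; so each
  multiset accounts for at most four such carvings.\<close>

lemma card_all_similar:
  "card {\<omega> \<in> \<Omega>. \<not> two_nonsimilar_solutions n \<iota> \<omega>} \<le> 4 * (card (rotations ` pieces) + n\<^sup>2 - 1 choose n\<^sup>2)"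
proof -
  let ?B = "{\<omega> \<in> \<Omega>. \<not> two_nonsimilar_solutions n \<iota> \<omega>}"
  let ?M = "multisets_of_size (rotations ` pieces) (n\<^sup>2)"
  have finM: "finite ?M" using finite_pieces by (intro finite_multisets_of_size) simp
  have "card {\<omega> \<in> ?B. piece_multiset \<omega> = X} \<le> 4" for X
  proof (cases "{\<omega> \<in> ?B. piece_multiset \<omega> = X} = {}")
    case False
    then obtain \<omega> where \<omega>: "\<omega> \<in> ?B" "piece_multiset \<omega> = X" by blast
    have "{\<omega> \<in> ?B. piece_multiset \<omega> = X} \<subseteq> (\<lambda>k. rotate_carving n k \<omega>) ` {..<4}"
      using \<omega> same_pieces_rotation[of \<omega>] by blast
    then have "card {\<omega> \<in> ?B. piece_multiset \<omega> = X} \<le> card {..<4::nat}" by (intro surj_card_le) auto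
    then show ?thesis by simp
  next
    case True
    then show ?thesis by (simp only: card.empty)
  qed
  then have "card (\<Union>X\<in>?M. {\<omega> \<in> ?B. piece_multiset \<omega> = X}) \<le> (\<Sum>X\<in>?M. 4)"
    by (intro order_trans[OF card_UN_le[OF finM]] sum_mono)
  moreover have "?B = (\<Union>X\<in>?M. {\<omega> \<in> ?B. piece_multiset \<omega> = X})" using piece_multiset_in by blast
  moreover have "card ?M = (card (rotations ` pieces) + n\<^sup>2 - 1 choose n\<^sup>2)"
    using finite_pieces by (intro card_multisets_of_size) simp
  ultimately show ?thesis by simp
qed

text \<open>Up to the threshold the number of multisets is at most a constant times
  \<open>x ^ m = q^(2 n^2)\<close>. The symmetric pieces and the term \<open>real m\<close> in the
  base change it by a factor \<open>1 + O(1 / m)\<close> only, whose \<open>m\<close>-th power is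
  bounded.\<close>

lemma card_all_similar_le:
  assumes n: "n > 0" and q: "2 \<le> q" "real q \<le> 2 / sqrt (exp 1) * real n"
  shows "real (card {\<omega> \<in> \<Omega>. \<not> two_nonsimilar_solutions n \<iota> \<omega>})
    \<le> 4 * exp (exp 1 + (exp 1)\<^sup>2 / 4) * (1 / 4) ^ n * real (card \<Omega>)"
proof -
  let ?e = "exp 1 :: real" and ?N = "card (rotations ` pieces)"
  define m where "m = n\<^sup>2"
  define x where "x = (real q)\<^sup>2"
  define M where "M = ?N + m - 1"
  have m: "real m > 0" using n by (simp add: m_def)
  have "(real q)\<^sup>2 \<le> (2 / sqrt ?e * real n)\<^sup>2" using q(2) by (intro power_mono) auto
  also have "\<dots> = 4 / ?e * real m" by (simp add: m_def power_mult_distrib power_divide)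
  finally have x1: "?e * x \<le> 4 * real m" by (simp add: x_def field_simps)
  have "(2::real)\<^sup>2 \<le> (real q)\<^sup>2" using q(1) by (intro power_mono) auto
  then have x4: "x \<ge> 4" by (simp add: x_def)
  \<comment> \<open>The leading term of the base divided by its permitted value
    \<open>m * x\<close>; the assumption on \<open>q\<close> says exactly
    \<open>u \<le> 1\<close>.\<close>
  define u where "u = ?e * x / (4 * real m)"
  define a where "a = ?e\<^sup>2 / (4 * real m)"
  have u: "0 < u" "u \<le> 1" using x1 x4 m by (auto simp: u_def field_simps)
  have "?e \<le> 4" using exp_le by linarith
  then have "?e * ?e \<le> ?e * x" using x4 by (intro mult_left_mono) auto
  then have au: "a \<le> u" using m by (simp add: a_def u_def power2_eq_square divide_right_mono)
  have base: "?e * (real ?N + real m) \<le> real m * x * (1 + (?e + ?e\<^sup>2 / 4) / real m)"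
  proof -
    have "real ?N \<le> x\<^sup>2 / 4 + x" using card_piece_classes by (simp add: x_def power_mult[symmetric])
    then have "?e * (real ?N + real m) \<le> ?e * (x\<^sup>2 / 4 + x + real m)" by simp
    also have "\<dots> = real m * x * (u + a / u + ?e / real m)"
      using m x4 by (simp add: u_def a_def field_simps power2_eq_square)
    \<comment> \<open>The left side is convex in \<open>u\<close> and equals \<open>1 + a\<close> at
      both ends of the interval from \<open>a\<close> to 1.\<close>
    also have "u + a / u \<le> 1 + a"
    proof -
      have "(1 - u) * (1 - a / u) \<ge> 0" using u au by (intro mult_nonneg_nonneg) (auto simp: field_simps)
      then show ?thesis using u by (simp add: field_simps)
    qed
    then have "real m * x * (u + a / u + ?e / real m) \<le> real m * x * (1 + a + ?e / real m)"
      using m x4 by (intro mult_left_mono) auto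
    also have "1 + a + ?e / real m = 1 + (?e + ?e\<^sup>2 / 4) / real m" by (simp add: a_def add_divide_distrib)
    finally show ?thesis .
  qed
  have "real (M choose m) * real m ^ m \<le> real (M choose m) * (exp (real m) * fact m)"
    by (intro mult_left_mono power_le_exp_fact) simp
  also have "\<dots> = exp (real m) * real ((M choose m) * fact m)" by simp
  also have "\<dots> \<le> exp (real m) * real (M ^ m)" using binomial_fact_pow[of M m] by (intro mult_left_mono of_nat_mono) auto
  also have "\<dots> \<le> exp (real m) * (real ?N + real m) ^ m"
    unfolding of_nat_power by (intro mult_left_mono power_mono) (auto simp: M_def)
  also have "\<dots> = (?e * (real ?N + real m)) ^ m" by (simp add: power_mult_distrib exp_of_nat_mult[symmetric])
  also have "\<dots> \<le> (real m * x * (1 + (?e + ?e\<^sup>2 / 4) / real m)) ^ m" by (intro power_mono base) simp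
  also have "\<dots> \<le> (real m * x * exp ((?e + ?e\<^sup>2 / 4) / real m)) ^ m"
    using m x4 by (intro power_mono mult_left_mono exp_ge_add_one_self) auto
  also have "\<dots> = real m ^ m * (x ^ m * exp (?e + ?e\<^sup>2 / 4))"
    using m by (simp add: power_mult_distrib exp_of_nat_mult[symmetric])
  finally have bin: "real (M choose m) \<le> x ^ m * exp (?e + ?e\<^sup>2 / 4)" using m by (simp add: mult.commute)
  \<comment> \<open>The surplus of the carvings over \<open>x ^ m\<close> is
    \<open>x ^ n = q^(2 n)\<close>, at least \<open>4 ^ n\<close> because
    \<open>q \<ge> 2\<close>.\<close>
  have "x ^ m * 4 ^ n \<le> x ^ m * x ^ n" using x4 by (intro mult_left_mono power_mono) auto
  also have "\<dots> = real (q ^ (2 * n\<^sup>2 + 2 * n))" by (simp add: x_def m_def power_add power_mult)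
  also have "\<dots> \<le> real (card \<Omega>)" by (rule of_nat_mono[OF card_carvings_ge])
  finally have "x ^ m \<le> (1 / 4) ^ n * real (card \<Omega>)" by (simp add: power_divide field_simps)
  then have "x ^ m * exp (?e + ?e\<^sup>2 / 4) \<le> (1 / 4) ^ n * real (card \<Omega>) * exp (?e + ?e\<^sup>2 / 4)" by (intro mult_right_mono) auto
  from order_trans[OF bin this] have "real (M choose m) \<le> exp (?e + ?e\<^sup>2 / 4) * (1 / 4) ^ n * real (card \<Omega>)"
    by (simp only: mult_ac)
  moreover have "real (card {\<omega> \<in> \<Omega>. \<not> two_nonsimilar_solutions n \<iota> \<omega>}) \<le> real (4 * (M choose m))"
    using card_all_similar by (intro of_nat_mono) (simp add: M_def m_def)
  ultimately show ?thesis by simp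
qed

end

lemma prob_two_nonsimilar_tendsto_1:
  fixes q :: "nat \<Rightarrow> nat" and \<iota> :: "nat \<Rightarrow> nat \<Rightarrow> nat"
  assumes puzzle: "\<And>n. puzzle (q n) (\<iota> n)"
    and q: "\<forall>\<^sub>F n in sequentially. 2 \<le> q n \<and> real (q n) \<le> 2 / sqrt (exp 1) * real n"
  shows "(\<lambda>n. measure_pmf.prob (random_puzzle n (q n) (\<iota> n)) {\<omega>. two_nonsimilar_solutions n (\<iota> n) \<omega>}) \<longlonglongrightarrow> 1"
proof (rule prob_tendsto_1)
  let ?c = "\<lambda>n. 4 * exp (exp 1 + (exp 1)\<^sup>2 / 4) * (1 / 4) ^ n :: real"
  show "?c \<longlonglongrightarrow> 0" by (intro tendsto_mult_right_zero LIMSEQ_power_zero) simp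
  show "\<forall>\<^sub>F n in sequentially. 1 - ?c n
    \<le> measure_pmf.prob (random_puzzle n (q n) (\<iota> n)) {\<omega>. two_nonsimilar_solutions n (\<iota> n) \<omega>}"
    using q eventually_gt_at_top[of 0]
  proof eventually_elim
    case (elim n)
    interpret puzzle n "q n" "\<iota> n" by (rule puzzle)
    show ?case using elim by (intro prob_ge[OF _ _ card_all_similar_le]) auto
  qed
qed

theorem theorem1p1:
  fixes q :: "nat \<Rightarrow> nat" and \<iota> :: "nat \<Rightarrow> nat \<Rightarrow> nat"
  assumes "\<And>n. q n \<ge> 1"
    and "\<And>n. \<iota> n \<in> {1..q n} \<rightarrow> {1..q n}"
    and "\<And>n t. t \<in> {1..q n} \<Longrightarrow> \<iota> n (\<iota> n t) = t"
  shows "((\<forall>\<^sub>F n in sequentially. 2 \<le> q n \<and> real (q n) \<le> 2 / sqrt (exp 1) * real n) \<longrightarrow>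
            (\<lambda>n. measure_pmf.prob (random_puzzle n (q n) (\<iota> n))
                   {\<omega>. two_nonsimilar_solutions n (\<iota> n) \<omega>}) \<longlonglongrightarrow> 1) \<and>
         (\<forall>\<epsilon>::real. \<epsilon> > 0 \<longrightarrow>
            (\<forall>\<^sub>F n in sequentially. real (q n) \<ge> (2 + \<epsilon>) * real n) \<longrightarrow>
            (\<lambda>n. measure_pmf.prob (random_puzzle n (q n) (\<iota> n))
                   {\<omega>. all_solutions_similar n (\<iota> n) \<omega>}) \<longlonglongrightarrow> 1) \<and>
         (filterlim (\<lambda>n. real (q n) / real n) at_top sequentially \<longrightarrow>
            (\<lambda>n. measure_pmf.prob (random_puzzle n (q n) (\<iota> n))
                   {\<omega>. unique_up_to_rotation n (\<iota> n) \<omega>}) \<longlonglongrightarrow> 1)"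
proof -
  have puzzle: "\<And>n. puzzle (q n) (\<iota> n)"
    using assms by unfold_locales
  show ?thesis
    by (intro conjI impI allI prob_two_nonsimilar_tendsto_1[OF puzzle] prob_all_similar_tendsto_1[OF puzzle]
      prob_unique_tendsto_1[OF puzzle])
qed

end
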